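(* Let $\mathcal{P}\subset\mathbb{R}^g$ be a closed bounded polytope. Suppose $\mathcal{P}$ has a two-dimensional face $F$ that is not a simplex. Then the extreme points of $F$ are not crucial free extreme points of $\mathcal{W}^{\max}(\mathcal{P})$. Furthermore, $\mathcal{W}^{\max}(\mathcal{P})$ has infinitely many free extreme points modulo unitary equivalence. As a consequence, if $0$ is in the interior of $\mathcal{P}$, then $\mathcal{W}^{\min}(\mathcal{P}^\bullet)$ is not a free spectrahedron.
   Context: All matrices are real. $SM_n(\mathbb{R})^g$ is the set of $g$-tuples of real symmetric $n\times n$ matrices, $SM(\mathbb{R})^g=\bigcup_{n\ge1}SM_n(\mathbb{R})^g$, and for $K\subseteq SM(\mathbb{R})^g$, $K(n)=K\cap SM_n(\mathbb{R})^g$. For a matrix $V$, $V^TXV=(V^TX_1V,\dots,V^TX_gV)$. $X\sim_u Y$ (unitarily equivalent) means $U^TXU=Y$ for some real orthogonal matrix $U$. Direct sums of tuples are coordinatewise. Points of $\mathbb{R}^g$ are identified with tuples in $SM_1(\mathbb{R})^g$. A matrix convex combination of elements of $K$ is a finite sum $\sum_{\ell=1}^m V_\ell^TX^\ell V_\ell$ with $X^\ell\in K(n_\ell)$, $V_\ell\in M_{n_\ell\times n}(\mathbb{R})$, $\sum_\ell V_\ell^TV_\ell=I_n$. The matrix convex hull $\mathrm{co}^{\mathrm{mat}}(K)$ is the set of all matrix convex combinations of elements of $K$; $K$ is matrix convex if $K=\mathrm{co}^{\mathrm{mat}}(K)$. Closures of subsets of $SM(\mathbb{R})^g$ are taken levelwise.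 For a closed convex set $C\subseteq\mathbb{R}^g$: the minimal matrix convex set over $C$ is $\mathcal{W}^{\min}(C)=\mathrm{co}^{\mathrm{mat}}(C)$; the maximal matrix convex set $\mathcal{W}^{\max}(C)$ over $C$ is the set of all $X\in SM(\mathbb{R})^g$ satisfying every affine inequality satisfied by $C$: if $a_0+\sum_ka_kx_k\ge0$ for all $x\in C$, then $a_0I+\sum_ka_kX_k\succeq0$. A point $X\in K(n)$ of a matrix convex set $K$ is a free extreme point of $K$ if whenever $X=\sum_{\ell=1}^m V_\ell^TY^\ell V_\ell$ is a matrix convex combination of $Y^\ell\in K(n_\ell)$ with every $V_\ell\ne0$, then for each $\ell$ either $n_\ell=n$ and $X\sim_uY^\ell$, or $n_\ell>n$ and there is $Z^\ell\in K$ with $X\oplus Z^\ell\sim_uY^\ell$. Write $\partial^{\mathrm{free}}K$ for the set of free extreme points. $X\in\partial^{\mathrm{free}}K$ is a crucial free extreme point of $K$ if $X\notin\overline{\mathrm{co}^{\mathrm{mat}}(\partial^{\mathrm{free}}K\setminus\{Y\in K:Y\sim_uX\})}$. A free spectrahedron is a set of the form $\mathcal{D}_A=\{X\in SM(\mathbb{R})^g:L_A(X)\succeq0\}$ for some $d$ and $A\in SM_d(\mathbb{R})^g$, where for $X\in SM_n(\mathbb{R})^g$, $L_A(X)=I_{dn}-A_1\otimes X_1-\dots-A_g\otimes X_g$. The polar dual of $\mathcal{P}$ is $\mathcal{P}^\bullet=\{x\in\mathbb{R}^g:1-\langle x,y\rangle\ge0\text{ for all }y\in\mathcal{P}\}$.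 A face of a convex set $C$ is a subset $F\subseteq C$ (here convex) such that whenever $x,y\in C$ and $tx+(1-t)y\in F$ for some $t\in(0,1)$, then $x,y\in F$; a two-dimensional face is not a simplex exactly when it is not a triangle. *)

theory Defs
  imports "HOL-Analysis.Analysis" "Jordan_Normal_Form.Matrix"
begin

no_notation Matrix.vec_index (infixl \<open>$\<close> 100)
no_notation Matrix.scalar_prod (infix \<open>\<bullet>\<close> 70)

text \<open>
  Points of Euclidean \<open>g\<close>-space have type \<^typ>\<open>real ^ 'g\<close>. Since the size of the matrices
  varies inside every definition below, a \<open>g\<close>-tuple of matrices is a function from \<^typ>\<open>'g\<close> to
  the matrices with explicit dimensions of \<open>Jordan_Normal_Form\<close>.
\<close>

type_synonym 'g mtuple = "'g \<Rightarrow> real Matrix.mat"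

text \<open>Matrices of different sizes share one type, so there is no generic \<open>0\<close>, and the
  type is not an instance of the class needed for \<^const>\<open>sum\<close>.\<close>

definition msum :: "nat \<Rightarrow> nat \<Rightarrow> ('i \<Rightarrow> real Matrix.mat) \<Rightarrow> 'i set \<Rightarrow> real Matrix.mat" where
  "msum r c M I = Matrix.mat r c (\<lambda>(i, j). \<Sum>s\<in>I. M s $$ (i, j))"

definition psd :: "real Matrix.mat \<Rightarrow> bool" where
  "psd M \<longleftrightarrow> square_mat M \<and> transpose_mat M = M \<and>
     (\<forall>v \<in> carrier_vec (dim_row M). 0 \<le> Matrix.scalar_prod v (M *\<^sub>v v))"

definition kron :: "real Matrix.mat \<Rightarrow> real Matrix.mat \<Rightarrow> real Matrix.mat" where
  "kron A B = Matrix.mat (dim_row A * dim_row B) (dim_col A * dim_col B)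
     (\<lambda>(i, j). A $$ (i div dim_row B, j div dim_col B) * B $$ (i mod dim_row B, j mod dim_col B))"

definition SMn :: "nat \<Rightarrow> 'g mtuple set" where
  "SMn n = {X. \<forall>k. X k \<in> carrier_mat n n \<and> transpose_mat (X k) = X k}"

definition SM :: "'g mtuple set" where
  "SM = (\<Union>n\<in>{1..}. SMn n)"

definition level :: "'g mtuple set \<Rightarrow> nat \<Rightarrow> 'g mtuple set" where
  "level K n = K \<inter> SMn n"

definition point_tuple :: "real ^ 'g \<Rightarrow> 'g mtuple" where
  "point_tuple x = (\<lambda>k. Matrix.mat 1 1 (\<lambda>_. x $ k))"

definition unitarily_equiv :: "('g mtuple \<times> 'g mtuple) set" where
  "unitarily_equiv = {(X, Y). \<exists>n\<ge>1. X \<in> SMn n \<and> Y \<in> SMn n \<and>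
     (\<exists>U \<in> carrier_mat n n. transpose_mat U * U = 1\<^sub>m n \<and> U * transpose_mat U = 1\<^sub>m n \<and>
        (\<forall>k. transpose_mat U * X k * U = Y k))}"

definition direct_sum :: "'g mtuple \<Rightarrow> 'g mtuple \<Rightarrow> 'g mtuple" where
  "direct_sum X Z = (\<lambda>k. four_block_mat
     (X k) (0\<^sub>m (dim_row (X k)) (dim_col (Z k)))
     (0\<^sub>m (dim_row (Z k)) (dim_col (X k))) (Z k))"

text \<open>\<open>mat_convex_comb K n m N V Y X\<close>: the \<open>n \<times> n\<close> tuple \<open>X\<close> is the matrix convex combination
  of the \<open>N l \<times> N l\<close> tuples \<open>Y l \<in> K\<close> with the \<open>N l \<times> n\<close> coefficients \<open>V l\<close>, for \<open>l < m\<close>.\<close>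

definition mat_convex_comb ::
  "'g mtuple set \<Rightarrow> nat \<Rightarrow> nat \<Rightarrow> (nat \<Rightarrow> nat) \<Rightarrow> (nat \<Rightarrow> real Matrix.mat) \<Rightarrow> (nat \<Rightarrow> 'g mtuple)
     \<Rightarrow> 'g mtuple \<Rightarrow> bool" where
  "mat_convex_comb K n m N V Y X \<longleftrightarrow>
     (\<forall>l<m. 1 \<le> N l \<and> Y l \<in> level K (N l) \<and> V l \<in> carrier_mat (N l) n) \<and>
     msum n n (\<lambda>l. transpose_mat (V l) * V l) {..<m} = 1\<^sub>m n \<and>
     X = (\<lambda>k. msum n n (\<lambda>l. transpose_mat (V l) * Y l k * V l) {..<m})"

definition co_mat :: "'g mtuple set \<Rightarrow> 'g mtuple set" where
  "co_mat K = {X. \<exists>n\<ge>1. \<exists>m N V Y. mat_convex_comb K n m N V Y X}"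

definition level_closure :: "'g mtuple set \<Rightarrow> 'g mtuple set" where
  "level_closure K = {X. \<exists>n\<ge>1. X \<in> SMn n \<and>
     (\<forall>e>0. \<exists>Y \<in> level K n. \<forall>k. \<forall>i<n. \<forall>j<n. \<bar>Y k $$ (i, j) - X k $$ (i, j)\<bar> < e)}"

definition Wmin :: "(real ^ 'g) set \<Rightarrow> 'g mtuple set" where
  "Wmin C = co_mat (point_tuple ` C)"

definition Wmax :: "(real ^ 'g::finite) set \<Rightarrow> 'g mtuple set" where
  "Wmax C = {X. \<exists>n\<ge>1. X \<in> SMn n \<and>
     (\<forall>(a0::real) (a::real ^ 'g). (\<forall>x\<in>C. 0 \<le> a0 + (\<Sum>k\<in>UNIV. a $ k * x $ k)) \<longrightarrow>
        psd (a0 \<cdot>\<^sub>m 1\<^sub>m n + msum n n (\<lambda>k. a $ k \<cdot>\<^sub>m X k) UNIV))}"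

definition free_extreme :: "'g mtuple set \<Rightarrow> 'g mtuple set" where
  "free_extreme K = {X. \<exists>n\<ge>1. X \<in> level K n \<and>
     (\<forall>m N V Y. mat_convex_comb K n m N V Y X \<and> (\<forall>l<m. V l \<noteq> 0\<^sub>m (N l) n) \<longrightarrow>
        (\<forall>l<m. (N l = n \<and> (X, Y l) \<in> unitarily_equiv) \<or>
               (N l > n \<and> (\<exists>Z\<in>K. (direct_sum X Z, Y l) \<in> unitarily_equiv))))}"

definition crucial_free_extreme :: "'g mtuple set \<Rightarrow> 'g mtuple set" where
  "crucial_free_extreme K = {X \<in> free_extreme K.
     X \<notin> level_closure (co_mat (free_extreme K - {Y \<in> K. (Y, X) \<in> unitarily_equiv}))}"

definition free_spectrahedron_of :: "nat \<Rightarrow> 'g::finite mtuple \<Rightarrow> 'g mtuple set" where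
  "free_spectrahedron_of d A = {X. \<exists>n\<ge>1. X \<in> SMn n \<and>
     psd (1\<^sub>m (d * n) - msum (d * n) (d * n) (\<lambda>k. kron (A k) (X k)) UNIV)}"

definition is_free_spectrahedron :: "'g::finite mtuple set \<Rightarrow> bool" where
  "is_free_spectrahedron K \<longleftrightarrow> (\<exists>d\<ge>1. \<exists>A \<in> SMn d. K = free_spectrahedron_of d A)"

definition polar_dual :: "(real ^ 'g::finite) set \<Rightarrow> (real ^ 'g) set" where
  "polar_dual P = {x. \<forall>y\<in>P. 0 \<le> 1 - x \<bullet> y}"

end

theory Submission
  imports Defs
begin

text \<open>
  Free extreme points arise from Arveson points, the points of the maximal matrix convex set \<open>W\<close>
  over \<open>P\<close> that have no nontrivial dilation in \<open>W\<close>. Every point of \<open>W\<close> is a corner of an Arveson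
  point: bordering it with a maximal multiple of a dilation direction strictly decreases the space
  of dilation directions. An Arveson point splits into irreducible ones, and these are free extreme,
  because a coefficient \<open>V\<close> of a matrix convex combination representing an Arveson point intertwines,
  so that irreducibility makes \<open>V\<^sup>T V\<close> scalar.

  Now let \<open>x\<close> be a vertex of the polygon \<open>F\<close>. As \<open>F\<close> is not a triangle, it has a vertex \<open>p\<close> both of
  whose edges miss \<open>x\<close>. Any \<open>z\<close> in the relative interior of \<open>F\<close> is a corner of some \<open>2 \<times> 2\<close> point of
  \<open>W\<close> on which the functionals \<open>u\<close>, \<open>v\<close> exposing these edges vanish at two independent vectors. Since
  \<open>u\<close> and \<open>v\<close> are positive at \<open>x\<close>, the point \<open>x\<close> cannot occur in a representation of this point,
      so \<open>z\<close> is
  generated by the other free extreme points. Letting \<open>z\<close> tend to \<open>x\<close> shows that \<open>x\<close> is not crucial.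
  If there were only finitely many classes, a functional exposing \<open>x\<close> would be bounded below by a
  positive number on all of them except \<open>x\<close>, hence at \<open>z\<close>. Finally, if \<open>A\<close> defined the minimal matrix
  convex set over the polar dual, then \<open>A\<close> would lie in \<open>W\<close>, and a combination of \<open>u\<close>, \<open>v\<close> and the
  functional exposing \<open>x\<close> would be nonnegative on \<open>A\<close> but negative on the \<open>2 \<times> 2\<close> point.
\<close>

section \<open>Quadratic forms of matrices with vector entries\<close>

text \<open>That \<open>P\<close> is a polytope makes finitely many affine functionals generate its
  dual cone. A perturbation that is harmless for each of them at all small parameters is then
  harmless for all at one parameter; borders and \<open>2 \<times> 2\<close> points both arise so.
  With \<open>z = p + a (p' - p) + b (p'' - p)\<close>, \<open>f = (0, 1)\<close> and
  \<open>w = (t, -1)\<close>, the \<open>2 \<times> 2\<close> point is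
  \<open>p I + a (p' - p) w w^T + b (p'' - p) f f^T\<close>. At \<open>t = 0\<close> it is diagonal
  with entries \<open>p\<close> and \<open>z\<close>. A small \<open>t > 0\<close> tilts it:
  \<open>u\<close>, which kills \<open>p\<close> and \<open>p'\<close>, gets the kernel vector
  \<open>(1, 0)\<close>, and \<open>v\<close>, which kills \<open>p\<close> and \<open>p''\<close>,
  gets \<open>(1, t)\<close>. In a triangle any two vertices share an edge, so one of
  \<open>u\<close>, \<open>v\<close> would vanish at \<open>x\<close>. In the polar statement the
  functionals form a \<open>2 \<times> 2\<close> matrix. It is nonnegative on \<open>A\<close>
  because \<open>A\<close> splits into copies of \<open>x\<close>, where \<open>u\<close> and
  \<open>v\<close> are positive, and a complement, where the functional exposing \<open>x\<close> is
  bounded away from 0. Membership in the minimal set would make it a sum of functionals of the dual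
  cone with rank one weights, hence nonnegative on the \<open>2 \<times> 2\<close> point.\<close>

text \<open>A tuple of \<open>n \<times> n\<close> matrices is handled as one matrix \<open>X :: nat \<Rightarrow> nat \<Rightarrow> 'a\<close> whose
  entries, for indices below \<open>n\<close>, are points of the Euclidean space; entries at other indices are
  irrelevant. The first component of \<open>hform n X v w\<close> is the inner product of \<open>v\<close> and \<open>w\<close>, so that an
  affine functional \<open>x \<mapsto> fst h + snd h \<bullet> x\<close> acts on \<open>X\<close> through \<open>h \<bullet> hform n X v w\<close>.\<close>

definition ip :: "nat \<Rightarrow> (nat \<Rightarrow> real) \<Rightarrow> (nat \<Rightarrow> real) \<Rightarrow> real" where
  "ip n v w = (\<Sum>i<n. v i * w i)"

definition vform :: "nat \<Rightarrow> (nat \<Rightarrow> nat \<Rightarrow> 'a::real_vector) \<Rightarrow> (nat \<Rightarrow> real) \<Rightarrow> (nat \<Rightarrow> real) \<Rightarrow> 'a" where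
  "vform n X v w = (\<Sum>i<n. \<Sum>j<n. (v i * w j) *\<^sub>R X i j)"

definition hform :: "nat \<Rightarrow> (nat \<Rightarrow> nat \<Rightarrow> 'a::real_vector) \<Rightarrow> (nat \<Rightarrow> real) \<Rightarrow> (nat \<Rightarrow> real) \<Rightarrow> real \<times>
    'a" where
  "hform n X v w = (ip n v w, vform n X v w)"

definition unitv :: "nat \<Rightarrow> nat \<Rightarrow> real" where
  "unitv k = (\<lambda>i. of_bool (i = k))"

definition symm :: "nat \<Rightarrow> (nat \<Rightarrow> nat \<Rightarrow> 'a) \<Rightarrow> bool" where
  "symm n X \<longleftrightarrow> (\<forall>i<n. \<forall>j<n. X i j = X j i)"

definition lin :: "nat \<Rightarrow> (nat \<Rightarrow> 'a::real_vector) \<Rightarrow> (nat \<Rightarrow> real) \<Rightarrow> 'a" where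
  "lin n b v = (\<Sum>i<n. v i *\<^sub>R b i)"

definition app :: "nat \<Rightarrow> (nat \<Rightarrow> nat \<Rightarrow> real) \<Rightarrow> (nat \<Rightarrow> real) \<Rightarrow> nat \<Rightarrow> real" where
  "app n V v = (\<lambda>i. \<Sum>j<n. V i j * v j)"

definition tapp :: "nat \<Rightarrow> (nat \<Rightarrow> nat \<Rightarrow> real) \<Rightarrow> (nat \<Rightarrow> real) \<Rightarrow> nat \<Rightarrow> real" where
  "tapp N V w = (\<lambda>j. \<Sum>i<N. V i j * w i)"

lemma ip_left: "ip n (\<lambda>i. v i + s * v' i) w = ip n v w + s * ip n v' w"
  by (simp add: ip_def sum.distrib sum_distrib_left algebra_simps)

lemma ip_commute: "ip n v w = ip n w v"
  by (simp add: ip_def mult.commute)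

lemma ip_right: "ip n w (\<lambda>i. v i + s * v' i) = ip n w v + s * ip n w v'"
  using ip_left[of n v s v' w] by (simp add: ip_commute)

lemma ip_nonneg: "0 \<le> ip n v v"
  by (simp add: ip_def sum_nonneg)

lemma ip_eq_0_iff: "ip n v v = 0 \<longleftrightarrow> (\<forall>i<n. v i = 0)"
  by (auto simp: ip_def sum_nonneg_eq_0_iff)

lemma vform_left: "vform n X (\<lambda>i. v i + s * v' i) w = vform n X v w + s *\<^sub>R vform n X v' w"
  by (simp add: vform_def sum.distrib scaleR_sum_right algebra_simps)

lemma vform_right: "vform n X w (\<lambda>i. v i + s * v' i) = vform n X w v + s *\<^sub>R vform n X w v'"
  by (simp add: vform_def sum.distrib scaleR_sum_right algebra_simps)

lemma hform_left: "hform n X (\<lambda>i. v i + s * v' i) w = hform n X v w + s *\<^sub>R hform n X v' w"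
  by (simp add: hform_def ip_left vform_left)

lemma hform_right: "hform n X w (\<lambda>i. v i + s * v' i) = hform n X w v + s *\<^sub>R hform n X w v'"
  by (simp add: hform_def ip_right vform_right)

lemma hform_zero [simp]: "hform n X (\<lambda>i. 0) w = 0" "hform n X w (\<lambda>i. 0) = 0"
  by (simp_all add: hform_def ip_def vform_def zero_prod_def)

lemma hform_scale: "hform n X (\<lambda>i. s * v i) w = s *\<^sub>R hform n X v w"
  "hform n X w (\<lambda>i. s * v i) = s *\<^sub>R hform n X w v"
  using hform_left[of n X "\<lambda>i. 0" s v w] hform_right[of n X w "\<lambda>i. 0" s v] by simp_all

lemma hform_sum: "hform n X (\<lambda>i. \<Sum>k\<in>K. c k * v k i) w = (\<Sum>k\<in>K. c k *\<^sub>R hform n X (v k) w)"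
proof (induction K rule: infinite_finite_induct)
  case (insert a K)
  have eq: "(\<lambda>i. \<Sum>k\<in>insert a K. c k * v k i) = (\<lambda>i. (\<Sum>k\<in>K. c k * v k i) + c a * v a i)"
    using insert.hyps by (simp add: add.commute)
  show ?case unfolding eq hform_left using insert by (simp add: add.commute)
qed simp_all

lemma vform_sym: "symm n X \<Longrightarrow> vform n X v w = vform n X w v"
  unfolding vform_def symm_def
  by (subst sum.swap) (auto intro!: sum.cong simp: mult.commute)

lemma hform_sym: "symm n X \<Longrightarrow> hform n X v w = hform n X w v"
  by (simp add: hform_def ip_commute[of n v w] vform_sym)

lemma vform_row: "vform n X v w = (\<Sum>i<n. v i *\<^sub>R (\<Sum>j<n. w j *\<^sub>R X i j))"
  by (simp add: vform_def scaleR_sum_right)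

lemma hform_cong:
  assumes "\<And>i j. i < n \<Longrightarrow> j < n \<Longrightarrow> X i j = X' i j" "\<And>i. i < n \<Longrightarrow> v i = v' i" "\<And>i. i < n \<Longrightarrow> w i = w' i"
  shows "hform n X v w = hform n X' v' w'"
  using assms by (auto simp: hform_def ip_def vform_def intro!: sum.cong)

lemma sum_unitv: "i < n \<Longrightarrow> (\<Sum>k<n. unitv i k *\<^sub>R f k) = (f i :: 'a::real_vector)"
  unfolding unitv_def
  by (subst sum.mono_neutral_right[of _ "{i}"]) auto

lemma sum_unitv_real [simp]: "i < n \<Longrightarrow> (\<Sum>k<n. unitv i k * f k) = (f i :: real)"
  "i < n \<Longrightarrow> (\<Sum>k<n. f k * unitv i k) = (f i :: real)"
  using sum_unitv[of i n f] by (simp_all add: mult.commute)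

lemma hform_unitv: "i < n \<Longrightarrow> j < n \<Longrightarrow> hform n X (unitv i) (unitv j) = (of_bool (i = j), X i j)"
  by (auto simp: hform_def ip_def vform_row sum_unitv) (auto simp: unitv_def)

lemma lin_add: "lin n (\<lambda>i. b i + s *\<^sub>R b' i) v = lin n b v + s *\<^sub>R lin n b' v"
  by (simp add: lin_def sum.distrib scaleR_sum_right algebra_simps)

lemma lin_scale: "lin n (\<lambda>i. s *\<^sub>R b i) v = s *\<^sub>R lin n b v"
  by (simp add: lin_def scaleR_sum_right algebra_simps)

lemma app_linear: "app n V (\<lambda>i. v i + s * w i) = (\<lambda>i. app n V v i + s * app n V w i)"
  by (rule ext) (simp add: app_def sum.distrib sum_distrib_left algebra_simps)

lemma ip_app: "ip N w (app n V v) = ip n (tapp N V w) v"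
  unfolding ip_def app_def tapp_def
  by (simp add: sum_distrib_left sum_distrib_right, subst sum.swap) (simp add: mult_ac)

lemma vec_expand: "(\<Sum>k<n. v k * unitv k i) = (if i < n then v i else 0)"
  by (simp add: unitv_def of_bool_def if_distrib cong: if_cong)

section \<open>Nonnegative quadratics and the Cauchy-Schwarz inequality\<close>

lemma discriminant_bound:
  fixes a b c :: real
  assumes "0 \<le> c" "\<And>s. 0 \<le> a + 2 * s * b + s\<^sup>2 * c"
  shows "b\<^sup>2 \<le> a * c"
proof (cases "c = 0")
  case True
  have "b = 0"
  proof (rule ccontr)
    assume "b \<noteq> 0"
    \<comment> \<open>With \<open>c = 0\<close> the expression is affine in \<open>s\<close>, and
      this \<open>s\<close> gives the value -1.\<close>
    then show False using assms(2)[of "- (a + 1) / (2 * b)"] True by (simp add: field_simps)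
  qed
  then show ?thesis using True by simp
next
  case False
  then have "c > 0" using assms(1) by simp
  then show ?thesis using assms(2)[of "- b / c"] by (simp add: field_simps power2_eq_square)
qed

lemma quadratic_nonneg:
  fixes a b c :: real
  assumes "0 \<le> a" "0 \<le> c" "b\<^sup>2 \<le> a * c"
  shows "0 \<le> a + 2 * s * b + s\<^sup>2 * c"
proof (cases "c = 0")
  case True
  then show ?thesis using assms by simp
next
  case False
  then have "c > 0" using assms by simp
  have "0 \<le> (s * c + b)\<^sup>2 + (a * c - b\<^sup>2)" using assms by simp
  also have "\<dots> = c * (a + 2 * s * b + s\<^sup>2 * c)" by (simp add: power2_eq_square algebra_simps)
  finally show ?thesis using \<open>c > 0\<close> by (simp add: zero_le_mult_iff)
qed

lemma hform_quad:
  assumes "symm n X"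
  shows "hform n X (\<lambda>i. v i + s * w i) (\<lambda>i. v i + s * w i)
    = hform n X v v + (2 * s) *\<^sub>R hform n X v w + s\<^sup>2 *\<^sub>R hform n X w w"
  using hform_sym[OF assms, of w v]
  by (simp add: hform_left hform_right scaleR_right_distrib power2_eq_square flip: scaleR_2)

lemma hform_cauchy_schwarz:
  assumes "symm n X" "\<And>v. 0 \<le> h \<bullet> hform n X v v"
  shows "(h \<bullet> hform n X v w)\<^sup>2 \<le> (h \<bullet> hform n X v v) * (h \<bullet> hform n X w w)"
proof (rule discriminant_bound[OF assms(2)])
  fix s
  show "0 \<le> h \<bullet> hform n X v v + 2 * s * (h \<bullet> hform n X v w) + s\<^sup>2 * (h \<bullet> hform n X w w)"
    using assms(2)[of "\<lambda>i. v i + s * w i"] hform_quad[OF assms(1), of v s w]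
    by (simp add: inner_add_right)
qed

section \<open>The maximal matrix convex set over a polytope\<close>

text \<open>Affine functionals are stored as pairs, with value \<open>h \<bullet> (1, p)\<close> at
  \<open>p\<close>. The nonnegative ones form the dual of the cone over
  \<open>{1} \<times> P\<close>.\<close>

definition dual_cone :: "'a::euclidean_space set \<Rightarrow> (real \<times> 'a) set" where
  "dual_cone P = {h. \<forall>p\<in>P. 0 \<le> h \<bullet> (1, p)}"

text \<open>Level \<open>n\<close> of the maximal matrix convex set in coordinates;
  \<open>Wmax_iff\<close> and \<open>tuple_Wmax\<close> translate to matrices.\<close>

definition wmax :: "'a::euclidean_space set \<Rightarrow> nat \<Rightarrow> (nat \<Rightarrow> nat \<Rightarrow> 'a) \<Rightarrow> bool" where
  "wmax P n X \<longleftrightarrow> symm n X \<and> (\<forall>h\<in>dual_cone P. \<forall>v. 0 \<le> h \<bullet> hform n X v v)"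

lemma wmaxD: "wmax P n X \<Longrightarrow> h \<in> dual_cone P \<Longrightarrow> 0 \<le> h \<bullet> hform n X v v"
  by (simp add: wmax_def)

lemma wmax_symm: "wmax P n X \<Longrightarrow> symm n X"
  by (simp add: wmax_def)

lemma wmax_cauchy_schwarz:
  "wmax P n X \<Longrightarrow> h \<in> dual_cone P \<Longrightarrow>
    (h \<bullet> hform n X v w)\<^sup>2 \<le> (h \<bullet> hform n X v v) * (h \<bullet> hform n X w w)"
  by (rule hform_cauchy_schwarz) (auto simp: wmax_def)

lemma wmax_kernel:
  assumes "wmax P n X" "h \<in> dual_cone P" "h \<bullet> hform n X v v = 0"
  shows "h \<bullet> hform n X v w = 0"
  using wmax_cauchy_schwarz[OF assms(1,2), of v w] assms(3) by simp

text \<open>Nonnegativity on \<open>P\<close> need only be tested on a finite set with hull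
  \<open>P\<close>, so the cone is polyhedral. Cut by a cube it becomes a polytope, and finitely
  many points with that hull generate the cone by rescaling.\<close>

lemma dual_cone_finitely_generated:
  fixes P :: "'a::euclidean_space set"
  assumes "polytope P"
  obtains J where "finite J" "J \<subseteq> dual_cone P"
    "\<And>h. h \<in> dual_cone P \<Longrightarrow> \<exists>c. (\<forall>j\<in>J. 0 \<le> c j) \<and> h = (\<Sum>j\<in>J. c j *\<^sub>R (j :: real \<times> 'a))"
proof -
  obtain E where E: "finite E" "P = convex hull E"
    using assms unfolding polytope_def by blast
  have H: "dual_cone P = (\<Inter>e\<in>E. {h. 0 \<le> (1, e) \<bullet> h})"
  proof (intro equalityI subsetI)
    fix h assume "h \<in> dual_cone P"
    then show "h \<in> (\<Inter>e\<in>E. {h. 0 \<le> (1, e) \<bullet> h})"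
      using E hull_subset[of E convex] by (auto simp: dual_cone_def inner_commute)
  next
    fix h :: "real \<times> 'a" assume h: "h \<in> (\<Inter>e\<in>E. {h. 0 \<le> (1, e) \<bullet> h})"
    have "{p. 0 \<le> fst h + snd h \<bullet> p} = {p. - fst h \<le> snd h \<bullet> p}" by auto
    then have "convex {p. 0 \<le> fst h + snd h \<bullet> p}" by (simp add: convex_halfspace_ge)
    then have "P \<subseteq> {p. 0 \<le> fst h + snd h \<bullet> p}"
      unfolding E(2) using h by (intro hull_minimal) (auto simp: inner_prod_def inner_commute)
    then show "h \<in> dual_cone P" by (auto simp: dual_cone_def inner_prod_def)
  qed
  have "polyhedron (dual_cone P)" unfolding H
    using E(1) by (intro polyhedron_Inter) (auto intro: polyhedron_halfspace_ge)
  then have "polyhedron (dual_cone P \<inter> cbox (- One) One)"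
    by (intro polyhedron_Int polytope_imp_polyhedron[OF polytope_interval])
  then have "polytope (dual_cone P \<inter> cbox (- One) One)"
    by (simp add: polytope_eq_bounded_polyhedron bounded_Int)
  then obtain J where J: "finite J" "dual_cone P \<inter> cbox (- One) One = convex hull J"
    unfolding polytope_def by blast
  show ?thesis
  proof (rule that[OF J(1)])
    show "J \<subseteq> dual_cone P" using J(2) hull_subset[of J convex] by blast
    fix h assume h: "h \<in> dual_cone P"
    \<comment> \<open>Dividing by \<open>norm h + 1\<close> brings \<open>h\<close> into the cube;
      the \<open>+ 1\<close> covers \<open>h = 0\<close>.\<close>
    define s where "s = 1 / (norm h + 1)"
    have s: "s > 0" unfolding s_def by (simp add: add_nonneg_pos)
    have "norm (s *\<^sub>R h) \<le> 1" unfolding s_def by (simp add: divide_simps add_nonneg_pos)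
    then have "\<bar>(s *\<^sub>R h) \<bullet> i\<bar> \<le> 1" if "i \<in> Basis" for i
      using Basis_le_norm[OF that, of "s *\<^sub>R h"] by linarith
    then have "s *\<^sub>R h \<in> cbox (- One) One"
      unfolding mem_box by (auto simp: abs_le_iff inner_minus_left)
    moreover have "s *\<^sub>R h \<in> dual_cone P" using h s by (simp add: dual_cone_def)
    ultimately have "s *\<^sub>R h \<in> convex hull J" using J(2) by blast
    then obtain c where c: "\<forall>x\<in>J. 0 \<le> c x" "s *\<^sub>R h = (\<Sum>x\<in>J. c x *\<^sub>R x)"
      unfolding convex_hull_finite[OF J(1)] by auto
    have "h = (1/s) *\<^sub>R (s *\<^sub>R h)" using s by simp
    also have "\<dots> = (\<Sum>x\<in>J. (c x / s) *\<^sub>R x)" unfolding c(2) by (simp add: scaleR_sum_right)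
    finally show "\<exists>c. (\<forall>j\<in>J. 0 \<le> c j) \<and> h = (\<Sum>j\<in>J. c j *\<^sub>R j)"
      using c(1) s by (intro exI[of _ "\<lambda>x. c x / s"]) auto
  qed
qed

text \<open>This supplies the uniformity needed for perturbations: what holds for all small
  parameters can be had for finitely many functionals at once.\<close>

lemma wmax_finite_test:
  fixes P :: "'a::euclidean_space set"
  assumes "polytope P"
  obtains J where "finite J" "J \<subseteq> dual_cone P"
    "\<And>n X. symm n X \<Longrightarrow> (\<And>h v. h \<in> J \<Longrightarrow> 0 \<le> h \<bullet> hform n X v v) \<Longrightarrow> wmax P n X"
proof -
  obtain J where J: "finite J" "J \<subseteq> dual_cone P"
    "\<And>h. h \<in> dual_cone P \<Longrightarrow> \<exists>c. (\<forall>j\<in>J. 0 \<le> c j) \<and> h = (\<Sum>j\<in>J. c j *\<^sub>R (j :: real \<times> 'a))"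
    by (rule dual_cone_finitely_generated[OF assms]) blast
  show ?thesis
  proof (rule that[OF J(1,2)])
    fix n and X :: "nat \<Rightarrow> nat \<Rightarrow> 'a"
    assume X: "symm n X" "\<And>h v. h \<in> J \<Longrightarrow> 0 \<le> h \<bullet> hform n X v v"
    show "wmax P n X" unfolding wmax_def
    proof (intro conjI ballI allI X(1))
      fix h v assume "h \<in> dual_cone P"
      then obtain c where "\<forall>j\<in>J. 0 \<le> c j" "h = (\<Sum>j\<in>J. c j *\<^sub>R j)" using J(3) by blast
      then show "0 \<le> h \<bullet> hform n X v v"
        using X(2) by (auto simp: inner_sum_left intro!: sum_nonneg)
    qed
  qed
qed

text \<open>The segment from \<open>p\<close> to \<open>z\<close> can be prolonged slightly beyond
  \<open>z\<close> inside \<open>P\<close>; an affine function that is zero at \<open>z\<close> and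
  positive at \<open>p\<close> would be negative there.\<close>

lemma dual_cone_vanish:
  assumes "h \<in> dual_cone P" "convex P" "z \<in> rel_interior P" "h \<bullet> (1, z) = 0" "p \<in> P"
  shows "h \<bullet> (1, p) = 0"
proof -
  have "P \<noteq> {}" using assms(5) by blast
  then obtain e where e: "e > 1" "(1 - e) *\<^sub>R p + e *\<^sub>R z \<in> P"
    using assms convex_rel_interior_iff[of P z] by blast
  have "h \<bullet> (1, (1 - e) *\<^sub>R p + e *\<^sub>R z) = (1 - e) * (h \<bullet> (1, p)) + e * (h \<bullet> (1, z))"
    by (cases h) (simp add: inner_add_right algebra_simps)
  then have "0 \<le> (1 - e) * (h \<bullet> (1, p))" using assms e by (auto simp: dual_cone_def)
  moreover have "0 \<le> h \<bullet> (1, p)" using assms by (simp add: dual_cone_def)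
  ultimately show ?thesis using e(1) by (smt (verit) mult_neg_pos)
qed

lemma wmax_combination:
  assumes "\<And>l. l < m \<Longrightarrow> wmax P (N l) (Y l)"
    and X: "\<And>v w. hform n X v w = (\<Sum>l<m. hform (N l) (Y l) (A l v) (A l w))"
  shows "wmax P n X"
  unfolding wmax_def
proof (intro conjI ballI allI)
  show "symm n X" unfolding symm_def
  proof (intro allI impI)
    fix i j assume ij: "i < n" "j < n"
    have "hform n X (unitv i) (unitv j) = hform n X (unitv j) (unitv i)"
      unfolding X using assms(1) by (intro sum.cong refl hform_sym) (auto simp: wmax_def)
    then show "X i j = X j i" using ij by (simp add: hform_unitv)
  qed
  fix h v assume "h \<in> dual_cone P"
  then show "0 \<le> h \<bullet> hform n X v v"
    unfolding X inner_sum_right using assms(1) by (intro sum_nonneg) (auto simp: wmax_def)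
qed

lemma wmax_compression:
  assumes "wmax P N Y" "\<And>v w. hform n X v w = hform N Y (A v) (A w)"
  shows "wmax P n X"
  by (rule wmax_combination[of "Suc 0" P "\<lambda>_. N" "\<lambda>_. Y" n X "\<lambda>_. A"]) (auto simp: assms)

section \<open>Arveson dilations\<close>

definition bordered :: "nat \<Rightarrow> (nat \<Rightarrow> nat \<Rightarrow> 'a) \<Rightarrow> (nat \<Rightarrow> 'a) \<Rightarrow> 'a \<Rightarrow> nat \<Rightarrow> nat \<Rightarrow> 'a" where
  "bordered n X b y = (\<lambda>i j. if i < n then (if j < n then X i j else b i)
                             else (if j < n then b j else y))"

lemma symm_bordered: "symm n X \<Longrightarrow> symm (Suc n) (bordered n X b y)"
  by (auto simp: symm_def bordered_def less_Suc_eq)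

lemma hform_bordered:
  "hform (Suc n) (bordered n X b y) v w =
    hform n X v w + (v n * w n) *\<^sub>R (1, y) + (0, w n *\<^sub>R lin n b v + v n *\<^sub>R lin n b w)"
proof -
  have "vform (Suc n) (bordered n X b y) v w
     = (\<Sum>i<n. (\<Sum>j<n. (v i * w j) *\<^sub>R X i j) + (v i * w n) *\<^sub>R b i) + ((\<Sum>j<n. (v n * w j) *\<^sub>R b j)
         + (v n * w n) *\<^sub>R y)"
    by (simp add: vform_def bordered_def)
  then show ?thesis
    by (simp add: hform_def ip_def vform_def lin_def sum.distrib scaleR_sum_right mult.commute)
qed

lemma inner_hform_bordered:
  "h \<bullet> hform (Suc n) (bordered n X b y) v v =
    h \<bullet> hform n X v v + 2 * v n * (snd h \<bullet> lin n b v) + (v n)\<^sup>2 * (h \<bullet> (1, y))"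
  by (cases h) (simp add: hform_bordered inner_add_right power2_eq_square algebra_simps)

text \<open>The directions in which \<open>X\<close> can be bordered inside the maximal matrix convex set, up to
  a scalar factor, expressed by the Schur complement condition.\<close>

definition dil_dir :: "'a::euclidean_space set \<Rightarrow> nat \<Rightarrow> (nat \<Rightarrow> nat \<Rightarrow> 'a) \<Rightarrow> (nat \<Rightarrow> 'a) \<Rightarrow> bool" where
  "dil_dir P n X b \<longleftrightarrow> (\<forall>h\<in>dual_cone P. \<exists>c. \<forall>v. (snd h \<bullet> lin n b v)\<^sup>2 \<le> c * (h \<bullet> hform n X v v))"

text \<open>Dilations are excluded through directions rather than borders: directions form a linear
  space, and each of them is, up to scaling, the off-diagonal part of an actual border by
  \<open>bordered_exists\<close>.\<close>

definition arveson :: "'a::euclidean_space set \<Rightarrow> nat \<Rightarrow> (nat \<Rightarrow> nat \<Rightarrow> 'a) \<Rightarrow> bool" where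
  "arveson P n X \<longleftrightarrow> wmax P n X \<and> (\<forall>b. dil_dir P n X b \<longrightarrow> (\<forall>i<n. b i = 0))"

section \<open>The linear space of dilation directions\<close>

lemma dil_dirE:
  assumes "dil_dir P n X b" "wmax P n X" "h \<in> dual_cone P"
  obtains c where "c \<ge> 0" "\<And>v. (snd h \<bullet> lin n b v)\<^sup>2 \<le> c * (h \<bullet> hform n X v v)"
proof -
  obtain c where c: "\<And>v. (snd h \<bullet> lin n b v)\<^sup>2 \<le> c * (h \<bullet> hform n X v v)"
    using assms unfolding dil_dir_def by blast
  show ?thesis
  proof (rule that[of "\<bar>c\<bar>"])
    fix v
    have "c * (h \<bullet> hform n X v v) \<le> \<bar>c\<bar> * (h \<bullet> hform n X v v)"
      using wmaxD[OF assms(2,3)] by (intro mult_right_mono) auto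
    then show "(snd h \<bullet> lin n b v)\<^sup>2 \<le> \<bar>c\<bar> * (h \<bullet> hform n X v v)"
      using c[of v] by linarith
  qed simp
qed

text \<open>The inequality \<open>(x + y)^2 \<le> 2 x^2 + 2 y^2\<close> combines the two
  bounds.\<close>

lemma dil_dir_combine:
  assumes "dil_dir P n X b" "dil_dir P n X b'" "wmax P n X"
  shows "dil_dir P n X (\<lambda>i. b i + s *\<^sub>R b' i)"
  unfolding dil_dir_def
proof
  fix h assume h: "h \<in> dual_cone P"
  obtain c where c: "\<And>v. (snd h \<bullet> lin n b v)\<^sup>2 \<le> c * (h \<bullet> hform n X v v)"
    using dil_dirE[OF assms(1,3) h] by blast
  obtain c' where c': "\<And>v. (snd h \<bullet> lin n b' v)\<^sup>2 \<le> c' * (h \<bullet> hform n X v v)"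
    using dil_dirE[OF assms(2,3) h] by blast
  show "\<exists>c. \<forall>v. (snd h \<bullet> lin n (\<lambda>i. b i + s *\<^sub>R b' i) v)\<^sup>2 \<le> c * (h \<bullet> hform n X v v)"
  proof (intro exI[of _ "2 * c + 2 * s\<^sup>2 * c'"] allI)
    fix v
    have "(snd h \<bullet> lin n (\<lambda>i. b i + s *\<^sub>R b' i) v)\<^sup>2
        = (snd h \<bullet> lin n b v + s * (snd h \<bullet> lin n b' v))\<^sup>2"
      by (simp add: lin_add inner_add_right)
    also have "\<dots> \<le> 2 * (snd h \<bullet> lin n b v)\<^sup>2 + 2 * s\<^sup>2 * (snd h \<bullet> lin n b' v)\<^sup>2"
      using zero_le_power2[of "snd h \<bullet> lin n b v - s * (snd h \<bullet> lin n b' v)"]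
      by (simp add: power2_eq_square algebra_simps)
    also have "\<dots> \<le> 2 * (c * (h \<bullet> hform n X v v)) + 2 * s\<^sup>2 * (c' * (h \<bullet> hform n X v v))"
      using c[of v] c'[of v] by (intro add_mono mult_left_mono) auto
    finally show "(snd h \<bullet> lin n (\<lambda>i. b i + s *\<^sub>R b' i) v)\<^sup>2
        \<le> (2 * c + 2 * s\<^sup>2 * c') * (h \<bullet> hform n X v v)" by (simp add: algebra_simps)
  qed
qed

lemma dil_dir_scale:
  assumes "dil_dir P n X b"
  shows "dil_dir P n X (\<lambda>i. s *\<^sub>R b i)"
  unfolding dil_dir_def
proof
  fix h assume h: "h \<in> dual_cone P"
  then obtain c where c: "\<And>v. (snd h \<bullet> lin n b v)\<^sup>2 \<le> c * (h \<bullet> hform n X v v)"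
    using assms by (auto simp: dil_dir_def)
  then have "\<forall>v. (snd h \<bullet> lin n (\<lambda>i. s *\<^sub>R b i) v)\<^sup>2 \<le> s\<^sup>2 * c * (h \<bullet> hform n X v v)"
    by (simp add: lin_scale power_mult_distrib mult.assoc mult_left_mono)
  then show "\<exists>c. \<forall>v. (snd h \<bullet> lin n (\<lambda>i. s *\<^sub>R b i) v)\<^sup>2 \<le> c * (h \<bullet> hform n X v v)" by blast
qed

text \<open>Test vectors padded by 0 at index \<open>n\<close> do not see the border.\<close>

lemma dil_dir_restrict:
  assumes "dil_dir P (Suc n) (bordered n X b y) d"
  shows "dil_dir P n X d"
  unfolding dil_dir_def
proof
  fix h assume "h \<in> dual_cone P"
  then obtain c where c: "\<And>v. (snd h \<bullet> lin (Suc n) d v)\<^sup>2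
      \<le> c * (h \<bullet> hform (Suc n) (bordered n X b y) v v)"
    using assms by (auto simp: dil_dir_def)
  have "(snd h \<bullet> lin n d v)\<^sup>2 \<le> c * (h \<bullet> hform n X v v)" for v
  proof -
    let ?v = "\<lambda>i. if i < n then v i else 0"
    have "lin (Suc n) d ?v = lin n d v" by (simp add: lin_def)
    moreover have "hform n X ?v ?v = hform n X v v" by (rule hform_cong) auto
    ultimately show ?thesis using c[of ?v] by (simp add: inner_hform_bordered)
  qed
  then show "\<exists>c. \<forall>v. (snd h \<bullet> lin n d v)\<^sup>2 \<le> c * (h \<bullet> hform n X v v)" by blast
qed

text \<open>By the Schur complement, the square of the off-diagonal value must be at most the
  product of the diagonal values, for every \<open>h\<close>. If \<open>h\<close> is positive at the
  corner \<open>y\<close>, a small \<open>\<alpha>\<close> achieves this. If \<open>h\<close>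
  vanishes at \<open>y\<close>, a relative interior point, it vanishes on \<open>P\<close>, and then
  both sides are zero.\<close>

lemma bordered_exists:
  fixes P :: "'a::euclidean_space set"
  assumes P: "polytope P" "P \<noteq> {}" and X: "wmax P n X" and b: "dil_dir P n X b"
  obtains \<alpha> y where "\<alpha> > 0" "wmax P (Suc n) (bordered n X (\<lambda>i. \<alpha> *\<^sub>R b i) y)"
proof -
  obtain J where J: "finite J" "J \<subseteq> dual_cone P"
    "\<And>n X. symm n X \<Longrightarrow> (\<And>h v. h \<in> J \<Longrightarrow> 0 \<le> h \<bullet> hform n X v v) \<Longrightarrow> wmax P n X"
    using wmax_finite_test[OF P(1)] by blast
  have cv: "convex P" using P(1) by (rule polytope_imp_convex)
  then obtain y where y: "y \<in> rel_interior P" using P(2) rel_interior_eq_empty by blast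
  have yP: "y \<in> P" using y rel_interior_subset by blast
  let ?Q = "\<lambda>h \<alpha>. \<forall>v. (\<alpha> * (snd h \<bullet> lin n b v))\<^sup>2 \<le> (h \<bullet> hform n X v v) * (h \<bullet> (1, y))"
  have ev: "\<forall>\<^sub>F \<alpha> in at_right 0. ?Q h \<alpha>" if h: "h \<in> J" for h
  proof -
    have hH: "h \<in> dual_cone P" using h J(2) by blast
    have y0: "0 \<le> h \<bullet> (1, y)" using hH yP by (simp add: dual_cone_def)
    obtain c where c: "c \<ge> 0" "\<And>v. (snd h \<bullet> lin n b v)\<^sup>2 \<le> c * (h \<bullet> hform n X v v)"
      using dil_dirE[OF b X hH] by blast
    show ?thesis
    proof (cases "h \<bullet> (1, y) = 0")
      case True
      then have "- h \<in> dual_cone P"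
        using dual_cone_vanish[OF hH cv y True] by (auto simp: dual_cone_def)
      then have "h \<bullet> hform n X v v = 0" for v
        using wmaxD[OF X hH, of v] wmaxD[OF X, of "- h" v] by (simp add: inner_minus_left)
      then have "snd h \<bullet> lin n b v = 0" for v using c(2)[of v] by simp
      then show ?thesis using True by simp
    next
      case False
      have "\<forall>\<^sub>F \<alpha> in at_right (0::real). \<alpha>\<^sup>2 * c < h \<bullet> (1, y)"
      proof (rule order_tendstoD(2))
        show "((\<lambda>\<alpha>. \<alpha>\<^sup>2 * c) \<longlongrightarrow> 0\<^sup>2 * c) (at_right (0::real))" by (intro tendsto_intros)
      qed (use False y0 in simp)
      then show ?thesis
      proof eventually_elim
        case (elim \<alpha>)
        show ?case
        proof
          fix v
          have "(\<alpha> * (snd h \<bullet> lin n b v))\<^sup>2 \<le> \<alpha>\<^sup>2 * (c * (h \<bullet> hform n X v v))"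
            using c(2)[of v] by (simp add: power_mult_distrib mult_left_mono)
          also have "\<dots> = (h \<bullet> hform n X v v) * (\<alpha>\<^sup>2 * c)" by simp
          also have "\<dots> \<le> (h \<bullet> hform n X v v) * (h \<bullet> (1, y))"
            using elim wmaxD[OF X hH, of v] by (intro mult_left_mono) auto
          finally show "(\<alpha> * (snd h \<bullet> lin n b v))\<^sup>2 \<le> (h \<bullet> hform n X v v) * (h \<bullet> (1, y))" .
        qed
      qed
    qed
  qed
  have "\<forall>\<^sub>F \<alpha> in at_right 0. \<forall>h\<in>J. ?Q h \<alpha>"
    using J(1) ev by (intro eventually_ball_finite) blast+
  moreover have "\<forall>\<^sub>F \<alpha> in at_right (0::real). \<alpha> > 0" by (rule eventually_at_right_less)
  ultimately have "\<forall>\<^sub>F \<alpha> in at_right (0::real). \<alpha> > 0 \<and> (\<forall>h\<in>J. ?Q h \<alpha>)"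
    by eventually_elim simp
  then obtain \<alpha> where \<alpha>: "\<alpha> > 0" "\<And>h v. h \<in> J \<Longrightarrow>
      (\<alpha> * (snd h \<bullet> lin n b v))\<^sup>2 \<le> (h \<bullet> hform n X v v) * (h \<bullet> (1, y))"
    using eventually_happens'[OF trivial_limit_at_right_real] by blast
  show ?thesis
  proof (rule that[OF \<alpha>(1)], rule J(3))
    show "symm (Suc n) (bordered n X (\<lambda>i. \<alpha> *\<^sub>R b i) y)"
      using X by (intro symm_bordered wmax_symm)
    fix h v assume h: "h \<in> J"
    then have hH: "h \<in> dual_cone P" using J(2) by blast
    have "0 \<le> h \<bullet> hform n X v v + 2 * v n * (\<alpha> * (snd h \<bullet> lin n b v)) + (v n)\<^sup>2 * (h \<bullet> (1, y))"
      using wmaxD[OF X hH] \<alpha>(2)[OF h] hH yP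
      by (intro quadratic_nonneg) (auto simp: dual_cone_def)
    then show "0 \<le> h \<bullet> hform (Suc n) (bordered n X (\<lambda>i. \<alpha> *\<^sub>R b i) y) v v"
      by (simp add: inner_hform_bordered lin_scale)
  qed
qed

text \<open>For fixed \<open>X\<close> and \<open>b\<close> all conditions are affine in
  \<open>(\<alpha>, y)\<close>, hence closed and convex. The unit vector at the new index bounds
  \<open>y\<close>, and Cauchy-Schwarz between the new index and \<open>i0\<close>, where
  \<open>b\<close> is nonzero, bounds \<open>\<alpha>\<close>.\<close>

lemma bordered_parameters_compact:
  fixes P :: "'a::euclidean_space set"
  assumes P: "bounded P" and X: "wmax P n X" and i0: "i0 < n" "b i0 \<noteq> 0"
  shows "compact {(\<alpha>, y). wmax P (Suc n) (bordered n X (\<lambda>i. \<alpha> *\<^sub>R b i) y)}" (is "compact ?T")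
    and "convex {(\<alpha>, y). wmax P (Suc n) (bordered n X (\<lambda>i. \<alpha> *\<^sub>R b i) y)}"
proof -
  let ?L = "\<lambda>h v. {p. - (h \<bullet> hform n X v v) \<le> (2 * v n * (snd h \<bullet> lin n b v), (v n)\<^sup>2 *\<^sub>R snd h) \<bullet>
      p + (v n)\<^sup>2 * fst h}"
  have L: "?L h v = {p. - (h \<bullet> hform n X v v) - (v n)\<^sup>2 * fst h
      \<le> (2 * v n * (snd h \<bullet> lin n b v), (v n)\<^sup>2 *\<^sub>R snd h) \<bullet> p}" for h v by auto
  have T: "?T = (\<Inter>h\<in>dual_cone P. \<Inter>v. ?L h v)"
  proof -
    have key: "0 \<le> h \<bullet> hform (Suc n) (bordered n X (\<lambda>i. \<alpha> *\<^sub>R b i) y) v v \<longleftrightarrow> (\<alpha>, y) \<in> ?L h v" for h v \<alpha> y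
      by (cases h) (simp add: inner_hform_bordered lin_scale algebra_simps, linarith)
    have mem: "wmax P (Suc n) (bordered n X (\<lambda>i. \<alpha> *\<^sub>R b i) y) \<longleftrightarrow>
        (\<forall>h\<in>dual_cone P. \<forall>v. (\<alpha>, y) \<in> ?L h v)" for \<alpha> y
      using symm_bordered[OF wmax_symm[OF X]] by (simp only: wmax_def key simp_thms)
    show ?thesis
    proof (rule Set.set_eqI)
      fix p :: "real \<times> 'a"
      obtain \<alpha> y where p: "p = (\<alpha>, y)" by (cases p)
      show "p \<in> ?T \<longleftrightarrow> p \<in> (\<Inter>h\<in>dual_cone P. \<Inter>v. ?L h v)"
        unfolding p mem INT_iff ball_UNIV by (simp only: mem_Collect_eq case_prod_conv)
    qed
  qed
  show "convex ?T" unfolding T L by (intro convex_INT convex_halfspace_ge)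
  have "closed ?T" unfolding T L by (intro closed_INT ballI closed_halfspace_ge)
  obtain M where M: "M > 0" "\<And>p. p \<in> P \<Longrightarrow> norm p \<le> M" using P bounded_pos by metis
  \<comment> \<open>\<open>P\<close> lies in the ball of radius \<open>M\<close>, so these
    functionals, one for each \<open>a\<close> in the unit ball, are nonnegative on
    \<open>P\<close>.\<close>
  have unit_H: "(M, a) \<in> dual_cone P" if "norm a \<le> 1" for a
  proof -
    have "0 \<le> M + a \<bullet> p" if "p \<in> P" for p
    proof -
      have "\<bar>a \<bullet> p\<bar> \<le> norm a * norm p" by (rule Cauchy_Schwarz_ineq2)
      also have "\<dots> \<le> 1 * M" using \<open>norm a \<le> 1\<close> M that by (intro mult_mono) auto
      finally show ?thesis by linarith
    qed
    then show ?thesis by (simp add: dual_cone_def)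
  qed
  \<comment> \<open>The diagonal value at \<open>i0\<close> of the functional whose value at the
    indices \<open>i0\<close> and \<open>n\<close> is exactly
    \<open>\<alpha> * norm (b i0)\<close>.\<close>
  define q where "q = (M, sgn (b i0)) \<bullet> hform n X (unitv i0) (unitv i0)"
  have bound: "norm y \<le> M \<and> (\<alpha> * norm (b i0))\<^sup>2 \<le> q * (2 * M)" if "(\<alpha>, y) \<in> ?T" for \<alpha> y
  proof
    let ?Y = "bordered n X (\<lambda>i. \<alpha> *\<^sub>R b i) y"
    have Y: "wmax P (Suc n) ?Y" using that by simp
    have yy: "hform (Suc n) ?Y (unitv n) (unitv n) = (1, y)"
      by (simp add: hform_unitv bordered_def)
    have "0 \<le> (M, - sgn y) \<bullet> (1, y)"
      using wmaxD[OF Y unit_H[of "- sgn y"], of "unitv n"] yy by (simp add: norm_sgn)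
    moreover have sg: "sgn z \<bullet> z = norm z" for z :: 'a
      by (cases "z = 0") (simp_all add: sgn_div_norm dot_square_norm power2_eq_square)
    ultimately show y: "norm y \<le> M" by (simp add: inner_minus_left)
    let ?h = "(M, sgn (b i0))"
    have h: "?h \<in> dual_cone P" by (rule unit_H) (simp add: norm_sgn)
    have "(?h \<bullet> hform (Suc n) ?Y (unitv i0) (unitv n))\<^sup>2
       \<le> (?h \<bullet> hform (Suc n) ?Y (unitv i0) (unitv i0)) * (?h \<bullet> hform (Suc n) ?Y (unitv n) (unitv n))"
      by (rule wmax_cauchy_schwarz[OF Y h])
    then have "(\<alpha> * norm (b i0))\<^sup>2 \<le> q * (M + sgn (b i0) \<bullet> y)"
      using i0 by (simp add: hform_unitv bordered_def q_def sg)
    also have "\<dots> \<le> q * (2 * M)"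
    proof (rule mult_left_mono)
      have "sgn (b i0) \<bullet> y \<le> norm (sgn (b i0)) * norm y" by (rule norm_cauchy_schwarz)
      also have "\<dots> \<le> 1 * M" using y M by (intro mult_mono) (auto simp: norm_sgn)
      finally show "M + sgn (b i0) \<bullet> y \<le> 2 * M" by simp
      show "0 \<le> q" unfolding q_def by (rule wmaxD[OF X h])
    qed
    finally show "(\<alpha> * norm (b i0))\<^sup>2 \<le> q * (2 * M)" .
  qed
  have "?T \<subseteq> cball 0 (sqrt (q * (2 * M)) / norm (b i0)) \<times> cball 0 M"
  proof
    fix p assume "p \<in> ?T"
    then obtain \<alpha> y where p: "p = (\<alpha>, y)" "(\<alpha>, y) \<in> ?T" by (cases p) auto
    note bd = bound[OF p(2)]
    have "\<bar>\<alpha> * norm (b i0)\<bar> \<le> sqrt (q * (2 * M))"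
      using bd real_sqrt_le_mono[of "(\<alpha> * norm (b i0))\<^sup>2"] by simp
    then have "\<bar>\<alpha>\<bar> \<le> sqrt (q * (2 * M)) / norm (b i0)"
      using i0(2) by (simp add: field_simps abs_mult)
    then show "p \<in> cball 0 (sqrt (q * (2 * M)) / norm (b i0)) \<times> cball 0 M" using bd p by auto
  qed
  then have "bounded ?T" by (rule bounded_subset[rotated]) (intro bounded_Times bounded_cball)
  then show "compact ?T" using \<open>closed ?T\<close> compact_eq_bounded_closed by blast
qed

text \<open>Choosing the border with maximal multiple of \<open>b\<close>, and then an extreme corner entry, makes the
  space of dilation directions strictly smaller: restriction to the old indices is injective on it
  and misses \<open>b\<close>.\<close>

lemma maximal_bordered:
  fixes P :: "'a::euclidean_space set"
  assumes P: "polytope P" "P \<noteq> {}" and X: "wmax P n X" and b: "dil_dir P n X b"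
    and i0: "i0 < n" "b i0 \<noteq> 0"
  obtains \<alpha> y where "wmax P (Suc n) (bordered n X (\<lambda>i. \<alpha> *\<^sub>R b i) y)"
    "\<And>d. dil_dir P (Suc n) (bordered n X (\<lambda>i. \<alpha> *\<^sub>R b i) y) d \<Longrightarrow> (\<forall>i<n. d i = 0) \<Longrightarrow> d n = 0"
    "\<And>d. dil_dir P (Suc n) (bordered n X (\<lambda>i. \<alpha> *\<^sub>R b i) y) d \<Longrightarrow> \<not> (\<forall>i<n. d i = b i)"
proof -
  define T where "T = {(\<alpha>, y). wmax P (Suc n) (bordered n X (\<lambda>i. \<alpha> *\<^sub>R b i) y)}"
  have T: "compact T" "convex T"
    using bordered_parameters_compact[OF polytope_imp_bounded[OF P(1)] X, of i0 b] i0
    unfolding T_def by auto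
  obtain \<alpha>0 y0 where 0: "\<alpha>0 > 0" "(\<alpha>0, y0) \<in> T"
    by (rule bordered_exists[OF P X b]) (auto simp: T_def)
  then have "T \<noteq> {}" by blast
  have "continuous_on T fst" by (intro continuous_intros)
  then obtain p where p: "p \<in> T" "\<forall>q\<in>T. fst q \<le> fst p"
    using continuous_attains_sup[OF T(1) \<open>T \<noteq> {}\<close>] by metis
  define \<alpha> where "\<alpha> = fst p"
  have max: "\<alpha>' \<le> \<alpha>" if "(\<alpha>', y) \<in> T" for \<alpha>' y
    using p(2) that unfolding \<alpha>_def by fastforce
  have "\<alpha> > 0" using max[OF 0(2)] 0(1) by linarith
  \<comment> \<open>The corners possible for the maximal \<open>\<alpha>\<close>; an extreme one
    will exclude directions supported at the new index.\<close>
  define S where "S = {y. (\<alpha>, y) \<in> T}"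
  have "S = snd ` (T \<inter> ({\<alpha>} \<times> UNIV))" unfolding S_def by force
  moreover have "compact (T \<inter> ({\<alpha>} \<times> UNIV))"
    using T(1) by (intro compact_Int_closed closed_Times) auto
  ultimately have "compact S" by (simp add: compact_continuous_image continuous_on_snd)
  moreover have "convex S"
  proof (rule convexI)
    fix y z and u v :: real assume "y \<in> S" "z \<in> S" and uv: "0 \<le> u" "0 \<le> v" "u + v = 1"
    then have "u *\<^sub>R (\<alpha>, y) + v *\<^sub>R (\<alpha>, z) \<in> T"
      using T(2) unfolding S_def by (intro convexD) auto
    moreover have "u * \<alpha> + v * \<alpha> = \<alpha>" using uv by (metis distrib_right mult_1)
    ultimately show "u *\<^sub>R y + v *\<^sub>R z \<in> S" unfolding S_def by simp
  qed
  moreover have "S \<noteq> {}" unfolding S_def using p(1) \<alpha>_def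
      by (metis empty_iff mem_Collect_eq prod.collapse)
  ultimately obtain y where y: "y extreme_point_of S" using extreme_point_exists_convex by blast
  let ?Y = "bordered n X (\<lambda>i. \<alpha> *\<^sub>R b i) y"
  have Y: "wmax P (Suc n) ?Y"
    using y by (auto simp: extreme_point_of_def S_def T_def)
  show ?thesis
  proof (rule that[OF Y])
    fix d assume d: "dil_dir P (Suc n) ?Y d" "\<forall>i<n. d i = 0"
    have lin_d: "lin (Suc n) d v = v n *\<^sub>R d n" for v
      using d(2) by (simp add: lin_def)
    obtain J where J: "finite J" "J \<subseteq> dual_cone P"
      "\<And>n X. symm n X \<Longrightarrow> (\<And>h v. h \<in> J \<Longrightarrow> 0 \<le> h \<bullet> hform n X v v) \<Longrightarrow> wmax P n X"
      using wmax_finite_test[OF P(1)] by blast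
    \<comment> \<open>For a direction supported at the new index, the form of \<open>?Y\<close>
      dominates a multiple of \<open>(v n)^2\<close>. This leaves room to move the corner by
      \<open>\<delta> d n\<close> both ways.\<close>
    let ?Q = "\<lambda>h \<delta>. \<forall>v. \<delta> * \<bar>snd h \<bullet> d n\<bar> * (v n)\<^sup>2 \<le> h \<bullet> hform (Suc n) ?Y v v"
    have "\<forall>\<^sub>F \<delta> in at_right 0. ?Q h \<delta>" if "h \<in> J" for h
    proof (cases "snd h \<bullet> d n = 0")
      case True
      then show ?thesis using wmaxD[OF Y subsetD[OF J(2) that]] by (simp add: always_eventually)
    next
      case False
      have hH: "h \<in> dual_cone P" using that J(2) by blast
      obtain c where c: "c \<ge> 0" "\<And>v. (snd h \<bullet> lin (Suc n) d v)\<^sup>2 \<le> c * (h \<bullet> hform (Suc n) ?Y v v)"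
        using dil_dirE[OF d(1) Y hH] by blast
      have "\<forall>\<^sub>F \<delta> in at_right (0::real). \<delta> * c < \<bar>snd h \<bullet> d n\<bar>"
      proof (rule order_tendstoD(2))
        show "((\<lambda>\<delta>. \<delta> * c) \<longlongrightarrow> 0 * c) (at_right (0::real))" by (intro tendsto_intros)
      qed (use False in simp)
      moreover have "\<forall>\<^sub>F \<delta> in at_right (0::real). \<delta> > 0" by (rule eventually_at_right_less)
      ultimately show ?thesis
      proof eventually_elim
        case (elim \<delta>)
        show ?case
        proof
          fix v
          let ?q = "h \<bullet> hform (Suc n) ?Y v v"
          have "\<bar>snd h \<bullet> d n\<bar> * (\<delta> * \<bar>snd h \<bullet> d n\<bar> * (v n)\<^sup>2) = \<delta> * (snd h \<bullet> lin (Suc n) d v)\<^sup>2"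
            by (simp add: lin_d power2_eq_square)
          also have "\<dots> \<le> \<delta> * (c * ?q)" using c(2) elim by (intro mult_left_mono) auto
          also have "\<dots> = (\<delta> * c) * ?q" by simp
          also have "\<dots> \<le> \<bar>snd h \<bullet> d n\<bar> * ?q"
            using elim wmaxD[OF Y hH, of v] by (intro mult_right_mono) auto
          finally show "\<delta> * \<bar>snd h \<bullet> d n\<bar> * (v n)\<^sup>2 \<le> ?q" using False by simp
        qed
      qed
    qed
    then have "\<forall>\<^sub>F \<delta> in at_right 0. \<forall>h\<in>J. ?Q h \<delta>"
      using J(1) by (intro eventually_ball_finite) blast+
    moreover have "\<forall>\<^sub>F \<delta> in at_right (0::real). \<delta> > 0" by (rule eventually_at_right_less)
    ultimately have "\<forall>\<^sub>F \<delta> in at_right (0::real). \<delta> > 0 \<and> (\<forall>h\<in>J. ?Q h \<delta>)"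
      by eventually_elim simp
    then obtain \<delta> where \<delta>: "\<delta> > 0" "\<And>h v. h \<in> J \<Longrightarrow>
        \<delta> * \<bar>snd h \<bullet> d n\<bar> * (v n)\<^sup>2 \<le> h \<bullet> hform (Suc n) ?Y v v"
      using eventually_happens'[OF trivial_limit_at_right_real] by blast
    have in_S: "y + s *\<^sub>R d n \<in> S" if "\<bar>s\<bar> = \<delta>" for s
    proof -
      have "wmax P (Suc n) (bordered n X (\<lambda>i. \<alpha> *\<^sub>R b i) (y + s *\<^sub>R d n))"
      proof (rule J(3))
        show "symm (Suc n) (bordered n X (\<lambda>i. \<alpha> *\<^sub>R b i) (y + s *\<^sub>R d n))"
          using X by (intro symm_bordered wmax_symm)
        fix h v assume h: "h \<in> J"
        have "\<bar>(v n)\<^sup>2 * (s * (snd h \<bullet> d n))\<bar> = \<delta> * \<bar>snd h \<bullet> d n\<bar> * (v n)\<^sup>2"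
          by (simp add: abs_mult that mult_ac)
        then have "0 \<le> h \<bullet> hform (Suc n) ?Y v v + (v n)\<^sup>2 * (s * (snd h \<bullet> d n))"
          using \<delta>(2)[OF h, of v] by linarith
        also have "\<dots> = h \<bullet> hform (Suc n) (bordered n X (\<lambda>i. \<alpha> *\<^sub>R b i) (y + s *\<^sub>R d n)) v v"
          by (cases h) (simp add: inner_hform_bordered inner_add_right algebra_simps)
        finally show "0 \<le> \<dots>" .
      qed
      then show ?thesis by (simp add: S_def T_def)
    qed
    have "y + \<delta> *\<^sub>R d n \<in> S" "y - \<delta> *\<^sub>R d n \<in> S" using in_S[of \<delta>] in_S[of "- \<delta>"] \<delta>(1) by auto
    then have "y \<notin> open_segment (y - \<delta> *\<^sub>R d n) (y + \<delta> *\<^sub>R d n)"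
      using y by (simp add: extreme_point_of_def)
    moreover have "midpoint (y - \<delta> *\<^sub>R d n) (y + \<delta> *\<^sub>R d n) = y"
      by (simp add: midpoint_def flip: scaleR_2)
    ultimately have "y - \<delta> *\<^sub>R d n = y + \<delta> *\<^sub>R d n"
      using midpoint_in_open_segment by metis
    then have "(y - \<delta> *\<^sub>R d n) \<bullet> d n = (y + \<delta> *\<^sub>R d n) \<bullet> d n" by (rule arg_cong)
    then have "2 * \<delta> * (d n \<bullet> d n) = 0" by (simp add: inner_diff_left inner_add_left)
    then show "d n = 0" using \<delta>(1) by simp
  next
    fix d assume d: "dil_dir P (Suc n) ?Y d"
    show "\<not> (\<forall>i<n. d i = b i)"
    proof
      assume db: "\<forall>i<n. d i = b i"
      \<comment> \<open>A direction extending \<open>b\<close> would give a second border, equal to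
        \<open>\<epsilon> b\<close> on the old indices. Compressing the two new indices onto one
        unit vector \<open>(c, s)\<close> yields a border of \<open>X\<close> along
        \<open>(c \<alpha> + s \<epsilon>) b\<close>.\<close>
      obtain \<epsilon> z where ez: "\<epsilon> > 0" "wmax P (Suc (Suc n)) (bordered (Suc n) ?Y (\<lambda>i. \<epsilon> *\<^sub>R d i) z)"
        by (rule bordered_exists[OF P Y d])
      define r where "r = sqrt (\<alpha>\<^sup>2 + \<epsilon>\<^sup>2)"
      have r: "r > 0" "r\<^sup>2 = \<alpha>\<^sup>2 + \<epsilon>\<^sup>2"
        using \<open>\<alpha> > 0\<close> by (auto simp: r_def add_pos_nonneg)
      \<comment> \<open>Parallel to \<open>(\<alpha>, \<epsilon>)\<close>, which makes
        \<open>c \<alpha> + s \<epsilon>\<close> as large as possible: it becomes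
        \<open>r > \<alpha>\<close>, contrary to maximality.\<close>
      define c s where "c = \<alpha> / r" and "s = \<epsilon> / r"
      have "c * c + s * s = (\<alpha>\<^sup>2 + \<epsilon>\<^sup>2) / r\<^sup>2" "c * \<alpha> + s * \<epsilon> = (\<alpha>\<^sup>2 + \<epsilon>\<^sup>2) / r"
        by (simp_all add: c_def s_def power2_eq_square add_divide_distrib)
      then have cs: "c * c + s * s = 1" "c * \<alpha> + s * \<epsilon> = r"
        unfolding r(2)[symmetric] using r(1) by (simp_all add: power2_eq_square)
      \<comment> \<open>The compressed corner; the two equal terms come from the entry
        \<open>\<epsilon> d n\<close> between the two new indices.\<close>
      define y' where "y' = (c * c) *\<^sub>R y + (s * s) *\<^sub>R z + (c * s * \<epsilon>) *\<^sub>R d n + (c * s * \<epsilon>) *\<^sub>R d n"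
      let ?A = "\<lambda>v i. if i < n then v i else if i = n then c * v n else s * v n"
      have A: "lin n b (?A v) = lin n b v" "lin (Suc n) d (?A v) = lin n b v + (c * v n) *\<^sub>R d n"
        "hform n X (?A v) (?A w) = hform n X v w" for v w
        using db by (auto simp: lin_def intro!: hform_cong)
      have "wmax P (Suc n) (bordered n X (\<lambda>i. (c * \<alpha> + s * \<epsilon>) *\<^sub>R b i) y')"
      proof (rule wmax_compression[OF ez(2)])
        fix v w
        have one: "(c * v n * (c * w n)) + s * v n * (s * w n) = v n * w n"
        proof -
          have "(c * v n * (c * w n)) + s * v n * (s * w n) = (c * c + s * s) * (v n * w n)"
            by (simp add: algebra_simps)
          then show ?thesis by (simp add: cs)
        qed
        have "hform (Suc (Suc n)) (bordered (Suc n) ?Y (\<lambda>i. \<epsilon> *\<^sub>R d i) z) (?A v) (?A w)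
          = hform n X v w + (c * v n * (c * w n)) *\<^sub>R (1, y)
            + (0, (c * w n) *\<^sub>R lin n (\<lambda>i. \<alpha> *\<^sub>R b i) v + (c * v n) *\<^sub>R lin n (\<lambda>i. \<alpha> *\<^sub>R b i) w)
            + (s * v n * (s * w n)) *\<^sub>R (1, z)
            + (0, (s * w n) *\<^sub>R (\<epsilon> *\<^sub>R (lin n b v + (c * v n) *\<^sub>R d n))
              + (s * v n) *\<^sub>R (\<epsilon> *\<^sub>R (lin n b w + (c * w n) *\<^sub>R d n)))"
        proof -
          have "lin n (\<lambda>i. \<alpha> *\<^sub>R b i) (?A v) = lin n (\<lambda>i. \<alpha> *\<^sub>R b i) v"
            "lin n (\<lambda>i. \<alpha> *\<^sub>R b i) (?A w) = lin n (\<lambda>i. \<alpha> *\<^sub>R b i) w"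
            by (simp_all add: lin_def)
          then show ?thesis by (simp add: hform_bordered A(2,3) lin_scale[of "Suc n"])
        qed
        also have "\<dots> = hform n X v w + (v n * w n) *\<^sub>R (1, y')
            + (0, w n *\<^sub>R lin n (\<lambda>i. (c * \<alpha> + s * \<epsilon>) *\<^sub>R b i) v
                + v n *\<^sub>R lin n (\<lambda>i. (c * \<alpha> + s * \<epsilon>) *\<^sub>R b i) w)"
          (is "?l = ?r")
        proof (rule prod_eqI)
          show "fst ?l = fst ?r" using one by simp
          show "snd ?l = snd ?r" unfolding y'_def lin_scale by (simp, simp add: algebra_simps)
        qed
        finally show "hform (Suc n) (bordered n X (\<lambda>i. (c * \<alpha> + s * \<epsilon>) *\<^sub>R b i) y') v w
          = hform (Suc (Suc n)) (bordered (Suc n) ?Y (\<lambda>i. \<epsilon> *\<^sub>R d i) z) (?A v) (?A w)"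
          by (simp only: hform_bordered)
      qed
      then have "(r, y') \<in> T" by (simp add: T_def cs(2))
      then have "r \<le> \<alpha>" by (rule max)
      then have "r\<^sup>2 \<le> \<alpha>\<^sup>2" using r by (intro power_mono) auto
      then show False using r(2) ez(1) by simp
    qed
  qed
qed

text \<open>The dimension of the space of directions is measured by the number of functionals that
  separate it. Bordering along \<open>b\<close> saves one of them: a functional \<open>c0\<close>
  that is nonzero at \<open>b\<close> serves as pivot for the others.\<close>

lemma arveson_dilation_separated:
  fixes P :: "'a::euclidean_space set"
  assumes P: "polytope P" "P \<noteq> {}" and "finite C" and X: "wmax P n X"
    and sep: "\<And>d. dil_dir P n X d \<Longrightarrow> (\<forall>c\<in>C. (\<Sum>i<n. c i \<bullet> d i) = 0) \<Longrightarrow> (\<forall>i<n. d i = 0)"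
  shows "\<exists>N Y. n \<le> N \<and> arveson P N Y \<and> (\<forall>i<n. \<forall>j<n. Y i j = X i j)"
  using assms(3-)
proof (induction "card C" arbitrary: C n X rule: less_induct)
  case less
  show ?case
  proof (cases "arveson P n X")
    case True
    then show ?thesis by blast
  next
    case False
    then obtain b i0 where b: "dil_dir P n X b" "i0 < n" "b i0 \<noteq> 0"
      using less.prems(2) by (auto simp: arveson_def)
    define pr where "pr c d = (\<Sum>i<n. c i \<bullet> d i)" for c d :: "nat \<Rightarrow> 'a"
    obtain c0 where c0: "c0 \<in> C" "pr c0 b \<noteq> 0"
      using less.prems(3)[OF b(1)] b(2,3) by (auto simp: pr_def)
    \<comment> \<open>As in Gaussian elimination, \<open>f c\<close> vanishes at \<open>b\<close>.
      It is cut off at \<open>n\<close>, so that it ignores the new index of the bordered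
      point.\<close>
    define f where "f c = (\<lambda>i. if i < n then c i - (pr c b / pr c0 b) *\<^sub>R c0 i else 0)" for c
    obtain \<alpha> y where Y: "wmax P (Suc n) (bordered n X (\<lambda>i. \<alpha> *\<^sub>R b i) y)"
      "\<And>d. dil_dir P (Suc n) (bordered n X (\<lambda>i. \<alpha> *\<^sub>R b i) y) d \<Longrightarrow> (\<forall>i<n. d i = 0) \<Longrightarrow> d n = 0"
      "\<And>d. dil_dir P (Suc n) (bordered n X (\<lambda>i. \<alpha> *\<^sub>R b i) y) d \<Longrightarrow> \<not> (\<forall>i<n. d i = b i)"
      by (rule maximal_bordered[OF P less.prems(2) b]) blast
    have "\<exists>N Z. Suc n \<le> N \<and> arveson P N Z
      \<and> (\<forall>i<Suc n. \<forall>j<Suc n. Z i j = bordered n X (\<lambda>i. \<alpha> *\<^sub>R b i) y i j)"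
    proof (rule less.hyps[OF _ _ Y(1)])
      have "card (f ` (C - {c0})) \<le> card (C - {c0})"
        using less.prems(1) by (intro card_image_le) auto
      also have "\<dots> < card C" using c0 less.prems(1) by (intro card_Diff1_less) auto
      finally show "card (f ` (C - {c0})) < card C" .
      show "finite (f ` (C - {c0}))" using less.prems(1) by simp
      fix d assume d: "dil_dir P (Suc n) (bordered n X (\<lambda>i. \<alpha> *\<^sub>R b i) y) d"
        and zero: "\<forall>c\<in>f ` (C - {c0}). (\<Sum>i<Suc n. c i \<bullet> d i) = 0"
      \<comment> \<open>Subtracting \<open>t b\<close> from \<open>d\<close> makes \<open>c0\<close>
        vanish too, so \<open>d\<close> equals \<open>t b\<close> on the old indices; the maximal
        border leaves only \<open>t = 0\<close>.\<close>
      define t where "t = pr c0 d / pr c0 b"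
      have f: "(\<Sum>i<Suc n. f c i \<bullet> d i) = pr c d - (pr c b / pr c0 b) * pr c0 d" for c
        by (simp add: f_def pr_def inner_diff_left sum_subtractf sum_distrib_left)
      have "dil_dir P n X (\<lambda>i. d i + (- t) *\<^sub>R b i)"
        by (rule dil_dir_combine[OF dil_dir_restrict[OF d] b(1) less.prems(2)])
      moreover have "\<forall>c\<in>C. (\<Sum>i<n. c i \<bullet> (d i + (- t) *\<^sub>R b i)) = 0"
      proof
        fix c assume c: "c \<in> C"
        have "(\<Sum>i<n. c i \<bullet> (d i + (- t) *\<^sub>R b i)) = pr c d - t * pr c b"
          by (simp add: pr_def inner_diff_right sum_subtractf sum_distrib_left)
        also have "\<dots> = 0"
        proof (cases "c = c0")
          case True
          then show ?thesis using c0 by (simp add: t_def)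
        next
          case False
          then have "pr c d - (pr c b / pr c0 b) * pr c0 d = 0"
            using bspec[OF zero, of "f c"] c f by simp
          then show ?thesis by (simp add: t_def field_simps)
        qed
        finally show "(\<Sum>i<n. c i \<bullet> (d i + (- t) *\<^sub>R b i)) = 0" .
      qed
      ultimately have dt: "\<forall>i<n. d i = t *\<^sub>R b i" using less.prems(3) by fastforce
      have "t = 0"
      proof (rule ccontr)
        assume "t \<noteq> 0"
        then show False using Y(3)[OF dil_dir_scale[OF d, of "1 / t"]] dt by auto
      qed
      then have "\<forall>i<n. d i = 0" using dt by simp
      then show "\<forall>i<Suc n. d i = 0" using Y(2)[OF d] by (simp add: less_Suc_eq)
    qed
    then obtain N Z where "Suc n \<le> N" "arveson P N Z"
      "\<forall>i<Suc n. \<forall>j<Suc n. Z i j = bordered n X (\<lambda>i. \<alpha> *\<^sub>R b i) y i j" by blast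
    then show ?thesis by (intro exI[of _ N] exI[of _ Z]) (auto simp: bordered_def)
  qed
qed

lemma arveson_dilation:
  fixes P :: "'a::euclidean_space set"
  assumes "polytope P" "P \<noteq> {}" "wmax P n X"
  obtains N Y where "n \<le> N" "arveson P N Y" "\<And>i j. i < n \<Longrightarrow> j < n \<Longrightarrow> Y i j = X i j"
proof -
  \<comment> \<open>The coordinate functionals, which separate everything.\<close>
  define C where "C = (\<lambda>(i, e) j. if j = i then e else 0) ` ({..<n} \<times> (Basis :: 'a set))"
  have "\<exists>N Y. n \<le> N \<and> arveson P N Y \<and> (\<forall>i<n. \<forall>j<n. Y i j = X i j)"
  proof (rule arveson_dilation_separated[OF assms(1,2) _ assms(3)])
    show "finite C" by (simp add: C_def)
    fix d assume "\<forall>c\<in>C. (\<Sum>i<n. c i \<bullet> d i) = 0"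
    then have "(\<Sum>k<n. (if k = i then e else 0) \<bullet> d k) = 0" if "i < n" "e \<in> Basis" for i e
      using that by (auto simp: C_def)
    then have "e \<bullet> d i = 0" if "i < n" "e \<in> Basis" for i e
      using that by (simp add: if_distrib[of "\<lambda>x. x \<bullet> _"] cong: if_cong)
    then show "\<forall>i<n. d i = 0"
      using euclidean_eqI[of _ "0::'a"] by (metis inner_commute inner_zero_left)
  qed
  then show ?thesis using that by blast
qed

section \<open>Orthonormal families and eigenvectors\<close>

definition orthonormal :: "nat \<Rightarrow> (nat \<Rightarrow> nat \<Rightarrow> real) \<Rightarrow> nat \<Rightarrow> bool" where
  "orthonormal n e k \<longleftrightarrow> (\<forall>i<k. \<forall>j<k. ip n (e i) (e j) = of_bool (i = j))"

definition subspace_fun :: "(nat \<Rightarrow> real) set \<Rightarrow> bool" where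
  "subspace_fun S \<longleftrightarrow> (\<lambda>_. 0) \<in> S \<and> (\<forall>v\<in>S. \<forall>w\<in>S. \<forall>s. (\<lambda>i. v i + s * w i) \<in> S)"

lemma subspace_scale:
  assumes "subspace_fun S" "w \<in> S"
  shows "(\<lambda>i. s * w i) \<in> S"
proof -
  have S: "\<forall>v\<in>S. \<forall>w\<in>S. \<forall>s. (\<lambda>i. v i + s * w i) \<in> S" "(\<lambda>_. 0) \<in> S"
    using assms(1) unfolding subspace_fun_def by simp_all
  show ?thesis using bspec[OF bspec[OF S] assms(2)] by simp
qed

definition proj :: "nat \<Rightarrow> (nat \<Rightarrow> nat \<Rightarrow> real) \<Rightarrow> nat \<Rightarrow> (nat \<Rightarrow> real) \<Rightarrow> nat \<Rightarrow> real" where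
  "proj n e k v = (\<lambda>i. \<Sum>j<k. ip n v (e j) * e j i)"

lemma ip_zero [simp]: "ip n (\<lambda>_. 0) w = 0" "ip n w (\<lambda>_. 0) = 0"
  by (simp_all add: ip_def)

lemma ip_cong: "(\<And>i. i < n \<Longrightarrow> v i = v' i) \<Longrightarrow> (\<And>i. i < n \<Longrightarrow> w i = w' i) \<Longrightarrow> ip n v w = ip n v' w'"
  by (simp add: ip_def)

lemma ip_unitv [simp]: "i < n \<Longrightarrow> ip n v (unitv i) = v i" "i < n \<Longrightarrow> ip n (unitv i) v = v i"
  by (simp_all add: ip_def)

lemma ip_sum_left: "ip n (\<lambda>i. \<Sum>k\<in>K. c k * v k i) w = (\<Sum>k\<in>K. c k * ip n (v k) w)"
  unfolding ip_def by (simp add: sum_distrib_left sum_distrib_right, subst sum.swap) (simp add: mult_ac)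

lemma ip_diff_left: "ip n (\<lambda>i. v i - w i) u = ip n v u - ip n w u"
  using ip_left[of n v "-1" w u] by simp

lemma ip_diff_right: "ip n u (\<lambda>i. v i - w i) = ip n u v - ip n u w"
  using ip_right[of n u v "-1" w] by simp

lemma ip_proj:
  assumes "orthonormal n e k" "j < k"
  shows "ip n (proj n e k v) (e j) = ip n v (e j)"
proof -
  have "ip n (proj n e k v) (e j) = (\<Sum>i<k. ip n v (e i) * of_bool (i = j))"
    using assms unfolding proj_def ip_sum_left orthonormal_def by (intro sum.cong) auto
  then show ?thesis using assms(2) by (simp add: of_bool_def if_distrib cong: if_cong)
qed

lemma ip_proj_right: "ip n w (proj n e k v) = (\<Sum>j<k. ip n v (e j) * ip n w (e j))"
  unfolding proj_def ip_commute[of n w] ip_sum_left by (simp add: ip_commute)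

text \<open>Pythagoras for the component outside the span; the nonnegativity of the left side is
  Bessel's inequality.\<close>

lemma orthonormal_residual:
  assumes "orthonormal n e k"
  defines "u \<equiv> \<lambda>v i. v i - proj n e k v i"
  shows "ip n (u v) (u v) = ip n v v - (\<Sum>j<k. (ip n v (e j))\<^sup>2)"
    and "j < k \<Longrightarrow> ip n (u v) (e j) = 0"
proof -
  show 0: "ip n (u v) (e j) = 0" if "j < k" for j
    unfolding u_def ip_diff_left using ip_proj[OF assms(1) that] by simp
  have "ip n (u v) (u v) = ip n (u v) v"
    using 0 unfolding u_def ip_diff_right[of n _ v "proj n e k v"] ip_proj_right by simp
  also have "\<dots> = ip n v v - (\<Sum>j<k. (ip n v (e j))\<^sup>2)"
    unfolding u_def ip_diff_left ip_commute[of n "proj n e k v" v] ip_proj_right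
    by (simp add: power2_eq_square)
  finally show "ip n (u v) (u v) = ip n v v - (\<Sum>j<k. (ip n v (e j))\<^sup>2)" .
qed

lemma orthonormal_total:
  assumes "orthonormal n e k"
  shows "(\<Sum>i<n. \<Sum>j<k. (e j i)\<^sup>2) = k"
proof -
  have "(\<Sum>i<n. \<Sum>j<k. (e j i)\<^sup>2) = (\<Sum>j<k. ip n (e j) (e j))"
    unfolding ip_def by (subst sum.swap) (simp add: power2_eq_square)
  also have "\<dots> = (\<Sum>j<k. 1)" using assms by (intro sum.cong) (auto simp: orthonormal_def)
  finally show ?thesis by simp
qed

text \<open>By Bessel at the unit vectors, each of the \<open>n\<close> coordinates has square sum
  at most 1 over the family, while the total square sum is \<open>k\<close>.\<close>

lemma orthonormal_card_le:
  assumes "orthonormal n e k"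
  shows "k \<le> n"
proof -
  have "(\<Sum>j<k. (e j i)\<^sup>2) \<le> 1" if "i < n" for i
    using orthonormal_residual(1)[OF assms, of "unitv i"] that
      ip_nonneg[of n "\<lambda>j. unitv i j - proj n e k (unitv i) j"] by (simp, simp add: unitv_def)
  then have "(\<Sum>i<n. \<Sum>j<k. (e j i)\<^sup>2) \<le> (\<Sum>i<n. 1)" by (intro sum_mono) auto
  then show ?thesis using orthonormal_total[OF assms] by simp
qed

lemma subspace_proj:
  assumes "subspace_fun S" "\<And>j. j < k \<Longrightarrow> e j \<in> S"
  shows "proj n e k v \<in> S"
  using assms(2)
proof (induction k)
  case 0
  then show ?case using assms(1) by (simp add: proj_def subspace_fun_def)
next
  case (Suc k)
  have "(\<lambda>i. proj n e k v i + ip n v (e k) * e k i) \<in> S"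
    using assms(1) Suc by (auto simp: subspace_fun_def)
  then show ?case by (simp add: proj_def)
qed

text \<open>Gram-Schmidt: while some vector of \<open>S\<close> differs from its projection, the
  normalised residual is appended. The bound on the size of orthonormal families ends the
  process.\<close>

lemma orthonormal_extend_basis:
  assumes "subspace_fun S" "orthonormal n e k" "\<And>j. j < k \<Longrightarrow> e j \<in> S"
  shows "\<exists>k' e'. k \<le> k' \<and> orthonormal n e' k' \<and> (\<forall>j<k. e' j = e j) \<and> (\<forall>j<k'. e' j \<in> S)
    \<and> (\<forall>v\<in>S. \<forall>i<n. v i = proj n e' k' v i)"
  using assms(2-)
proof (induction "n - k" arbitrary: k e rule: less_induct)
  case less
  show ?case
  proof (cases "\<forall>v\<in>S. \<forall>i<n. v i = proj n e k v i")
    case True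
    then show ?thesis using less.prems by blast
  next
    case False
    then obtain v i where v: "v \<in> S" "i < n" "v i \<noteq> proj n e k v i" by blast
    define u where "u = (\<lambda>i. v i + (-1) * proj n e k v i)"
    have u: "u = (\<lambda>i. v i - proj n e k v i)" by (simp add: u_def)
    have "u \<in> S" unfolding u_def
      using assms(1) v(1) subspace_proj[of S k e n v] less.prems unfolding subspace_fun_def by blast
    have "ip n u u \<noteq> 0" using v ip_eq_0_iff[of n u] by (auto simp: u)
    then have pos: "ip n u u > 0" using ip_nonneg[of n u] by linarith
    define r where "r = 1 / sqrt (ip n u u)"
    define w where "w = (\<lambda>i. r * u i)"
    have "w \<in> S" unfolding w_def by (rule subspace_scale[OF assms(1) \<open>u \<in> S\<close>])
    have w: "ip n w x = r * ip n u x" "ip n x w = r * ip n x u" for x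
      using ip_left[of n "\<lambda>_. 0" r u x] ip_right[of n x "\<lambda>_. 0" r u] by (simp_all add: w_def)
    have ww: "ip n w w = 1" using pos by (simp add: w r_def)
    have we: "ip n w (e j) = 0" "ip n (e j) w = 0" if "j < k" for j
      using orthonormal_residual(2)[OF less.prems(1) that, of v]
          by (simp_all add: w u ip_commute[of n "e j"])
    have orth: "orthonormal n (e(k := w)) (Suc k)"
      using less.prems(1) ww we by (auto simp: orthonormal_def less_Suc_eq)
    have "Suc k \<le> n" by (rule orthonormal_card_le[OF orth])
    then have "\<exists>k' e'. Suc k \<le> k' \<and> orthonormal n e' k' \<and> (\<forall>j<Suc k. e' j = (e(k := w)) j)
      \<and> (\<forall>j<k'. e' j \<in> S) \<and> (\<forall>v\<in>S. \<forall>i<n. v i = proj n e' k' v i)"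
      using less.prems \<open>w \<in> S\<close> by (intro less.hyps orth) (auto simp: less_Suc_eq)
    then obtain k' e' where "Suc k \<le> k'" "orthonormal n e' k'" "\<forall>j<Suc k. e' j = (e(k := w)) j"
      "\<forall>j<k'. e' j \<in> S" "\<forall>v\<in>S. \<forall>i<n. v i = proj n e' k' v i" by blast
    then show ?thesis by (intro exI[of _ k'] exI[of _ e']) auto
  qed
qed

lemma orthonormal_complete:
  assumes "orthonormal n e k"
  obtains g where "orthonormal n g n" "\<And>j. j < k \<Longrightarrow> g j = e j"
    "\<And>v i. i < n \<Longrightarrow> v i = proj n g n v i"
proof -
  obtain k' g where g: "orthonormal n g k'" "\<forall>j<k. g j = e j"
      "\<forall>v\<in>UNIV. \<forall>i<n. v i = proj n g k' v i"
    using orthonormal_extend_basis[of UNIV n e k] assms by (auto simp: subspace_fun_def)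
  \<comment> \<open>Each unit vector equals its projection, so Bessel is an equality at all of them,
    and the total square sum gives \<open>k' = n\<close>.\<close>
  have "(\<Sum>j<k'. (g j i)\<^sup>2) = 1" if "i < n" for i
  proof -
    have "unitv i i = proj n g k' (unitv i) i" using g(3) that by blast
    also have "\<dots> = (\<Sum>j<k'. (g j i)\<^sup>2)" using that by (simp add: proj_def power2_eq_square)
    finally show ?thesis by (simp add: unitv_def)
  qed
  then have "(\<Sum>i<n. \<Sum>j<k'. (g j i)\<^sup>2) = (\<Sum>i<n. 1)" by (intro sum.cong) auto
  then have "k' = n" using orthonormal_total[OF g(1)] by simp
  show ?thesis by (rule that[of g]) (use g \<open>k' = n\<close> in auto)
qed

text \<open>The first \<open>k\<close> vectors are a basis of \<open>S\<close> and the others a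
  basis of its orthogonal complement, as far as indices below \<open>n\<close> are
  concerned.\<close>

lemma adapted_basis:
  assumes "subspace_fun S"
  obtains g k where "k \<le> n" "orthonormal n g n" "\<And>j. j < k \<Longrightarrow> g j \<in> S"
    "\<And>j v. k \<le> j \<Longrightarrow> j < n \<Longrightarrow> v \<in> S \<Longrightarrow> ip n v (g j) = 0"
    "\<And>v i. v \<in> S \<Longrightarrow> i < n \<Longrightarrow> v i = proj n g k v i"
    "\<And>v i. i < n \<Longrightarrow> v i = proj n g n v i"
proof -
  have "\<exists>k' e'. 0 \<le> k' \<and> orthonormal n e' k' \<and> (\<forall>j<0. e' j = (\<lambda>_. 0)) \<and> (\<forall>j<k'. e' j \<in> S)
    \<and> (\<forall>v\<in>S. \<forall>i<n. v i = proj n e' k' v i)"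
    using assms by (intro orthonormal_extend_basis[where e = "\<lambda>_ _. 0"]) (auto simp: orthonormal_def)
  then obtain k e where e: "orthonormal n e k" "\<forall>j<k. e j \<in> S" "\<forall>v\<in>S. \<forall>i<n. v i = proj n e k v i"
    by blast
  obtain g where g: "orthonormal n g n" "\<And>j. j < k \<Longrightarrow> g j = e j"
    "\<And>v i. i < n \<Longrightarrow> v i = proj n g n v i"
    by (rule orthonormal_complete[OF e(1)]) blast
  have kn: "k \<le> n" by (rule orthonormal_card_le[OF e(1)])
  have pe: "proj n g k v = proj n e k v" for v using g(2) by (simp add: proj_def)
  show ?thesis
  proof (rule that[OF kn g(1)])
    show "g j \<in> S" if "j < k" for j using g(2)[OF that] e(2) that by simp
    show "v i = proj n g k v i" if "v \<in> S" "i < n" for v i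
      using e(3) that pe by simp
    show "v i = proj n g n v i" if "i < n" for v i by (rule g(3)[OF that])
    fix j v assume j: "k \<le> j" "j < n" "v \<in> S"
    have "ip n v (g j) = ip n (proj n g k v) (g j)"
      using e(3) j(3) pe by (intro ip_cong) auto
    also have "\<dots> = (\<Sum>i<k. ip n v (g i) * ip n (g i) (g j))" unfolding proj_def ip_sum_left ..
    also have "\<dots> = 0" using g(1) j(1,2) by (intro sum.neutral) (auto simp: orthonormal_def)
    finally show "ip n v (g j) = 0" .
  qed
qed

section \<open>Minima of quadratic forms on spheres, eigenvectors\<close>

lemma compact_sphere:
  "compact {v :: nat \<Rightarrow> real. (\<forall>i\<ge>n. v i = 0) \<and> ip n v v = 1 \<and> (\<forall>s\<in>S. ip n s v = 0)}" (is "compact ?K")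
proof -
  \<comment> \<open>Vectors that vanish from \<open>n\<close> on and have norm 1 lie in a product of
    intervals, which is compact by Tychonoff.\<close>
  have "compactin (product_topology (\<lambda>_. euclidean) UNIV) (PiE UNIV (\<lambda>_::nat. {- 1..1::real}))"
    by (simp add: compactin_PiE)
  then have box: "compact (PiE UNIV (\<lambda>_::nat. {- 1..1::real}))"
    by (simp add: euclidean_product_topology)
  have c: "continuous_on UNIV (\<lambda>v :: nat \<Rightarrow> real. v i)" for i by simp
  have ipc: "continuous_on UNIV (\<lambda>v :: nat \<Rightarrow> real. ip n v v)"
    "continuous_on UNIV (\<lambda>v :: nat \<Rightarrow> real. ip n s v)" for s
    unfolding ip_def by (intro continuous_on_sum continuous_on_mult c continuous_on_const)+
  have K: "?K = (\<Inter>i\<in>{n..}. {v. v i = 0}) \<inter> {v. ip n v v = 1} \<inter> (\<Inter>s\<in>S. {v. ip n s v = 0})" by auto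
  have "closed ?K" unfolding K
    by (intro closed_Int closed_INT ballI closed_Collect_eq ipc c continuous_on_const)
  moreover have "?K \<subseteq> PiE UNIV (\<lambda>_. {- 1..1})"
  proof
    fix v assume v: "v \<in> ?K"
    have "\<bar>v i\<bar> \<le> 1" for i
    proof (cases "i < n")
      case True
      then have "(v i)\<^sup>2 \<le> ip n v v"
        unfolding ip_def power2_eq_square by (intro member_le_sum) auto
      then show ?thesis using v by (simp add: abs_square_le_1)
    qed (use v in auto)
    then show "v \<in> PiE UNIV (\<lambda>_. {- 1..1})" by (auto simp: abs_le_iff minus_le_iff)
  qed
  ultimately show ?thesis using compact_Int_closed[OF box, of ?K] by (simp add: Int_absorb1)
qed

lemma continuous_on_hform: "continuous_on UNIV (\<lambda>v. h \<bullet> hform n (X :: nat \<Rightarrow> nat \<Rightarrow>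
    'a::euclidean_space) v v)"
proof -
  have c: "continuous_on UNIV (\<lambda>v :: nat \<Rightarrow> real. v i)" for i by simp
  show ?thesis unfolding hform_def ip_def vform_def
    by (intro continuous_on_inner continuous_on_Pair continuous_on_sum continuous_on_mult
        continuous_on_scaleR c continuous_on_const)
qed

lemma minimum_on_sphere:
  fixes X :: "nat \<Rightarrow> nat \<Rightarrow> 'a::euclidean_space"
  assumes "\<exists>v. ip n v v \<noteq> 0 \<and> (\<forall>s\<in>S. ip n s v = 0)"
  obtains v where "ip n v v = 1" "\<forall>s\<in>S. ip n s v = 0"
    "\<And>w. (\<forall>s\<in>S. ip n s w = 0) \<Longrightarrow> (h \<bullet> hform n X v v) * ip n w w \<le> h \<bullet> hform n X w w"
proof -
  let ?K = "{v :: nat \<Rightarrow> real. (\<forall>i\<ge>n. v i = 0) \<and> ip n v v = 1 \<and> (\<forall>s\<in>S. ip n s v = 0)}"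
  \<comment> \<open>Normalised and cut off at \<open>n\<close>; forms of size \<open>n\<close> do
    not notice the cut.\<close>
  define nrm where "nrm w = (\<lambda>i. (1 / sqrt (ip n w w)) * (if i < n then w i else 0))" for w
  have nrm_ip: "ip n s (nrm w) = (1 / sqrt (ip n w w)) * ip n s w" "ip n (nrm w) s
      = (1 / sqrt (ip n w w)) * ip n w s" for s w
  proof -
    show 1: "ip n s (nrm w) = (1 / sqrt (ip n w w)) * ip n s w" for s
      by (simp add: ip_def nrm_def sum_distrib_left sum_divide_distrib)
    show "ip n (nrm w) s = (1 / sqrt (ip n w w)) * ip n w s"
      using 1[of s] by (simp add: ip_commute)
  qed
  have in_K: "nrm w \<in> ?K" if "ip n w w \<noteq> 0" "\<forall>s\<in>S. ip n s w = 0" for w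
  proof -
    have "ip n (nrm w) (nrm w) = (1 / sqrt (ip n w w)) * ((1 / sqrt (ip n w w)) * ip n w w)"
      by (simp only: nrm_ip)
    then have "ip n (nrm w) (nrm w) = 1" using that(1) ip_nonneg[of n w] by simp
    moreover have "\<forall>i\<ge>n. nrm w i = 0" by (simp add: nrm_def)
    moreover have "\<forall>s\<in>S. ip n s (nrm w) = 0" using that(2) by (simp add: nrm_ip(1))
    ultimately show ?thesis by simp
  qed
  have cont: "continuous_on ?K (\<lambda>v. h \<bullet> hform n X v v)"
    by (rule continuous_on_subset[OF continuous_on_hform]) simp
  obtain u where "ip n u u \<noteq> 0" "\<forall>s\<in>S. ip n s u = 0" using assms by blast
  then have "nrm u \<in> ?K" by (rule in_K)
  then have ne: "?K \<noteq> {}" by (metis empty_iff)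
  have "\<exists>v\<in>?K. \<forall>w\<in>?K. h \<bullet> hform n X v v \<le> h \<bullet> hform n X w w"
    by (rule continuous_attains_inf[OF compact_sphere ne cont])
  then obtain v where v: "v \<in> ?K" "\<forall>w\<in>?K. h \<bullet> hform n X v v \<le> h \<bullet> hform n X w w"
    by (rule bexE)
  show ?thesis
  proof (rule that)
    show "ip n v v = 1" "\<forall>s\<in>S. ip n s v = 0" using v(1) by auto
    fix w assume w: "\<forall>s\<in>S. ip n s w = 0"
    show "(h \<bullet> hform n X v v) * ip n w w \<le> h \<bullet> hform n X w w"
    proof (cases "ip n w w = 0")
      case True
      then have "hform n X w w = hform n X (\<lambda>_. 0) (\<lambda>_. 0)"
        by (intro hform_cong) (auto simp: ip_eq_0_iff)
      then show ?thesis using True by simp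
    next
      case False
      then have pos: "ip n w w > 0" using ip_nonneg[of n w] by linarith
      let ?r = "1 / sqrt (ip n w w)"
      have "hform n X (nrm w) (nrm w) = hform n X (\<lambda>i. ?r * w i) (\<lambda>i. ?r * w i)"
        by (rule hform_cong) (auto simp: nrm_def)
      also have "\<dots> = (1 / ip n w w) *\<^sub>R hform n X w w"
        unfolding hform_scale using pos by simp
      finally have "h \<bullet> hform n X v v \<le> (1 / ip n w w) * (h \<bullet> hform n X w w)"
        using bspec[OF v(2) in_K[OF False w]] by simp
      then show ?thesis using pos by (simp add: field_simps)
    qed
  qed
qed

text \<open>The minimum over the unit sphere of the complement of \<open>S\<close> is attained, and
  \<open>ker\<close> makes it positive. If the complement is zero, any constant will do.\<close>

lemma positive_on_complement:
  fixes X :: "nat \<Rightarrow> nat \<Rightarrow> 'a::euclidean_space"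
  assumes nonneg: "\<And>v. 0 \<le> h \<bullet> hform n X v v"
    and ker: "\<And>v. (\<forall>s\<in>S. ip n s v = 0) \<Longrightarrow> h \<bullet> hform n X v v = 0 \<Longrightarrow> ip n v v = 0"
  obtains e where "e > 0" "\<And>w. (\<forall>s\<in>S. ip n s w = 0) \<Longrightarrow> e * ip n w w \<le> h \<bullet> hform n X w w"
proof (cases "\<exists>v. ip n v v \<noteq> 0 \<and> (\<forall>s\<in>S. ip n s v = 0)")
  case True
  obtain v where v: "ip n v v = 1" "\<forall>s\<in>S. ip n s v = 0"
    "\<And>w. (\<forall>s\<in>S. ip n s w = 0) \<Longrightarrow> (h \<bullet> hform n X v v) * ip n w w \<le> h \<bullet> hform n X w w"
    using minimum_on_sphere[OF True] by blast
  have "h \<bullet> hform n X v v \<noteq> 0" using ker[OF v(2)] v(1) by auto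
  then have "h \<bullet> hform n X v v > 0" using nonneg[of v] by linarith
  then show ?thesis using that v(3) by blast
next
  case False
  show ?thesis
  proof (rule that[of 1])
    fix w assume "\<forall>s\<in>S. ip n s w = 0"
    then have "ip n w w = 0" using False by blast
    then show "1 * ip n w w \<le> h \<bullet> hform n X w w" using nonneg[of w] by simp
  qed simp
qed

lemma vform_app: "vform n (Q :: nat \<Rightarrow> nat \<Rightarrow> real) v w = ip n v (app n Q w)"
  by (simp add: vform_row ip_def app_def mult.commute)

text \<open>A minimiser \<open>v\<close> of the Rayleigh quotient, with minimum \<open>c\<close>, is
  a null vector of the nonnegative form \<open>Q - c I\<close>, hence in its kernel by
  Cauchy-Schwarz. As a functional on \<open>hform\<close> this form is the pair
  \<open>(- c, 1)\<close>.\<close>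

lemma symmetric_eigenvector:
  assumes "symm n (Q :: nat \<Rightarrow> nat \<Rightarrow> real)" "n > 0"
  obtains c v where "ip n v v = 1" "\<And>i. i < n \<Longrightarrow> app n Q v i = c * v i"
proof -
  have "\<exists>v. ip n v v \<noteq> 0 \<and> (\<forall>s\<in>{}. ip n s v = 0)"
    using assms(2) by (intro exI[of _ "unitv 0"]) (simp, simp add: unitv_def)
  then obtain v where v: "ip n v v = 1"
    "\<And>w. ((0, 1) \<bullet> hform n Q v v) * ip n w w \<le> (0, 1) \<bullet> hform n Q w w"
    by (rule minimum_on_sphere[where h = "(0, 1)" and X = Q]) blast
  define c where "c = vform n Q v v"
  have q: "(- c, 1) \<bullet> hform n Q x y = ip n x (app n Q y) - c * ip n x y" for x y
    by (simp add: hform_def vform_app)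
  have "((- c, 1) \<bullet> hform n Q (unitv i) v)\<^sup>2 \<le>
      ((- c, 1) \<bullet> hform n Q (unitv i) (unitv i)) * ((- c, 1) \<bullet> hform n Q v v)" for i
  proof (rule hform_cauchy_schwarz[OF assms(1)])
    fix w show "0 \<le> (- c, 1) \<bullet> hform n Q w w"
      using v(2)[of w] by (simp add: c_def hform_def)
  qed
  moreover have "(- c, 1) \<bullet> hform n Q v v = 0" using v(1) by (simp add: c_def hform_def)
  ultimately have "(- c, 1) \<bullet> hform n Q (unitv i) v = 0" for i by simp
  then have "app n Q v i = c * v i" if "i < n" for i
    using q[of "unitv i" v] that by simp
  then show ?thesis using that v(1) by blast
qed

section \<open>Decomposition into irreducible Arveson points\<close>

lemma lin_expand:
  fixes f :: "(nat \<Rightarrow> real) \<Rightarrow> 'a::real_vector"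
  assumes "\<And>v w s. f (\<lambda>i. v i + s * w i) = f v + s *\<^sub>R f w" "\<And>v. f v = f (\<lambda>i. if i < n then v i else 0)"
  shows "f v = lin n (\<lambda>i. f (unitv i)) v"
proof -
  have f0: "f (\<lambda>_. 0) = 0" using assms(1)[of "\<lambda>_. 0" 1 "\<lambda>_. 0"] by simp
  have "f (\<lambda>i. \<Sum>k<m. v k * unitv k i) = (\<Sum>k<m. v k *\<^sub>R f (unitv k))" for m
    by (induction m) (simp_all add: f0 assms(1))
  then show ?thesis using assms(2)[of v] unfolding vec_expand lin_def by simp
qed

lemma app_cong: "(\<And>i. i < n \<Longrightarrow> v i = v' i) \<Longrightarrow> app n V v = app n V v'"
  by (simp add: app_def)

lemma vform_cong:
  assumes "\<And>i j. i < n \<Longrightarrow> j < n \<Longrightarrow> X i j = X' i j" "\<And>i. i < n \<Longrightarrow> v i = v' i" "\<And>i. i < n \<Longrightarrow> w i = w' i"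
  shows "vform n X v w = vform n X' v' w'"
  using hform_cong[OF assms] by (simp add: hform_def)

lemma hform_sum_right: "hform n X w (\<lambda>i. \<Sum>k\<in>K. c k * v k i) = (\<Sum>k\<in>K. c k *\<^sub>R hform n X w (v k))"
proof (induction K rule: infinite_finite_induct)
  case (insert a K)
  have eq: "(\<lambda>i. \<Sum>k\<in>insert a K. c k * v k i) = (\<lambda>i. (\<Sum>k\<in>K. c k * v k i) + c a * v a i)"
    using insert.hyps by (simp add: add.commute)
  show ?case unfolding eq hform_right using insert by (simp add: add.commute)
qed simp_all

lemma hform_as_sum: "hform n X v w = (\<Sum>i<n. \<Sum>j<n. (v i * w j) *\<^sub>R (of_bool (i = j), X i j))"
proof (rule prod_eqI)
  show "fst (hform n X v w) = fst (\<Sum>i<n. \<Sum>j<n. (v i * w j) *\<^sub>R (of_bool (i = j), X i j))"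
    by (simp add: hform_def ip_def fst_sum)
  show "snd (hform n X v w) = snd (\<Sum>i<n. \<Sum>j<n. (v i * w j) *\<^sub>R (of_bool (i = j), X i j))"
    by (simp add: hform_def vform_def snd_sum)
qed

lemma hform_basis:
  assumes "orthonormal n g k"
  shows "hform n X (\<lambda>i. \<Sum>a<k. v a * g a i) (\<lambda>i. \<Sum>a<k. w a * g a i)
    = hform k (\<lambda>i j. vform n X (g i) (g j)) v w"
proof -
  have "hform n X (\<lambda>i. \<Sum>a<k. v a * g a i) (\<lambda>i. \<Sum>a<k. w a * g a i)
      = (\<Sum>a<k. v a *\<^sub>R (\<Sum>b<k. w b *\<^sub>R hform n X (g a) (g b)))"
    by (simp only: hform_sum hform_sum_right)
  also have "\<dots> = (\<Sum>a<k. \<Sum>b<k. (v a * w b) *\<^sub>R (of_bool (a = b), vform n X (g a) (g b)))"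
    using assms by (auto intro!: sum.cong simp: scaleR_sum_right hform_def orthonormal_def)
  finally show ?thesis by (simp add: hform_as_sum)
qed

lemma wmax_basis:
  assumes "wmax P n X" "orthonormal n g k"
  shows "wmax P k (\<lambda>i j. vform n X (g i) (g j))"
  by (rule wmax_compression[OF assms(1)]) (rule hform_basis[OF assms(2), symmetric])

lemma hform_change_basis:
  assumes "orthonormal n g n" "\<And>v i. i < n \<Longrightarrow> v i = proj n g n v i"
  shows "hform n X v w = hform n (\<lambda>i j. vform n X (g i) (g j)) (app n g v) (app n g w)"
proof -
  have e: "(\<Sum>a<n. app n g v a * g a i) = v i" if "i < n" for v i
    using assms(2)[OF that, of v] by (simp add: proj_def app_def ip_def mult.commute)
  have "hform n X v w = hform n X (\<lambda>i. \<Sum>a<n. app n g v a * g a i) (\<lambda>i. \<Sum>a<n. app n g w a * g a i)"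
    by (rule hform_cong) (simp_all add: e)
  then show ?thesis by (simp only: hform_basis[OF assms(1)])
qed

lemma sum_lessThan_add: "(\<Sum>i<k + (m::nat). f i) = (\<Sum>i<k. f i) + (\<Sum>i<m. f (k
    + i) :: 'b::comm_monoid_add)"
  by (induction m) (simp_all add: add.assoc)

lemma hform_block:
  assumes "\<And>i j. i < k \<Longrightarrow> j < m \<Longrightarrow> X i (k + j) = 0 \<and> X (k + j) i = 0"
  shows "hform (k + m) X v w = hform k X v w
    + hform m (\<lambda>i j. X (k + i) (k + j)) (\<lambda>i. v (k + i)) (\<lambda>i. w (k + i))"
  using assms unfolding hform_as_sum sum_lessThan_add
  by (simp add: sum.distrib flip: zero_prod_def)

lemma arvesonD: "arveson P n X \<Longrightarrow> dil_dir P n X b \<Longrightarrow> i < n \<Longrightarrow> b i = 0"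
  by (simp add: arveson_def)

text \<open>For fixed \<open>u\<close> the defect of the identity is linear in \<open>v\<close>. By
  Cauchy-Schwarz for \<open>Y\<close> and for \<open>X\<close>, its square is at most a constant
  times the form of \<open>X\<close> at \<open>v\<close>: it is a dilation direction, hence zero for
  an Arveson point.\<close>

lemma intertwining:
  fixes X :: "nat \<Rightarrow> nat \<Rightarrow> 'a::euclidean_space"
  assumes X: "arveson P n X" and Y: "wmax P k Y"
    and le: "\<And>h v. h \<in> dual_cone P \<Longrightarrow> h \<bullet> hform k Y (app n V v) (app n V v) \<le> h \<bullet> hform n X v v"
  shows "vform k Y u (app n V v) = vform n X (tapp k V u) v"
proof -
  define f where "f v = vform k Y u (app n V v) - vform n X (tapp k V u) v" for v
  have wX: "wmax P n X" using X by (simp add: arveson_def)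
  have f: "f v = lin n (\<lambda>i. f (unitv i)) v" for v
  proof (rule lin_expand)
    show "f (\<lambda>i. v i + s * w i) = f v + s *\<^sub>R f w" for v w s
      unfolding f_def app_linear vform_right by (simp add: algebra_simps)
    show "f v = f (\<lambda>i. if i < n then v i else 0)" for v
      unfolding f_def
      by (intro arg_cong2[of _ _ _ _ minus] vform_cong arg_cong[of _ _ "vform k Y u"] app_cong) auto
  qed
  have "dil_dir P n X (\<lambda>i. f (unitv i))" unfolding dil_dir_def
  proof
    fix h assume h: "h \<in> dual_cone P"
    let ?c = "2 * (h \<bullet> hform k Y u u) + 2 * (h \<bullet> hform n X (tapp k V u) (tapp k V u))"
    have "(snd h \<bullet> f v)\<^sup>2 \<le> ?c * (h \<bullet> hform n X v v)" for v
    proof -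
      let ?a = "h \<bullet> hform k Y u (app n V v)" and ?b = "h \<bullet> hform n X (tapp k V u) v"
      \<comment> \<open>The constant parts cancel, \<open>tapp\<close> being the transpose of
        \<open>app\<close>.\<close>
      have eq: "snd h \<bullet> f v = ?a - ?b"
        by (cases h) (simp add: f_def hform_def ip_app inner_diff_right)
      have "(snd h \<bullet> f v)\<^sup>2 \<le> 2 * ?a\<^sup>2 + 2 * ?b\<^sup>2"
        unfolding eq using zero_le_power2[of "?a + ?b"] by (simp add: power2_eq_square algebra_simps)
      moreover have "?a\<^sup>2 \<le> (h \<bullet> hform k Y u u) * (h \<bullet> hform n X v v)"
        by (rule order.trans[OF wmax_cauchy_schwarz[OF Y h]], rule mult_left_mono[OF le[OF h]])
           (rule wmaxD[OF Y h])
      moreover have "?b\<^sup>2 \<le> (h \<bullet> hform n X (tapp k V u) (tapp k V u)) * (h \<bullet> hform n X v v)"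
        by (rule wmax_cauchy_schwarz[OF wX h])
      ultimately show ?thesis by (simp add: algebra_simps)
    qed
    then show "\<exists>c. \<forall>v. (snd h \<bullet> lin n (\<lambda>i. f (unitv i)) v)\<^sup>2 \<le> c * (h \<bullet> hform n X v v)"
      unfolding f[symmetric] by blast
  qed
  then have "\<forall>i<n. f (unitv i) = 0" using arvesonD[OF X] by blast
  then have "f v = 0" by (subst f) (simp add: lin_def)
  then show ?thesis by (simp add: f_def)
qed

text \<open>A direction of \<open>Y\<close> pulls back along \<open>V\<close> to a direction of
  \<open>X\<close>, which is zero; the orthonormal rows of \<open>V\<close> recover the original
  one.\<close>

lemma arveson_summand:
  fixes X :: "nat \<Rightarrow> nat \<Rightarrow> 'a::euclidean_space"
  assumes X: "arveson P n X" and Y: "wmax P k Y"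
    and le: "\<And>h v. h \<in> dual_cone P \<Longrightarrow> h \<bullet> hform k Y (app n V v) (app n V v) \<le> h \<bullet> hform n X v v"
    and V: "orthonormal n V k"
  shows "arveson P k Y"
  unfolding arveson_def
proof (intro conjI allI impI Y)
  fix d j assume d: "dil_dir P k Y d" and j: "j < k"
  define d' where "d' i = (\<Sum>a<k. V a i *\<^sub>R d a)" for i
  have lin: "lin n d' v = lin k d (app n V v)" for v
    unfolding lin_def d'_def app_def
    by (simp add: scaleR_sum_left scaleR_sum_right, subst sum.swap) (simp add: mult.commute)
  have "dil_dir P n X d'" unfolding dil_dir_def
  proof
    fix h assume h: "h \<in> dual_cone P"
    obtain c where c: "c \<ge> 0" "\<And>v. (snd h \<bullet> lin k d v)\<^sup>2 \<le> c * (h \<bullet> hform k Y v v)"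
      using dil_dirE[OF d Y h] by blast
    have "(snd h \<bullet> lin n d' v)\<^sup>2 \<le> c * (h \<bullet> hform n X v v)" for v
      unfolding lin using c(2)[of "app n V v"] mult_left_mono[OF le[OF h, of v] c(1)] by linarith
    then show "\<exists>c. \<forall>v. (snd h \<bullet> lin n d' v)\<^sup>2 \<le> c * (h \<bullet> hform n X v v)" by blast
  qed
  then have "\<forall>i<n. d' i = 0" using X by (simp add: arveson_def)
  then have "0 = (\<Sum>i<n. V j i *\<^sub>R d' i)" by simp
  also have "\<dots> = (\<Sum>a<k. ip n (V j) (V a) *\<^sub>R d a)"
    unfolding d'_def ip_def
    by (simp add: scaleR_sum_left scaleR_sum_right, subst sum.swap) simp
  also have "\<dots> = (\<Sum>a<k. of_bool (j = a) *\<^sub>R d a)"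
    using V j by (intro sum.cong) (auto simp: orthonormal_def)
  also have "\<dots> = d j" using j by (simp add: of_bool_def if_distrib[of "\<lambda>c. c *\<^sub>R _"] cong: if_cong)
  finally show "d j = 0" by simp
qed

text \<open>The identity says that \<open>Q\<close> commutes with every coordinate of
  \<open>X\<close>. Symmetric \<open>Q\<close> suffice to detect invariant subspaces, whereas over
  the reals an irreducible tuple may commute with nonzero skew matrices.\<close>

definition irred :: "nat \<Rightarrow> (nat \<Rightarrow> nat \<Rightarrow> 'a::euclidean_space) \<Rightarrow> bool" where
  "irred n X \<longleftrightarrow> (\<forall>Q. symm n Q \<longrightarrow> (\<forall>v w. vform n X (app n Q v) w = vform n X v (app n Q w)) \<longrightarrow>
     (\<exists>c. \<forall>i<n. \<forall>j<n. Q i j = c * of_bool (i = j)))"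

text \<open>A symmetric matrix that is not scalar has an eigenspace that is neither zero nor
  everything. If it commutes with \<open>X\<close>, this eigenspace is invariant, and an adapted
  basis makes \<open>X\<close> block diagonal.\<close>

lemma reducible_split:
  fixes X :: "nat \<Rightarrow> nat \<Rightarrow> 'a::euclidean_space"
  assumes X: "symm n X" and "n > 0" and "\<not> irred n X"
  obtains g k where "0 < k" "k < n" "orthonormal n g n" "\<And>v i. i < n \<Longrightarrow> v i = proj n g n v i"
    "\<And>i j. i < k \<Longrightarrow> k \<le> j \<Longrightarrow> j < n \<Longrightarrow> vform n X (g i) (g j) = 0"
proof -
  obtain Q where Q: "symm n Q" "\<And>v w. vform n X (app n Q v) w = vform n X v (app n Q w)"
    "\<And>c. \<exists>i<n. \<exists>j<n. Q i j \<noteq> c * of_bool (i = j)"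
    using assms(3) unfolding irred_def by blast
  obtain c v where cv: "ip n v v = 1" "\<And>i. i < n \<Longrightarrow> app n Q v i = c * v i"
    by (rule symmetric_eigenvector[OF Q(1) assms(2)]) blast
  define S where "S = {v. \<forall>i<n. app n Q v i = c * v i}"
  have S: "subspace_fun S"
    unfolding subspace_fun_def
  proof (intro conjI ballI allI)
    show "(\<lambda>_. 0) \<in> S" by (simp add: S_def app_def)
    fix v w s assume "v \<in> S" "w \<in> S"
    then show "(\<lambda>i. v i + s * w i) \<in> S"
      by (auto simp: S_def app_linear algebra_simps)
  qed
  obtain g k where g: "k \<le> n" "orthonormal n g n" "\<And>j. j < k \<Longrightarrow> g j \<in> S"
    "\<And>j v. k \<le> j \<Longrightarrow> j < n \<Longrightarrow> v \<in> S \<Longrightarrow> ip n v (g j) = 0"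
    "\<And>v i. v \<in> S \<Longrightarrow> i < n \<Longrightarrow> v i = proj n g k v i"
    "\<And>v i. i < n \<Longrightarrow> v i = proj n g n v i"
    by (rule adapted_basis[OF S]) blast
  have "v \<in> S" using cv(2) by (simp add: S_def)
  have "k \<noteq> 0"
  proof
    assume "k = 0"
    then have "\<forall>i<n. v i = 0" using g(5)[OF \<open>v \<in> S\<close>] by (simp add: proj_def)
    then show False using cv(1) ip_eq_0_iff[of n v] by simp
  qed
  moreover have "k \<noteq> n"
  proof
    assume kn: "k = n"
    have "Q i j = c * of_bool (i = j)" if "i < n" "j < n" for i j
    proof -
      have "proj n g n (unitv j) \<in> S" using g(3) kn by (intro subspace_proj[OF S]) auto
      then have "app n Q (proj n g n (unitv j)) i = c * proj n g n (unitv j) i"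
        using that by (simp add: S_def)
      moreover have "app n Q (proj n g n (unitv j)) = app n Q (unitv j)"
        by (rule app_cong) (simp add: g(6)[symmetric])
      ultimately have "app n Q (unitv j) i = c * unitv j i"
        using g(6)[OF that(1), of "unitv j"] by simp
      then show ?thesis using that(2) by (simp add: app_def) (simp add: unitv_def)
    qed
    then show False using Q(3)[of c] by blast
  qed
  moreover have "vform n X (g i) (g j) = 0" if "i < k" "k \<le> j" "j < n" for i j
  proof (rule euclidean_eqI)
    fix b :: 'a
    \<comment> \<open>The image of \<open>g i\<close> under the coordinate of \<open>X\<close> in
      direction \<open>b\<close>. It is again an eigenvector of \<open>Q\<close>, while
      \<open>g j\<close> is orthogonal to the eigenspace.\<close>
    define z where "z a = b \<bullet> (\<Sum>l<n. g i l *\<^sub>R X a l)" for a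
    have z: "ip n z w = b \<bullet> vform n X w (g i)" for w
      by (simp add: z_def vform_row ip_def inner_sum_right mult.commute)
    have "z \<in> S" unfolding S_def
    proof (intro CollectI allI impI)
      fix a assume a: "a < n"
      have "app n Q z a = vform n Q (unitv a) z" by (simp add: vform_app a)
      also have "\<dots> = vform n Q z (unitv a)" by (rule vform_sym[OF Q(1)])
      also have "\<dots> = ip n z (app n Q (unitv a))" by (rule vform_app)
      also have "\<dots> = b \<bullet> vform n X (unitv a) (app n Q (g i))" by (simp add: z Q(2))
      also have "vform n X (unitv a) (app n Q (g i)) = vform n X (unitv a) (\<lambda>l. 0 + c * g i l)"
        using g(3)[OF that(1)] by (intro vform_cong) (auto simp: S_def)
      also have "\<dots> = c *\<^sub>R vform n X (unitv a) (g i)"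
        using vform_right[of n X "unitv a" "\<lambda>_. 0" c "g i"] by (simp add: vform_def[of n X _ "\<lambda>_. 0"])
      finally show "app n Q z a = c * z a" using z[of "unitv a"] a by simp
    qed
    then have "ip n z (g j) = 0" using g(4) that by blast
    then show "vform n X (g i) (g j) \<bullet> b = 0 \<bullet> b"
      by (simp add: z vform_sym[OF X, of "g i"] inner_commute)
  qed
  ultimately show ?thesis using that[of k g] g(1,2,6) by simp
qed

text \<open>Matrix convex combinations of members of \<open>K\<close>: the first components of the
  identity say that the products \<open>V^T V\<close> add up to the identity, the second ones that
  the congruences \<open>V^T Y V\<close> add up to \<open>X\<close>.\<close>

definition assembled :: "(nat \<Rightarrow> (nat \<Rightarrow> nat \<Rightarrow> 'a::euclidean_space) \<Rightarrow> bool) \<Rightarrow> nat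
    \<Rightarrow> (nat \<Rightarrow> nat \<Rightarrow> 'a) \<Rightarrow> bool" where
  "assembled K n X \<longleftrightarrow> (\<exists>L. (\<forall>(k, Y, V)\<in>set L. 0 < k \<and> K k Y) \<and>
     (\<forall>v w. hform n X v w = (\<Sum>(k, Y, V)\<leftarrow>L. hform k Y (app n V v) (app n V w))))"

definition mmult :: "nat \<Rightarrow> (nat \<Rightarrow> nat \<Rightarrow> real) \<Rightarrow> (nat \<Rightarrow> nat \<Rightarrow> real) \<Rightarrow> nat \<Rightarrow> nat \<Rightarrow> real" where
  "mmult k A B = (\<lambda>i j. \<Sum>p<k. A i p * B p j)"

lemma app_mmult: "app n (mmult k A B) v = app k A (app n B v)"
  unfolding app_def mmult_def
  by (rule ext, simp add: sum_distrib_left sum_distrib_right, subst sum.swap) (simp add: mult_ac)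

lemma assembled_compress:
  assumes "assembled K k Y" "\<And>v w. hform n X v w = hform k Y (app n V v) (app n V w)"
  shows "assembled K n X"
proof -
  obtain L where L: "\<forall>(k, Y, V)\<in>set L. 0 < k \<and> K k Y"
    "\<And>v w. hform k Y v w = (\<Sum>(l, Y, V)\<leftarrow>L. hform l Y (app k V v) (app k V w))"
    using assms(1) unfolding assembled_def by blast
  show ?thesis unfolding assembled_def
  proof (intro exI[of _ "map (\<lambda>(l, Y, A). (l, Y, mmult k A V)) L"] conjI allI)
    show "\<forall>(k, Y, V)\<in>set (map (\<lambda>(l, Y, A). (l, Y, mmult k A V)) L). 0 < k \<and> K k Y"
      using L(1) by auto
    show "hform n X v w = (\<Sum>(l, Y, A)\<leftarrow>map (\<lambda>(l, Y, A). (l, Y, mmult k A V)) L.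
        hform l Y (app n A v) (app n A w))" for v w
      unfolding assms(2) L(2) by (simp add: case_prod_unfold comp_def app_mmult)
  qed
qed

lemma assembled_add:
  assumes "assembled K k Y" "assembled K m Z"
    "\<And>v w. hform n X v w = hform k Y (app n V v) (app n V w) + hform m Z (app n W v) (app n W w)"
  shows "assembled K n X"
proof -
  obtain L where L: "\<forall>(k, Y, V)\<in>set L. 0 < k \<and> K k Y"
    "\<And>v w. hform k Y v w = (\<Sum>(l, Y, V)\<leftarrow>L. hform l Y (app k V v) (app k V w))"
    using assms(1) unfolding assembled_def by blast
  obtain M where M: "\<forall>(k, Y, V)\<in>set M. 0 < k \<and> K k Y"
    "\<And>v w. hform m Z v w = (\<Sum>(l, Y, V)\<leftarrow>M. hform l Y (app m V v) (app m V w))"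
    using assms(2) unfolding assembled_def by blast
  show ?thesis unfolding assembled_def
  proof (intro exI[of _ "map (\<lambda>(l, Y, A). (l, Y, mmult k A V)) L @ map (\<lambda>(l, Y, A). (l, Y, mmult m
      A W)) M"]
      conjI allI)
    show "\<forall>(k, Y, V)\<in>set (map (\<lambda>(l, Y, A). (l, Y, mmult k A V)) L @ map (\<lambda>(l, Y, A). (l, Y, mmult
        m A W)) M).
        0 < k \<and> K k Y"
      using L(1) M(1) by auto
    show "hform n X v w = (\<Sum>(l, Y, A)\<leftarrow>map (\<lambda>(l, Y, A). (l, Y, mmult k A V)) L @ map (\<lambda>(l, Y, A).
        (l, Y, mmult m A W)) M.
        hform l Y (app n A v) (app n A w))" for v w
      unfolding assms(3) L(2) M(2) by (simp add: case_prod_unfold comp_def app_mmult)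
  qed
qed

lemma assembled_base:
  assumes "K n X" "0 < n"
  shows "assembled K n X"
proof -
  have i: "app n (\<lambda>i. unitv i) v j = v j" if "j < n" for v j
    using that by (simp add: app_def)
  have "hform n X v w = hform n X (app n (\<lambda>i. unitv i) v) (app n (\<lambda>i. unitv i) w)" for v w
    by (rule hform_cong) (simp_all add: i)
  then show ?thesis unfolding assembled_def
    using assms by (intro exI[of _ "[(n, X, \<lambda>i. unitv i)]"]) simp
qed

text \<open>Each diagonal block of a reducible Arveson point has a form dominated by the whole one,
  so it is Arveson by \<open>arveson_summand\<close>, and it is smaller.\<close>

lemma arveson_assembled:
  fixes P :: "'a::euclidean_space set"
  assumes "arveson P n X" "0 < n"
  shows "assembled (\<lambda>k Y. arveson P k Y \<and> irred k Y) n X"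
  using assms
proof (induction n arbitrary: X rule: less_induct)
  case (less n)
  show ?case
  proof (cases "irred n X")
    case True
    then show ?thesis using less.prems by (intro assembled_base) auto
  next
    case False
    have X: "wmax P n X" using less.prems(1) by (simp add: arveson_def)
    obtain g k where g: "0 < k" "k < n" "orthonormal n g n" "\<And>v i. i < n \<Longrightarrow> v i = proj n g n v i"
      "\<And>i j. i < k \<Longrightarrow> k \<le> j \<Longrightarrow> j < n \<Longrightarrow> vform n X (g i) (g j) = 0"
      by (rule reducible_split[OF wmax_symm[OF X] less.prems(2) False]) blast
    define Z where "Z i j = vform n X (g i) (g j)" for i j
    define W where "W i j = Z (k + i) (k + j)" for i j
    have n: "n = k + (n - k)" using g(2) by simp
    have gk: "orthonormal n g k" "orthonormal n (\<lambda>i. g (k + i)) (n - k)"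
      using g(2,3) by (auto simp: orthonormal_def)
    have split: "hform n X v w = hform k Z (app n g v) (app n g w)
        + hform (n - k) W (app n (\<lambda>i. g (k + i)) v) (app n (\<lambda>i. g (k + i)) w)" for v w
    proof -
      have "hform n X v w = hform (k + (n - k)) Z (app n g v) (app n g w)"
        using hform_change_basis[OF g(3,4), where X = X and v = v and w = w] n
            by (simp add: Z_def[abs_def])
      also have "\<dots> = hform k Z (app n g v) (app n g w)
        + hform (n - k) W (\<lambda>i. app n g v (k + i)) (\<lambda>i. app n g w (k + i))"
        unfolding W_def
      proof (rule hform_block)
        fix i j assume "i < k" "j < n - k"
        then show "Z i (k + j) = 0 \<and> Z (k + j) i = 0"
          using g(5)[of i "k + j"] vform_sym[OF wmax_symm[OF X], of "g (k + j)" "g i"]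
          by (simp add: Z_def)
      qed
      finally show ?thesis by (simp add: app_def)
    qed
    have Z: "wmax P k Z" unfolding Z_def[abs_def] by (rule wmax_basis[OF X gk(1)])
    have W: "wmax P (n - k) W" unfolding W_def[abs_def] Z_def by (rule wmax_basis[OF X gk(2)])
    have "arveson P k Z"
    proof (rule arveson_summand[OF less.prems(1) Z _ gk(1)])
      show "h \<bullet> hform k Z (app n g v) (app n g v) \<le> h \<bullet> hform n X v v" if "h \<in> dual_cone P" for h v
        unfolding split inner_add_right using wmaxD[OF W that] by simp
    qed
    moreover have "arveson P (n - k) W"
    proof (rule arveson_summand[OF less.prems(1) W _ gk(2)])
      show "h \<bullet> hform (n - k) W (app n (\<lambda>i. g (k + i)) v) (app n (\<lambda>i. g (k + i)) v) \<le> h \<bullet> hform n X v v"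
        if "h \<in> dual_cone P" for h v
        unfolding split inner_add_right using wmaxD[OF Z that] by simp
    qed
    ultimately show ?thesis
      using g(1,2) by (intro assembled_add[OF _ _ split] less.IH) auto
  qed
qed

lemma wmax_assembled:
  fixes P :: "'a::euclidean_space set"
  assumes "polytope P" "P \<noteq> {}" "wmax P n X" "0 < n"
  shows "assembled (\<lambda>k Y. arveson P k Y \<and> irred k Y) n X"
proof -
  obtain N Y where Y: "n \<le> N" "arveson P N Y" "\<And>i j. i < n \<Longrightarrow> j < n \<Longrightarrow> Y i j = X i j"
    by (rule arveson_dilation[OF assms(1-3)]) blast
  show ?thesis
  proof (rule assembled_compress)
    show "assembled (\<lambda>k Y. arveson P k Y \<and> irred k Y) N Y"
      using Y assms(4) by (intro arveson_assembled) auto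
    show "hform n X v w = hform N Y (app n (\<lambda>i. unitv i) v) (app n (\<lambda>i. unitv i) w)" for v w
    proof -
      have a: "app n (\<lambda>i. unitv i) v i = (if i < n then v i else 0)" for v i
        by (simp add: app_def) (simp add: unitv_def)
      obtain m where N: "N = n + m" using Y(1) le_Suc_ex by blast
      show ?thesis unfolding N hform_as_sum sum_lessThan_add
        by (simp add: a Y(3) flip: zero_prod_def)
    qed
  qed
qed

text \<open>By \<open>intertwining\<close>, the product of \<open>Q = V^T V\<close> with a
  coordinate of \<open>X\<close> is the congruence of a symmetric matrix by \<open>V\<close>, hence
  symmetric; so \<open>Q\<close> commutes with \<open>X\<close>.\<close>

lemma irred_arveson_isometry:
  fixes X :: "nat \<Rightarrow> nat \<Rightarrow> 'a::euclidean_space"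
  assumes X: "arveson P n X" "irred n X" and Y: "wmax P k Y"
    and le: "\<And>h v. h \<in> dual_cone P \<Longrightarrow> h \<bullet> hform k Y (app n V v) (app n V v) \<le> h \<bullet> hform n X v v"
  obtains c where "\<And>v w. ip k (app n V v) (app n V w) = c * ip n v w"
proof -
  define Q where "Q i j = (\<Sum>a<k. V a i * V a j)" for i j
  have Qv: "app n Q v = tapp k V (app n V v)" for v
    unfolding app_def tapp_def Q_def
    by (rule ext, simp add: sum_distrib_left sum_distrib_right, subst sum.swap) (simp add: mult_ac)
  have Q: "vform n X (app n Q v) w = vform k Y (app n V v) (app n V w)" for v w
    unfolding Qv by (rule intertwining[OF X(1) Y le, symmetric])
  have "vform n X (app n Q v) w = vform n X v (app n Q w)" for v w
  proof -
    have "vform n X v (app n Q w) = vform n X (app n Q w) v"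
      using X(1) by (intro vform_sym wmax_symm[of P]) (simp add: arveson_def)
    then show ?thesis unfolding Q using vform_sym[OF wmax_symm[OF Y]] by simp
  qed
  moreover have "symm n Q" by (simp add: symm_def Q_def mult.commute)
  ultimately obtain c where c: "\<forall>i<n. \<forall>j<n. Q i j = c * of_bool (i = j)"
    using X(2) unfolding irred_def by blast
  have "app n Q w i = c * w i" if "i < n" for w i
  proof -
    have "app n Q w i = (\<Sum>j<n. c * of_bool (i = j) * w j)"
      unfolding app_def using that c by (intro sum.cong) auto
    then show ?thesis using that by (simp add: mult.assoc flip: sum_distrib_left)
  qed
  then have "ip n v (app n Q w) = c * ip n v w" for v w
    by (simp add: ip_def sum_distrib_left algebra_simps)
  moreover have "ip k (app n V v) (app n V w) = ip n v (app n Q w)" for v w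
    unfolding Qv ip_app using ip_app[of k "app n V w" n V v] ip_commute
    by (metis ip_app)
  ultimately have "ip k (app n V v) (app n V w) = c * ip n v w" for v w by simp
  then show ?thesis by (rule that)
qed

section \<open>Corners of polygons\<close>

lemma exposing_functional:
  fixes P :: "'a::euclidean_space set"
  assumes "polytope P" "T face_of P"
  obtains h where "h \<in> dual_cone P" "\<And>p. p \<in> P \<Longrightarrow> h \<bullet> (1, p) = 0 \<longleftrightarrow> p \<in> T"
proof -
  have "T exposed_face_of P"
    using assms by (simp add: exposed_face_of_polyhedron polytope_imp_polyhedron)
  then obtain a b where ab: "P \<subseteq> {x. a \<bullet> x \<le> b}" "T = P \<inter> {x. a \<bullet> x = b}"
    unfolding exposed_face_of_def by blast
  show ?thesis
  proof (rule that[of "(b, - a)"])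
    show "(b, - a) \<in> dual_cone P" using ab(1) by (auto simp: dual_cone_def inner_minus_left)
    show "(b, - a) \<bullet> (1, p) = 0 \<longleftrightarrow> p \<in> T" if "p \<in> P" for p
      using ab(2) that by (auto simp: inner_minus_left)
  qed
qed

text \<open>In a plane the kernel of \<open>l\<close> is a line, and a nonzero vector
  \<open>k\<close> of that line is orthogonal only to the zero vector of it.\<close>

lemma plane_coordinate:
  fixes D :: "'a::euclidean_space set"
  assumes "dim D = 2" "d0 \<in> D" "l \<bullet> d0 \<noteq> 0"
  obtains k where "k \<in> span D" "k \<noteq> 0" "l \<bullet> k = 0"
    "\<And>d. d \<in> span D \<Longrightarrow> l \<bullet> d = 0 \<Longrightarrow> k \<bullet> d = 0 \<Longrightarrow> d = 0"
proof -
  obtain B where B: "B \<subseteq> D" "independent B" "D \<subseteq> span B" "card B = 2"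
    using basis_exists[of D] assms(1) by metis
  then obtain b1 b2 where b: "B = {b1, b2}" "b1 \<noteq> b2" by (auto simp: card_2_iff)
  have spD: "span D = span B" using B(1,3) by (metis span_eq subset_trans span_superset)
  have comb: "\<exists>s t. d = s *\<^sub>R b1 + t *\<^sub>R b2" if "d \<in> span B" for d
  proof -
    have "\<exists>s. d - s *\<^sub>R b1 \<in> span {b2}" using that unfolding b(1) span_insert[of b1] by simp
    then obtain s where "d - s *\<^sub>R b1 \<in> span {b2}" by blast
    then obtain t where "d - s *\<^sub>R b1 = t *\<^sub>R b2" unfolding span_singleton by blast
    then have "d = s *\<^sub>R b1 + t *\<^sub>R b2" by (simp add: algebra_simps)
    then show ?thesis by blast
  qed
  have lb: "l \<bullet> b1 \<noteq> 0 \<or> l \<bullet> b2 \<noteq> 0"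
  proof (rule ccontr)
    assume "\<not> ?thesis"
    moreover obtain s t where "d0 = s *\<^sub>R b1 + t *\<^sub>R b2" using comb B(3) assms(2) by blast
    ultimately show False using assms(3) by (simp add: inner_add_right)
  qed
  define k where "k = (l \<bullet> b2) *\<^sub>R b1 - (l \<bullet> b1) *\<^sub>R b2"
  have kB: "k \<in> span B" unfolding k_def b(1) by (intro span_diff span_scale span_base) auto
  have "k \<noteq> 0"
  proof
    assume "k = 0"
    then have e: "(l \<bullet> b2) *\<^sub>R b1 = (l \<bullet> b1) *\<^sub>R b2" by (simp add: k_def)
    have i: "b1 \<notin> span {b2}" "b2 \<notin> span {b1}"
      using B(2) b unfolding dependent_def by (auto simp: insert_Diff_if)
    show False
    proof (cases "l \<bullet> b1 = 0")
      case True
      then have "b1 = 0" using e lb by auto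
      then show False using i(1) span_zero by metis
    next
      case False
      then have "b2 = ((l \<bullet> b2) / (l \<bullet> b1)) *\<^sub>R b1"
        using arg_cong[OF e, of "\<lambda>x. (1 / (l \<bullet> b1)) *\<^sub>R x"] by simp
      then show False using i(2) span_scale[OF span_base[of b1 "{b1}"]] by (metis singletonI)
    qed
  qed
  moreover have "d = 0" if "d \<in> span B" "l \<bullet> d = 0" "k \<bullet> d = 0" for d
  proof -
    obtain s t where d: "d = s *\<^sub>R b1 + t *\<^sub>R b2" using comb[OF \<open>d \<in> span B\<close>] by blast
    have st: "s * (l \<bullet> b1) + t * (l \<bullet> b2) = 0" using that(2) by (simp add: d inner_add_right)
    have "\<exists>c. d = c *\<^sub>R k"
    proof (cases "l \<bullet> b1 = 0")
      case True
      then have "t = 0" using st lb by auto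
      then have "d = (s / (l \<bullet> b2)) *\<^sub>R k" using True lb by (simp add: d k_def)
      then show ?thesis by blast
    next
      case False
      then have "s = - t * (l \<bullet> b2) / (l \<bullet> b1)" using st by (simp add: field_simps add_eq_0_iff)
      then have "d = (- t / (l \<bullet> b1)) *\<^sub>R k" using False by (simp add: d k_def scaleR_diff_right)
      then show ?thesis by blast
    qed
    then obtain c where c: "d = c *\<^sub>R k" by blast
    then have "c * (k \<bullet> k) = 0" using that(3) by simp
    then show "d = 0" using \<open>k \<noteq> 0\<close> c by simp
  qed
  moreover have "l \<bullet> k = 0" by (simp add: k_def inner_diff_right)
  ultimately show ?thesis using that[of k] kB spD by simp
qed

text \<open>In coordinates at a vertex \<open>p\<close> given by an exposing functional \<open>l\<close> and a second functional
  \<open>k\<close>, the neighbours of \<open>p\<close> are the vertices that minimise and maximise the slope \<open>k / l\<close>.\<close>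

lemma polygon_vertex:
  fixes F :: "'a::euclidean_space set"
  assumes F: "polytope F" "aff_dim F = 2" and p: "p extreme_point_of F"
  obtains p' p'' u v where "p' extreme_point_of F" "p'' extreme_point_of F"
    "\<And>q. q \<in> F \<Longrightarrow> 0 \<le> u \<bullet> (q - p)" "\<And>q. q \<in> F \<Longrightarrow> 0 \<le> v \<bullet> (q - p)"
    "u \<bullet> (p' - p) = 0" "v \<bullet> (p'' - p) = 0" "0 < u \<bullet> (p'' - p)" "0 < v \<bullet> (p' - p)"
    "\<And>q. q \<in> F \<Longrightarrow> q - p = (v \<bullet> (q - p) / (v \<bullet> (p' - p))) *\<^sub>R (p' - p)
       + (u \<bullet> (q - p) / (u \<bullet> (p'' - p))) *\<^sub>R (p'' - p)"
proof -
  define E where "E = {x. x extreme_point_of F}"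
  have E: "finite E" unfolding E_def by (rule finite_polyhedron_extreme_points[OF
      polytope_imp_polyhedron[OF F(1)]])
  have FE: "F = convex hull E" unfolding E_def
    by (rule Krein_Milman_Minkowski[OF polytope_imp_compact[OF F(1)] polytope_imp_convex[OF F(1)]])
  have pF: "p \<in> F" using p by (simp add: extreme_point_of_def)
  have EF: "E \<subseteq> F" by (auto simp: E_def extreme_point_of_def)
  define D where "D = (\<lambda>x. x - p) ` F"
  have dim: "dim D = 2"
    using aff_dim_eq_dim_subtract[OF hull_inc[OF pF]] F(2) unfolding D_def by simp
  obtain h where h: "h \<in> dual_cone F" "\<And>q. q \<in> F \<Longrightarrow> h \<bullet> (1, q) = 0 \<longleftrightarrow> q \<in> {p}"
    using exposing_functional[OF F(1), of "{p}"] p face_of_singleton by blast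
  define l where "l = snd h"
  have hl: "h \<bullet> (1, q) = l \<bullet> (q - p)" for q
    using h(2)[OF pF] by (cases h) (simp add: l_def inner_diff_right)
  have l: "l \<bullet> (q - p) > 0" if "q \<in> F" "q \<noteq> p" for q
  proof -
    have "0 \<le> h \<bullet> (1, q)" using h(1) that(1) unfolding dual_cone_def by blast
    moreover have "h \<bullet> (1, q) \<noteq> 0" using h(2)[OF that(1)] that(2) by blast
    ultimately show ?thesis unfolding hl by linarith
  qed
  have ne: "E - {p} \<noteq> {}"
  proof
    assume "E - {p} = {}"
    then have "E = {p}" using p by (auto simp: E_def)
    then have "F = {p}" using FE by simp
    then show False using F(2) by simp
  qed
  then obtain q0 where q0: "q0 \<in> E" "q0 \<noteq> p" by blast
  then have q0F: "q0 \<in> F" using EF by blast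
  have d0: "q0 - p \<in> D" "l \<bullet> (q0 - p) \<noteq> 0" using l[OF q0F q0(2)] q0F by (auto simp: D_def)
  obtain k where k: "k \<in> span D" "k \<noteq> 0" "l \<bullet> k = 0"
    "\<And>d. d \<in> span D \<Longrightarrow> l \<bullet> d = 0 \<Longrightarrow> k \<bullet> d = 0 \<Longrightarrow> d = 0"
    by (rule plane_coordinate[OF dim d0]) blast
  define r where "r q = (k \<bullet> (q - p)) / (l \<bullet> (q - p))" for q
  have fin: "finite (r ` (E - {p}))" "r ` (E - {p}) \<noteq> {}" using E ne by auto
  obtain p' where p': "p' \<in> E - {p}" "Min (r ` (E - {p})) = r p'" using Min_in[OF fin] by auto
  obtain p'' where p'': "p'' \<in> E - {p}" "Max (r ` (E - {p})) = r p''" using Max_in[OF fin] by auto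
  have bounds: "r p' \<le> r q" "r q \<le> r p''" if "q \<in> E - {p}" for q
    using that Min_le[OF fin(1)] Max_ge[OF fin(1)] by (auto simp flip: p'(2) p''(2))
  \<comment> \<open>Both vanish on a ray of extreme slope at \<open>p\<close>; at another vertex
    their value is \<open>l\<close> times a difference of slopes, hence nonnegative.\<close>
  define u where "u = k - r p' *\<^sub>R l"
  define v where "v = r p'' *\<^sub>R l - k"
  have ue: "u \<bullet> (q - p) = (l \<bullet> (q - p)) * (r q - r p')" "v \<bullet> (q - p) = (l \<bullet> (q - p)) * (r p'' - r q)"
    if "q \<in> E - {p}" for q
    using l[of q] that EF by (auto simp: u_def v_def r_def inner_diff_left field_simps)
  have u0: "0 \<le> u \<bullet> (q - p)" "0 \<le> v \<bullet> (q - p)" if "q \<in> E" for q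
  proof (atomize (full), cases "q = p")
    case False
    then have q: "q \<in> E - {p}" using that by blast
    then have "l \<bullet> (q - p) > 0" using l EF by blast
    then show "0 \<le> u \<bullet> (q - p) \<and> 0 \<le> v \<bullet> (q - p)" unfolding ue[OF q] using bounds[OF q] by simp
  qed simp
  have nonneg: "0 \<le> w \<bullet> (q - p)" if w: "\<And>q. q \<in> E \<Longrightarrow> 0 \<le> w \<bullet> (q - p)" and "q \<in> F" for w q
  proof -
    have "E \<subseteq> {x. w \<bullet> x \<ge> w \<bullet> p}" using w by (auto simp: inner_diff_right)
    then have "F \<subseteq> {x. w \<bullet> x \<ge> w \<bullet> p}" unfolding FE by (intro hull_minimal convex_halfspace_ge)
    then show ?thesis using that(2) by (auto simp: inner_diff_right)
  qed
  have lp: "l \<bullet> (p' - p) > 0" "l \<bullet> (p'' - p) > 0" using l p'(1) p''(1) EF by blast+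
  \<comment> \<open>Equal slopes would put \<open>F\<close> on a line: \<open>u\<close> would vanish
    on the span of all differences, which contains \<open>k\<close>, but
    \<open>u \<bullet> k = k \<bullet> k\<close>.\<close>
  have "r p' \<noteq> r p''"
  proof
    assume eq: "r p' = r p''"
    have "u \<bullet> (q - p) = 0" if "q \<in> F" for q
    proof -
      have "u \<bullet> (q - p) \<le> 0" using nonneg[OF u0(2) that] by (simp add: u_def v_def eq inner_diff_left)
      then show ?thesis using nonneg[OF u0(1) that] by simp
    qed
    then have "D \<subseteq> {x. u \<bullet> x = 0}" by (auto simp: D_def)
    then have "span D \<subseteq> {x. u \<bullet> x = 0}" by (intro span_minimal subspace_hyperplane)
    then have "u \<bullet> k = 0" using k(1) by blast
    then show False using k(2,3) by (simp add: u_def inner_diff_left)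
  qed
  then have lt: "r p' < r p''" using bounds(1)[OF p''(1)] by simp
  have pos: "0 < u \<bullet> (p'' - p)" "0 < v \<bullet> (p' - p)"
    unfolding ue[OF p'(1)] ue[OF p''(1)] using lp lt by simp_all
  have zero: "u \<bullet> (p' - p) = 0" "v \<bullet> (p'' - p) = 0" by (simp_all add: ue[OF p'(1)] ue[OF p''(1)])
  show ?thesis
  proof (rule that[OF _ _ nonneg[OF u0(1)] nonneg[OF u0(2)] zero pos])
    show "p' extreme_point_of F" "p'' extreme_point_of F" using p'(1) p''(1) by (auto simp: E_def)
    fix q assume q: "q \<in> F"
    define \<alpha> \<beta> where "\<alpha> = v \<bullet> (q - p) / (v \<bullet> (p' - p))" and "\<beta> = u \<bullet> (q - p) / (u \<bullet> (p'' - p))"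
    \<comment> \<open>The error of the expansion. It is killed by \<open>u\<close> and
      \<open>v\<close>, hence by \<open>u + v\<close>, a positive multiple of \<open>l\<close>, and
      then by \<open>k\<close>.\<close>
    define d where "d = (q - p) - \<alpha> *\<^sub>R (p' - p) - \<beta> *\<^sub>R (p'' - p)"
    have "q - p \<in> D" "p' - p \<in> D" "p'' - p \<in> D" using q p'(1) p''(1) EF by (auto simp: D_def)
    then have dD: "d \<in> span D" unfolding d_def by (intro span_diff span_scale span_base)
    have ud: "u \<bullet> d = 0" "v \<bullet> d = 0"
      using pos zero by (simp_all add: d_def inner_diff_right \<alpha>_def \<beta>_def)
    have "u \<bullet> d + v \<bullet> d = (r p'' - r p') * (l \<bullet> d)"
      by (simp add: u_def v_def inner_diff_left algebra_simps)
    then have "l \<bullet> d = 0" using ud lt by simp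
    moreover have "k \<bullet> d = 0" using ud(1) \<open>l \<bullet> d = 0\<close> by (simp add: u_def inner_diff_left)
    ultimately have "d = 0" using k(4) dD by blast
    then show "q - p = (v \<bullet> (q - p) / (v \<bullet> (p' - p))) *\<^sub>R (p' - p)
       + (u \<bullet> (q - p) / (u \<bullet> (p'' - p))) *\<^sub>R (p'' - p)"
      by (simp add: d_def \<alpha>_def \<beta>_def algebra_simps)
  qed
qed

text \<open>For \<open>c < 1\<close> the point \<open>p\<close> lies between \<open>x\<close> and
  \<open>a\<close>, for \<open>c > 1\<close> the point \<open>a\<close> lies between
  \<open>x\<close> and \<open>p\<close>.\<close>

lemma extreme_points_not_collinear:
  assumes "p extreme_point_of F" "a extreme_point_of F" "x extreme_point_of F"
    and "p \<noteq> a" "p \<noteq> x" "0 \<le> c" "p - x = c *\<^sub>R (a - x)"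
  shows False
proof -
  have F: "p \<in> F" "a \<in> F" "x \<in> F" using assms(1-3) by (auto simp: extreme_point_of_def)
  have "a \<noteq> x" "c \<noteq> 0" "c \<noteq> 1" using assms by auto
  show False
  proof (cases "c < 1")
    case True
    then have "p \<in> open_segment x a"
      unfolding in_segment using assms \<open>a \<noteq> x\<close> \<open>c \<noteq> 0\<close>
      by (intro conjI exI[of _ c]) (auto simp: algebra_simps)
    then show False using assms(1) F by (auto simp: extreme_point_of_def)
  next
    case False
    then have "c > 1" using \<open>c \<noteq> 1\<close> by simp
    have "a - x = (1 / c) *\<^sub>R (p - x)" unfolding assms(7) using \<open>c > 1\<close> by simp
    then have "a = x + (1 / c) *\<^sub>R (p - x)" by (metis add.commute diff_add_cancel)
    then have "a = (1 - 1 / c) *\<^sub>R x + (1 / c) *\<^sub>R p" by (simp add: algebra_simps)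
    then have "a \<in> open_segment x p"
      unfolding in_segment using assms(5) \<open>c > 1\<close> by (intro conjI exI[of _ "1 / c"]) auto
    then show False using assms(2) F by (auto simp: extreme_point_of_def)
  qed
qed

text \<open>A vertex \<open>p\<close> that is neither \<open>x\<close> nor a neighbour of \<open>x\<close>: both edges at \<open>p\<close> miss \<open>x\<close>.\<close>

lemma polygon_opposite_vertex:
  fixes F :: "'a::euclidean_space set"
  assumes F: "polytope F" "aff_dim F = 2" "\<not> (\<exists>n. n simplex F)" and x: "x extreme_point_of F"
  obtains p p' p'' u v where "p \<in> F" "p' \<in> F" "p'' \<in> F"
    "\<And>q. q \<in> F \<Longrightarrow> 0 \<le> u \<bullet> (q - p)" "\<And>q. q \<in> F \<Longrightarrow> 0 \<le> v \<bullet> (q - p)"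
    "u \<bullet> (p' - p) = 0" "v \<bullet> (p'' - p) = 0" "0 < u \<bullet> (x - p)" "0 < v \<bullet> (x - p)"
    "\<And>q. q \<in> F \<Longrightarrow> \<exists>a b. 0 \<le> a \<and> 0 \<le> b \<and> q = p + a *\<^sub>R (p' - p) + b *\<^sub>R (p'' - p)"
proof -
  define E where "E = {x. x extreme_point_of F}"
  have FE: "F = convex hull E" unfolding E_def
    by (rule Krein_Milman_Minkowski[OF polytope_imp_compact[OF F(1)] polytope_imp_convex[OF F(1)]])
  have EF: "E \<subseteq> F" by (auto simp: E_def extreme_point_of_def)
  obtain a' a'' U V where X: "a' extreme_point_of F" "a'' extreme_point_of F"
    "\<And>q. q \<in> F \<Longrightarrow> 0 \<le> U \<bullet> (q - x)" "\<And>q. q \<in> F \<Longrightarrow> 0 \<le> V \<bullet> (q - x)"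
    "U \<bullet> (a' - x) = 0" "V \<bullet> (a'' - x) = 0" "0 < U \<bullet> (a'' - x)" "0 < V \<bullet> (a' - x)"
    "\<And>q. q \<in> F \<Longrightarrow> q - x = (V \<bullet> (q - x) / (V \<bullet> (a' - x))) *\<^sub>R (a' - x)
       + (U \<bullet> (q - x) / (U \<bullet> (a'' - x))) *\<^sub>R (a'' - x)"
    by (rule polygon_vertex[OF F(1,2) x]) blast
  \<comment> \<open>Otherwise \<open>F\<close> would be the hull of three points with affine
    dimension 2, a triangle.\<close>
  have "\<not> E \<subseteq> {x, a', a''}"
  proof
    assume "E \<subseteq> {x, a', a''}"
    then have eq: "F = convex hull {x, a', a''}" using FE X(1,2) x
        by (metis E_def empty_subsetI insert_subset mem_Collect_eq subset_antisym)
    have "aff_dim {x, a', a''} = 2" using F(2) unfolding eq aff_dim_convex_hull .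
    moreover from this have "3 \<le> card {x, a', a''}" using aff_dim_le_card[of "{x, a', a''}"] by simp
    moreover have "card {x, a', a''} \<le> 3" by (simp add: card_insert_if)
    ultimately have "\<not> affine_dependent {x, a', a''} \<and> int (card {x, a', a''}) = 2 + 1"
      unfolding affine_independent_iff_card by simp
    then have "2 simplex F" unfolding simplex_def using eq by blast
    then show False using F(3) by blast
  qed
  then obtain p where p: "p extreme_point_of F" "p \<noteq> x" "p \<noteq> a'" "p \<noteq> a''"
    by (auto simp: E_def)
  have pF: "p \<in> F" "x \<in> F" "a' \<in> F" "a'' \<in> F" using p(1) x X(1,2) by (auto simp: extreme_point_of_def)
  obtain p' p'' u v where P: "p' extreme_point_of F" "p'' extreme_point_of F"
    "\<And>q. q \<in> F \<Longrightarrow> 0 \<le> u \<bullet> (q - p)" "\<And>q. q \<in> F \<Longrightarrow> 0 \<le> v \<bullet> (q - p)"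
    "u \<bullet> (p' - p) = 0" "v \<bullet> (p'' - p) = 0" "0 < u \<bullet> (p'' - p)" "0 < v \<bullet> (p' - p)"
    "\<And>q. q \<in> F \<Longrightarrow> q - p = (v \<bullet> (q - p) / (v \<bullet> (p' - p))) *\<^sub>R (p' - p)
       + (u \<bullet> (q - p) / (u \<bullet> (p'' - p))) *\<^sub>R (p'' - p)"
    by (rule polygon_vertex[OF F(1,2) p(1)]) blast
  have pF': "p' \<in> F" "p'' \<in> F" using P(1,2) by (auto simp: extreme_point_of_def)
  \<comment> \<open>To be applied to \<open>u\<close> and \<open>v\<close>. If \<open>w\<close> did
    not separate \<open>x\<close> from \<open>p\<close>, both would minimise \<open>w\<close> on
    \<open>F\<close>. As \<open>p\<close> is not a neighbour of \<open>x\<close>, both edges at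
    \<open>x\<close> occur in \<open>p - x\<close> with positive coefficients, so \<open>w\<close>
    would be constant on \<open>F\<close>.\<close>
  have pos: "0 < w \<bullet> (x - p)" if w: "\<And>q. q \<in> F \<Longrightarrow> 0 \<le> w \<bullet> (q - p)" and q0: "q0 \<in> F"
      "0 < w \<bullet> (q0 - p)" for w q0
  proof (rule ccontr)
    assume "\<not> 0 < w \<bullet> (x - p)"
    then have wx: "w \<bullet> x = w \<bullet> p" using w[OF pF(2)] by (simp add: inner_diff_right)
    define \<alpha> \<beta> where "\<alpha> = V \<bullet> (p - x) / (V \<bullet> (a' - x))" and "\<beta> = U \<bullet> (p - x) / (U \<bullet> (a'' - x))"
    have ab: "0 \<le> \<alpha>" "0 \<le> \<beta>" unfolding \<alpha>_def \<beta>_def using X(3,4)[OF pF(1)] X(7,8) by simp_all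
    have px: "p - x = \<alpha> *\<^sub>R (a' - x) + \<beta> *\<^sub>R (a'' - x)" unfolding \<alpha>_def \<beta>_def by (rule X(9)[OF pF(1)])
    have wa: "0 \<le> w \<bullet> (a' - x)" "0 \<le> w \<bullet> (a'' - x)"
      using w[OF pF(3)] w[OF pF(4)] wx by (simp_all add: inner_diff_right)
    have "w \<bullet> (p - x) = \<alpha> * (w \<bullet> (a' - x)) + \<beta> * (w \<bullet> (a'' - x))" unfolding px
        by (simp add: inner_add_right)
    then have "\<alpha> * (w \<bullet> (a' - x)) + \<beta> * (w \<bullet> (a'' - x)) = 0" using wx by (simp add: inner_diff_right)
    then have z: "\<alpha> * (w \<bullet> (a' - x)) = 0" "\<beta> * (w \<bullet> (a'' - x)) = 0"
      using ab wa by (auto simp: add_nonneg_eq_0_iff)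
    show False
    proof (cases "\<alpha> = 0 \<or> \<beta> = 0")
      case True
      then show False
      proof
        assume "\<alpha> = 0"
        then show False using extreme_points_not_collinear[OF p(1) X(2) x p(4,2) ab(2)] px by simp
      next
        assume "\<beta> = 0"
        then show False using extreme_points_not_collinear[OF p(1) X(1) x p(3,2) ab(1)] px by simp
      qed
    next
      case False
      then have "w \<bullet> (a' - x) = 0" "w \<bullet> (a'' - x) = 0" using z by auto
      then have "w \<bullet> (q0 - x) = 0" by (subst X(9)[OF q0(1)]) (simp add: inner_add_right)
      then show False using q0(2) wx by (simp add: inner_diff_right)
    qed
  qed
  show ?thesis
  proof (rule that[OF pF(1) pF' P(3,4,5,6) pos[OF P(3) pF'(2) P(7)] pos[OF P(4) pF'(1) P(8)]])
    fix q assume q: "q \<in> F"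
    have "q = p + (v \<bullet> (q - p) / (v \<bullet> (p' - p))) *\<^sub>R (p' - p)
       + (u \<bullet> (q - p) / (u \<bullet> (p'' - p))) *\<^sub>R (p'' - p)"
      using P(9)[OF q] by (simp add: algebra_simps)
    moreover have "0 \<le> v \<bullet> (q - p) / (v \<bullet> (p' - p))" "0 \<le> u \<bullet> (q - p) / (u \<bullet> (p'' - p))"
      using P(3,4)[OF q] P(7,8) by simp_all
    ultimately show "\<exists>a b. 0 \<le> a \<and> 0 \<le> b \<and> q = p + a *\<^sub>R (p' - p) + b *\<^sub>R (p'' - p)" by blast
  qed
qed

section \<open>Tilted dilations of points of a polygonal face\<close>

definition pair_mat :: "'a \<Rightarrow> 'a \<Rightarrow> 'a \<Rightarrow> nat \<Rightarrow> nat \<Rightarrow> 'a" where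
  "pair_mat a b c = (\<lambda>i j. if i = 0 then (if j = 0 then a else b) else (if j = 0 then b else c))"

lemma hform_pair_mat:
  "hform 2 (pair_mat a b c) v v =
    (v 0)\<^sup>2 *\<^sub>R (1, a) + (2 * v 0 * v 1) *\<^sub>R (0, b) + (v 1)\<^sup>2 *\<^sub>R (1, c)"
  by (simp add: hform_as_sum pair_mat_def numeral_2_eq_2 power2_eq_square flip: scaleR_2)
    (simp add: algebra_simps flip: scaleR_2)

text \<open>For a functional vanishing at \<open>p\<close> the form is a sum of squares with
  nonnegative weights, whatever \<open>t\<close> is. Any other one is positive at \<open>p\<close>
  and, by \<open>van\<close>, at \<open>z\<close>; it stays nonnegative for small \<open>t\<close>,
  since at \<open>t = 0\<close> the point is diagonal.\<close>

lemma tilted_pair_wmax: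
  fixes P :: "'a::euclidean_space set"
  assumes P: "polytope P" "p \<in> P" "p' \<in> P" "p'' \<in> P" and ab: "0 \<le> a" "0 \<le> b"
    and z: "z = p + a *\<^sub>R (p' - p) + b *\<^sub>R (p'' - p)" "z \<in> P"
    and van: "\<And>h. h \<in> dual_cone P \<Longrightarrow> h \<bullet> (1, z) = 0 \<Longrightarrow> h \<bullet> (1, p) = 0"
  obtains t where "t > 0"
    "wmax P 2 (pair_mat (p + t\<^sup>2 *\<^sub>R a *\<^sub>R (p' - p)) (- t *\<^sub>R a *\<^sub>R (p' - p)) z)"
proof -
  obtain J where J: "finite J" "J \<subseteq> dual_cone P"
    "\<And>n X. symm n X \<Longrightarrow> (\<And>h v. h \<in> J \<Longrightarrow> 0 \<le> h \<bullet> hform n X v v) \<Longrightarrow> wmax P n X"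
    using wmax_finite_test[OF P(1)] by blast
  define M where "M t = pair_mat (p + t\<^sup>2 *\<^sub>R a *\<^sub>R (p' - p)) (- t *\<^sub>R a *\<^sub>R (p' - p)) z" for t :: real
  define A where "A h = a * (h \<bullet> (1, p') - h \<bullet> (1, p))" for h :: "real \<times> 'a"
  define B where "B h = b * (h \<bullet> (1, p'') - h \<bullet> (1, p))" for h :: "real \<times> 'a"
  have hz: "h \<bullet> (1, z) = h \<bullet> (1, p) + A h + B h" for h
    by (cases h) (simp add: z(1) A_def B_def inner_add_right inner_diff_right algebra_simps)
  have form: "h \<bullet> hform 2 (M t) v v = ((v 0)\<^sup>2 + (v 1)\<^sup>2) * (h \<bullet> (1, p))
      + A h * (t * v 0 - v 1)\<^sup>2 + B h * (v 1)\<^sup>2" for h t v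
    by (cases h) (simp add: M_def hform_pair_mat z(1) A_def B_def inner_add_right inner_diff_right
        power2_eq_square algebra_simps)
  have ev: "\<forall>\<^sub>F t in at_right 0. \<forall>v. 0 \<le> h \<bullet> hform 2 (M t) v v" if "h \<in> J" for h
  proof -
    have hH: "h \<in> dual_cone P" using that J(2) by blast
    have nn: "0 \<le> h \<bullet> (1, p)" "0 \<le> h \<bullet> (1, p')" "0 \<le> h \<bullet> (1, p'')" "0 \<le> h \<bullet> (1, z)"
      using hH P(2-4) z(2) by (auto simp: dual_cone_def)
    show ?thesis
    proof (cases "h \<bullet> (1, p) = 0")
      case True
      then have "0 \<le> A h" "0 \<le> B h" using ab nn by (simp_all add: A_def B_def)
      then show ?thesis unfolding form using True by (intro always_eventually allI) simp
    next
      case False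
      then have hp: "h \<bullet> (1, p) > 0" using nn by simp
      then have hz0: "h \<bullet> (1, z) > 0" using nn(4) van[OF hH] by (cases "h \<bullet> (1, z) = 0") auto
      have "\<forall>\<^sub>F t in at_right (0::real). 0 < h \<bullet> (1, p) + A h * t\<^sup>2"
      proof (rule order_tendstoD(1))
        show "((\<lambda>t. h \<bullet> (1, p) + A h * t\<^sup>2) \<longlongrightarrow> h \<bullet> (1, p) + A h * 0\<^sup>2) (at_right (0::real))"
          by (intro tendsto_intros)
      qed (use hp in simp)
      \<comment> \<open>The determinant of the form, which at \<open>t = 0\<close> is the product of
        the values at \<open>p\<close> and \<open>z\<close>.\<close>
      moreover have "\<forall>\<^sub>F t in at_right (0::real). 0 < (h \<bullet> (1, p)
          + A h * t\<^sup>2) * (h \<bullet> (1, z)) - (- t * A h)\<^sup>2"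
      proof (rule order_tendstoD(1))
        show "((\<lambda>t. (h \<bullet> (1, p) + A h * t\<^sup>2) * (h \<bullet> (1, z)) - (- t * A h)\<^sup>2) \<longlongrightarrow>
            (h \<bullet> (1, p) + A h * 0\<^sup>2) * (h \<bullet> (1, z)) - (- 0 * A h)\<^sup>2) (at_right (0::real))"
          by (intro tendsto_intros)
      qed (use hp hz0 in simp)
      ultimately show ?thesis
      proof eventually_elim
        case (elim t)
        show ?case
        proof
          fix v :: "nat \<Rightarrow> real"
          show "0 \<le> h \<bullet> hform 2 (M t) v v"
          proof (cases "v 0 = 0")
            case True
            have "h \<bullet> hform 2 (M t) v v = (v 1)\<^sup>2 * (h \<bullet> (1, z))"
              unfolding form hz using True by (simp add: algebra_simps)
            then show ?thesis using hz0 by simp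
          next
            case False
            have "0 \<le> h \<bullet> (1, p) + A h * t\<^sup>2 + 2 * (v 1 / v 0) * (- t * A h)
                + (v 1 / v 0)\<^sup>2 * (h \<bullet> (1, z))"
              using elim hz0 by (intro quadratic_nonneg) auto
            then have "0 \<le> (v 0)\<^sup>2 * (h \<bullet> (1, p) + A h * t\<^sup>2 + 2 * (v 1 / v 0) * (- t * A h)
                + (v 1 / v 0)\<^sup>2 * (h \<bullet> (1, z)))" by simp
            also have "\<dots> = h \<bullet> hform 2 (M t) v v"
              unfolding form hz using False by (simp add: field_simps power2_eq_square)
            finally show ?thesis .
          qed
        qed
      qed
    qed
  qed
  have "\<forall>\<^sub>F t in at_right 0. \<forall>h\<in>J. \<forall>v. 0 \<le> h \<bullet> hform 2 (M t) v v"
    using J(1) ev by (intro eventually_ball_finite) blast+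
  moreover have "\<forall>\<^sub>F t in at_right (0::real). t > 0" by (rule eventually_at_right_less)
  ultimately have "\<forall>\<^sub>F t in at_right (0::real). t > 0 \<and> (\<forall>h\<in>J. \<forall>v. 0 \<le> h \<bullet> hform 2 (M t) v v)"
    by eventually_elim simp
  then obtain t where t: "t > 0" "\<forall>h\<in>J. \<forall>v. 0 \<le> h \<bullet> hform 2 (M t) v v"
    using eventually_happens'[OF trivial_limit_at_right_real] by blast
  have "wmax P 2 (M t)"
    by (rule J(3)) (use t(2) in \<open>auto simp: symm_def M_def pair_mat_def\<close>)
  then show ?thesis using that[OF t(1)] by (simp add: M_def)
qed

text \<open>\<open>u\<close> supports \<open>F\<close> but perhaps not \<open>P\<close>. The face of
  \<open>F\<close> that it cuts out is also a face of \<open>P\<close>, hence exposed by a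
  functional nonnegative on all of \<open>P\<close>.\<close>

lemma face_exposing_edge:
  fixes P F :: "'a::euclidean_space set"
  assumes "polytope P" "F face_of P" and u: "\<And>q. q \<in> F \<Longrightarrow> 0 \<le> u \<bullet> (q - p)"
  obtains h where "h \<in> dual_cone P" "\<forall>q\<in>F. h \<bullet> (1, q) = 0 \<longleftrightarrow> u \<bullet> (q - p) = 0"
proof -
  have "F \<inter> {x. u \<bullet> x = u \<bullet> p} face_of F"
    using u face_of_imp_convex[OF assms(2)]
    by (intro face_of_Int_supporting_hyperplane_ge) (auto simp: inner_diff_right)
  then have "F \<inter> {x. u \<bullet> x = u \<bullet> p} face_of P" using assms(2) by (rule face_of_trans)
  then obtain h where h: "h \<in> dual_cone P" "\<And>q. q \<in> P \<Longrightarrow> h \<bullet> (1, q) = 0 \<longleftrightarrow> q \<in> F \<inter> {x. u \<bullet> x = u \<bullet> p}"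
    using exposing_functional[OF assms(1)] by blast
  show ?thesis
  proof (rule that[OF h(1)])
    show "\<forall>q\<in>F. h \<bullet> (1, q) = 0 \<longleftrightarrow> u \<bullet> (q - p) = 0"
      using h(2) face_of_imp_subset[OF assms(2)] by (auto simp: inner_diff_right)
  qed
qed

lemma tilted_dilation:
  fixes P F :: "'a::euclidean_space set"
  assumes P: "polytope P" and F: "F face_of P" "aff_dim F = 2" "\<not> (\<exists>n. n simplex F)"
    and x: "x extreme_point_of F"
  obtains u v y where "u \<in> dual_cone P" "v \<in> dual_cone P" "0 < u \<bullet> (1, x)" "0 < v \<bullet> (1, x)"
    "\<And>e. 0 < e \<Longrightarrow> e \<le> 1 \<Longrightarrow> \<exists>t>0. \<exists>X. wmax P 2 X \<and> X 1 1 = (1 - e) *\<^sub>R x + e *\<^sub>R y \<and>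
      u \<bullet> hform 2 X (\<lambda>i. of_bool (i = 0)) (\<lambda>i. of_bool (i = 0)) = 0 \<and>
      v \<bullet> hform 2 X (\<lambda>i. if i = 0 then 1 else t) (\<lambda>i. if i = 0 then 1 else t) = 0"
proof -
  have FP: "F \<subseteq> P" by (rule face_of_imp_subset[OF F(1)])
  have polyF: "polytope F" by (rule face_of_polytope_polytope[OF P F(1)])
  have xF: "x \<in> F" using x by (simp add: extreme_point_of_def)
  have cF: "convex F" by (rule polytope_imp_convex[OF polyF])
  obtain y where y: "y \<in> rel_interior F" using rel_interior_eq_empty[OF cF] xF by blast
  obtain p p' p'' u0 v0 where g: "p \<in> F" "p' \<in> F" "p'' \<in> F"
    "\<And>q. q \<in> F \<Longrightarrow> 0 \<le> u0 \<bullet> (q - p)" "\<And>q. q \<in> F \<Longrightarrow> 0 \<le> v0 \<bullet> (q - p)"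
    "u0 \<bullet> (p' - p) = 0" "v0 \<bullet> (p'' - p) = 0" "0 < u0 \<bullet> (x - p)" "0 < v0 \<bullet> (x - p)"
    "\<And>q. q \<in> F \<Longrightarrow> \<exists>a b. 0 \<le> a \<and> 0 \<le> b \<and> q = p + a *\<^sub>R (p' - p) + b *\<^sub>R (p'' - p)"
    by (rule polygon_opposite_vertex[OF polyF F(2,3) x]) blast
  obtain u where u: "u \<in> dual_cone P" "\<forall>q\<in>F. u \<bullet> (1, q) = 0 \<longleftrightarrow> u0 \<bullet> (q - p) = 0"
    by (rule face_exposing_edge[OF P F(1) g(4)])
  obtain v where v: "v \<in> dual_cone P" "\<forall>q\<in>F. v \<bullet> (1, q) = 0 \<longleftrightarrow> v0 \<bullet> (q - p) = 0"
    by (rule face_exposing_edge[OF P F(1) g(5)])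
  have zero: "u \<bullet> (1, p) = 0" "u \<bullet> (1, p') = 0" "v \<bullet> (1, p) = 0" "v \<bullet> (1, p'') = 0"
    using u(2) v(2) g(1,2,3,6,7) by simp_all
  have x0: "u \<bullet> (1, x) \<noteq> 0" "v \<bullet> (1, x) \<noteq> 0" using bspec[OF u(2) xF] bspec[OF v(2) xF] g(8,9)
      by simp_all
  have "0 \<le> u \<bullet> (1, x)" "0 \<le> v \<bullet> (1, x)" using u(1) v(1) xF FP by (auto simp: dual_cone_def)
  then have pos: "0 < u \<bullet> (1, x)" "0 < v \<bullet> (1, x)" using x0 by simp_all
  show ?thesis
  proof (rule that[OF u(1) v(1) pos, of y])
    fix e :: real assume e: "0 < e" "e \<le> 1"
    define z where "z = (1 - e) *\<^sub>R x + e *\<^sub>R y"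
    \<comment> \<open>In the relative interior, so that a functional of the cone vanishing at
      \<open>z\<close> vanishes on \<open>F\<close>, in particular at \<open>p\<close>.\<close>
    have "x - e *\<^sub>R (x - y) \<in> rel_interior F" by (rule rel_interior_convex_shrink[OF cF y xF e])
    then have zr: "z \<in> rel_interior F" by (simp add: z_def algebra_simps)
    then have zF: "z \<in> F" using rel_interior_subset by blast
    obtain a b where ab: "0 \<le> a" "0 \<le> b" "z = p + a *\<^sub>R (p' - p) + b *\<^sub>R (p'' - p)"
      using g(10)[OF zF] by blast
    have van: "h \<bullet> (1, p) = 0" if "h \<in> dual_cone P" "h \<bullet> (1, z) = 0" for h
    proof (rule dual_cone_vanish[OF _ cF zr that(2) g(1)])
      show "h \<in> dual_cone F" using that(1) FP by (auto simp: dual_cone_def)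
    qed
    obtain t where t: "t > 0" "wmax P 2 (pair_mat (p
        + t\<^sup>2 *\<^sub>R a *\<^sub>R (p' - p)) (- t *\<^sub>R a *\<^sub>R (p' - p)) z)"
      using tilted_pair_wmax[OF P _ _ _ ab _ van] g(1-3) zF FP by (metis subsetD)
    let ?X = "pair_mat (p + t\<^sup>2 *\<^sub>R a *\<^sub>R (p' - p)) (- t *\<^sub>R a *\<^sub>R (p' - p)) z"
    have "u \<bullet> hform 2 ?X (\<lambda>i. of_bool (i = 0)) (\<lambda>i. of_bool (i = 0)) = 0"
    proof (cases u)
      case (Pair c w)
      then have w: "w \<bullet> p = - c" "w \<bullet> p' = - c" using zero by simp_all
      show ?thesis unfolding Pair by (simp add: hform_pair_mat inner_add_right inner_diff_right w)
    qed
    moreover have "v \<bullet> hform 2 ?X (\<lambda>i. if i = 0 then 1 else t) (\<lambda>i. if i = 0 then 1 else t) = 0"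
    proof (cases v)
      case (Pair c w)
      then have w: "w \<bullet> p = - c" "w \<bullet> p'' = - c" using zero by simp_all
      show ?thesis
        unfolding Pair by (simp add: hform_pair_mat ab(3) inner_add_right inner_diff_right w
            power2_eq_square algebra_simps)
    qed
    moreover have "?X 1 1 = z" by (simp add: pair_mat_def)
    ultimately show "\<exists>t>0. \<exists>X. wmax P 2 X \<and> X 1 1 = (1 - e) *\<^sub>R x + e *\<^sub>R y \<and>
      u \<bullet> hform 2 X (\<lambda>i. of_bool (i = 0)) (\<lambda>i. of_bool (i = 0)) = 0 \<and>
      v \<bullet> hform 2 X (\<lambda>i. if i = 0 then 1 else t) (\<lambda>i. if i = 0 then 1 else t) = 0"
      using t unfolding z_def by blast
  qed
qed

section \<open>Separation from a vertex\<close>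

text \<open>All other vertices have positive \<open>l\<close>-value, so a large multiple of
  \<open>l\<close> compensates any affine functional that vanishes at \<open>x\<close>.\<close>

lemma vertex_functional:
  fixes P :: "'a::euclidean_space set"
  assumes P: "polytope P" and x: "x extreme_point_of P"
  obtains l where "l \<in> dual_cone P" "l \<bullet> (1, x) = 0"
    "\<And>b. \<exists>C. C *\<^sub>R l + (- (b \<bullet> x), b) \<in> dual_cone P"
proof -
  obtain l where l: "l \<in> dual_cone P" "\<And>p. p \<in> P \<Longrightarrow> l \<bullet> (1, p) = 0 \<longleftrightarrow> p \<in> {x}"
    using exposing_functional[OF P, of "{x}"] x face_of_singleton by blast
  have xP: "x \<in> P" using x by (simp add: extreme_point_of_def)
  define E where "E = {x. x extreme_point_of P}"
  have E: "finite E" unfolding E_def by (rule finite_polyhedron_extreme_points[OF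
      polytope_imp_polyhedron[OF P]])
  have PE: "P = convex hull E" unfolding E_def
    by (rule Krein_Milman_Minkowski[OF polytope_imp_compact[OF P] polytope_imp_convex[OF P]])
  have EP: "E \<subseteq> P" by (auto simp: E_def extreme_point_of_def)
  have "\<exists>C. C *\<^sub>R l + (- (b \<bullet> x), b) \<in> dual_cone P" for b
  proof -
    \<comment> \<open>The sum dominates each ratio; the term of \<open>x\<close> is 0.\<close>
    define C where "C = (\<Sum>e\<in>E. \<bar>b \<bullet> (e - x)\<bar> / (l \<bullet> (1, e)))"
    define h where "h = C *\<^sub>R l + (- (b \<bullet> x), b)"
    have he: "h \<bullet> (1, q) = C * (l \<bullet> (1, q)) + b \<bullet> (q - x)" for q
      by (simp add: h_def inner_add_left inner_diff_right)
    have lE: "0 \<le> l \<bullet> (1, e)" if "e \<in> E" for e using l(1) that EP by (auto simp: dual_cone_def)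
    have hE: "0 \<le> h \<bullet> (1, e)" if e: "e \<in> E" for e
    proof (cases "e = x")
      case True
      then show ?thesis using l(2)[OF xP] by (simp add: he)
    next
      case False
      then have "0 < l \<bullet> (1, e)" using l(2)[of e] lE[OF e] EP e
          by (metis less_eq_real_def singletonD subsetD)
      moreover have "\<bar>b \<bullet> (e - x)\<bar> / (l \<bullet> (1, e)) \<le> C"
        unfolding C_def using E e lE by (intro member_le_sum) auto
      ultimately have "\<bar>b \<bullet> (e - x)\<bar> \<le> C * (l \<bullet> (1, e))" by (simp add: pos_divide_le_eq)
      then show ?thesis by (simp add: he)
    qed
    have "- fst h \<le> snd h \<bullet> e" if "e \<in> E" for e
      using hE[OF that] by (simp add: inner_prod_def)
    then have "E \<subseteq> {p. - fst h \<le> snd h \<bullet> p}" by blast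
    then have "P \<subseteq> {p. snd h \<bullet> p \<ge> - fst h}"
      unfolding PE by (intro hull_minimal convex_halfspace_ge)
    then have "h \<in> dual_cone P" by (auto simp: dual_cone_def inner_prod_def)
    then show ?thesis unfolding h_def by blast
  qed
  then show ?thesis using that[OF l(1)] l(2)[OF xP] by blast
qed

text \<open>Both \<open>b\<close> and \<open>- b\<close>, shifted to vanish at \<open>x\<close>,
  become nonnegative on \<open>P\<close> by adding a multiple of \<open>l\<close>, which is zero at
  \<open>v\<close>. So \<open>v\<close> is a null vector, hence a kernel vector, of the corrected
  functional.\<close>

lemma vertex_eigenvector:
  fixes P :: "'a::euclidean_space set"
  assumes l: "l \<in> dual_cone P" "\<And>b. \<exists>C. C *\<^sub>R l + (- (b \<bullet> x), b) \<in> dual_cone P"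
    and Y: "wmax P n Y" and v: "l \<bullet> hform n Y v v = 0"
  shows "vform n Y v w = ip n v w *\<^sub>R x"
proof (rule euclidean_eqI)
  fix b :: 'a
  have val: "(C *\<^sub>R l + (- (b \<bullet> x), b)) \<bullet> hform n Y v w
      = C * (l \<bullet> hform n Y v w) + (b \<bullet> vform n Y v w - (b \<bullet> x) * ip n v w)" for C b w
    by (simp add: inner_add_left hform_def)
  obtain C1 where C1: "C1 *\<^sub>R l + (- (b \<bullet> x), b) \<in> dual_cone P" using l(2) by blast
  obtain C2 where C2: "C2 *\<^sub>R l + (- ((- b) \<bullet> x), - b) \<in> dual_cone P" using l(2) by blast
  have 1: "0 \<le> b \<bullet> vform n Y v v - (b \<bullet> x) * ip n v v"
    using wmaxD[OF Y C1, of v] unfolding val v by simp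
  moreover have "0 \<le> (- b) \<bullet> vform n Y v v - ((- b) \<bullet> x) * ip n v v"
    using wmaxD[OF Y C2, of v] unfolding val v by simp
  ultimately have "(C1 *\<^sub>R l + (- (b \<bullet> x), b)) \<bullet> hform n Y v v = 0"
    unfolding val v by (simp add: inner_minus_left)
  then have "(C1 *\<^sub>R l + (- (b \<bullet> x), b)) \<bullet> hform n Y v w = 0" by (rule wmax_kernel[OF Y C1])
  moreover have "l \<bullet> hform n Y v w = 0" by (rule wmax_kernel[OF Y l(1) v])
  ultimately show "vform n Y v w \<bullet> b = (ip n v w *\<^sub>R x) \<bullet> b"
    unfolding val by (simp add: inner_commute mult.commute)
qed

text \<open>For a joint eigenvector \<open>v\<close> the rank one matrix \<open>v v^T\<close>
  commutes with \<open>Y\<close>; by irreducibility it is scalar, which forces size 1.\<close>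

lemma irred_vertex:
  fixes P :: "'a::euclidean_space set"
  assumes l: "l \<in> dual_cone P" "\<And>b. \<exists>C. C *\<^sub>R l + (- (b \<bullet> x), b) \<in> dual_cone P"
    and Y: "wmax P n Y" "irred n Y" and v: "l \<bullet> hform n Y v v = 0" "ip n v v \<noteq> 0"
  shows "n = 1 \<and> Y 0 0 = x"
proof -
  have e: "vform n Y v w = ip n v w *\<^sub>R x" for w by (rule vertex_eigenvector[OF l Y(1) v(1)])
  define Q where "Q i j = v i * v j" for i j
  have Q: "app n Q w = (\<lambda>i. 0 + ip n v w * v i)" for w
    by (rule ext) (simp add: app_def Q_def ip_def sum_distrib_left algebra_simps)
  have z: "vform n Y (\<lambda>_. 0) w = 0" "vform n Y w (\<lambda>_. 0) = 0" for w by (simp_all add: vform_def)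
  have "vform n Y (app n Q u) w = vform n Y u (app n Q w)" for u w
    unfolding Q vform_left vform_right z
    by (simp add: e vform_sym[OF wmax_symm[OF Y(1)], of u v])
  moreover have "symm n Q" by (simp add: symm_def Q_def mult.commute)
  ultimately obtain c where c: "\<forall>i<n. \<forall>j<n. Q i j = c * of_bool (i = j)"
    using Y(2) unfolding irred_def by blast
  obtain i where i: "i < n" "v i \<noteq> 0" using v(2) ip_eq_0_iff[of n v] by blast
  have "j = i" if "j < n" for j
  proof (rule ccontr)
    assume "j \<noteq> i"
    then have "v j * v j = v i * v i" "v i * v j = 0" using c i that by (auto simp: Q_def)
    then show False using i(2) by auto
  qed
  then have n: "n = 1" using i(1) by (metis One_nat_def Suc_lessI gr_zeroI less_Suc_eq_0_disj
      not_less_eq)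
  then have "(v 0 * v 0) *\<^sub>R Y 0 0 = (v 0 * v 0) *\<^sub>R x"
    using e[of v] by (simp add: vform_def ip_def)
  moreover have "v 0 \<noteq> 0" using i n by simp
  ultimately show ?thesis using n by simp
qed

lemma sum_list_filter_zero:
  "(\<And>x. x \<in> set L \<Longrightarrow> \<not> Q x \<Longrightarrow> f x = 0) \<Longrightarrow> sum_list (map f (filter Q L)) = sum_list (map f L)"
  by (induction L) auto

definition nonvertex :: "'a::euclidean_space set \<Rightarrow> 'a \<Rightarrow> nat \<Rightarrow> (nat \<Rightarrow> nat \<Rightarrow> 'a) \<Rightarrow> bool" where
  "nonvertex P x k Y \<longleftrightarrow> arveson P k Y \<and> irred k Y \<and> \<not> (k = 1 \<and> Y 0 0 = x)"

lemma near_vertex_assembled: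
  fixes P F :: "'a::euclidean_space set"
  assumes P: "polytope P" and F: "F face_of P" "aff_dim F = 2" "\<not> (\<exists>n. n simplex F)"
    and x: "x extreme_point_of F"
  obtains y where "\<And>e. 0 < e \<Longrightarrow> e \<le> 1 \<Longrightarrow>
      assembled (nonvertex P x) 1 (\<lambda>_ _. (1 - e) *\<^sub>R x + e *\<^sub>R y)"
proof -
  have ne: "P \<noteq> {}" using x face_of_imp_subset[OF F(1)] by (auto simp: extreme_point_of_def)
  obtain u v y where uv: "u \<in> dual_cone P" "v \<in> dual_cone P" "0 < u \<bullet> (1, x)" "0 < v \<bullet> (1, x)"
    "\<And>e. 0 < e \<Longrightarrow> e \<le> 1 \<Longrightarrow> \<exists>t>0. \<exists>X. wmax P 2 X \<and> X 1 1 = (1 - e) *\<^sub>R x + e *\<^sub>R y \<and>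
      u \<bullet> hform 2 X (\<lambda>i. of_bool (i = 0)) (\<lambda>i. of_bool (i = 0)) = 0 \<and>
      v \<bullet> hform 2 X (\<lambda>i. if i = 0 then 1 else t) (\<lambda>i. if i = 0 then 1 else t) = 0"
    by (rule tilted_dilation[OF P F x]) blast
  show ?thesis
  proof (rule that)
    fix e :: real assume "0 < e" "e \<le> 1"
    then obtain t X where t: "t > 0" and X: "wmax P 2 X" "X 1 1 = (1 - e) *\<^sub>R x + e *\<^sub>R y"
      "u \<bullet> hform 2 X (\<lambda>i. of_bool (i = 0)) (\<lambda>i. of_bool (i = 0)) = 0"
      "v \<bullet> hform 2 X (\<lambda>i. if i = 0 then 1 else t) (\<lambda>i. if i = 0 then 1 else t) = 0"
      using uv(5) by blast
    have "assembled (\<lambda>k Y. arveson P k Y \<and> irred k Y) 2 X"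
      by (rule wmax_assembled[OF P ne X(1)]) simp
    then obtain L where L: "\<forall>(k, Y, V)\<in>set L. 0 < k \<and> arveson P k Y \<and> irred k Y"
      "\<And>v w. hform 2 X v w = (\<Sum>(k, Y, V)\<leftarrow>L. hform k Y (app 2 V v) (app 2 V w))"
      unfolding assembled_def by blast
    \<comment> \<open>All terms are nonnegative, so a null vector of the whole form is one of each
      term.\<close>
    have zero: "h \<bullet> hform k Y (app 2 V a) (app 2 V a) = 0"
      if "h \<in> dual_cone P" "h \<bullet> hform 2 X a a = 0" "(k, Y, V) \<in> set L" for h a k Y V
    proof -
      let ?f = "\<lambda>(k, Y, V). h \<bullet> hform k Y (app 2 V a) (app 2 V a)"
      have nn: "0 \<le> ?f T" if "T \<in> set L" for T
        using L(1) that \<open>h \<in> dual_cone P\<close> by (auto simp: arveson_def intro: wmaxD)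
      have ih: "h \<bullet> sum_list (map f M) = sum_list (map (\<lambda>T. h \<bullet> f T) M)" for f :: "_ \<Rightarrow> real \<times> 'a"
          and M :: "(nat \<times> (nat \<Rightarrow> nat \<Rightarrow> 'a) \<times> (nat \<Rightarrow> nat \<Rightarrow> real)) list"
        by (induction M) (simp_all add: inner_add_right)
      have "sum_list (map ?f L) = 0"
        using that(2) unfolding L(2) ih by (simp add: case_prod_unfold)
      then have "\<forall>y\<in>set (map ?f L). y = 0"
        using nn by (subst (asm) sum_list_nonneg_eq_0_iff) auto
      then show ?thesis using that(3) by force
    qed
    have vanish: "hform k Y (app 2 V a) (app 2 V b) = 0"
      if T: "(k, Y, V) \<in> set L" and kx: "k = 1" "Y 0 0 = x" for k Y V a b
    proof -
      have h1: "h \<bullet> hform 1 Y c c = (c 0)\<^sup>2 * (h \<bullet> (1, x))" for h c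
        using kx by (cases h) (simp add: hform_as_sum power2_eq_square algebra_simps)
      have "(app 2 V (\<lambda>i. of_bool (i = 0)) 0)\<^sup>2 * (u \<bullet> (1, x)) = 0"
        using zero[OF uv(1) X(3) T] h1[of u] kx by simp
      then have V0: "V 0 0 = 0" using uv(3) by (simp add: app_def numeral_2_eq_2)
      have "(app 2 V (\<lambda>i. if i = 0 then 1 else t) 0)\<^sup>2 * (v \<bullet> (1, x)) = 0"
        using zero[OF uv(2) X(4) T] h1[of v] kx by simp
      then have "V 0 1 = 0" using uv(4) V0 t by (simp add: app_def numeral_2_eq_2)
      then have "app 2 V a 0 = 0" "app 2 V b 0 = 0" for a b using V0
          by (simp_all add: app_def numeral_2_eq_2)
      then show ?thesis using kx by (simp add: hform_as_sum zero_prod_def)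
    qed
    define M where "M = filter (\<lambda>(k, Y, V). \<not> (k = 1 \<and> Y 0 0 = x)) L"
    have "assembled (nonvertex P x) 2 X"
      unfolding assembled_def
    proof (intro exI[of _ M] conjI allI)
      show "\<forall>(k, Y, V)\<in>set M. 0 < k \<and> nonvertex P x k Y"
        using L(1) by (auto simp: M_def nonvertex_def)
      show "hform 2 X a b = (\<Sum>(k, Y, V)\<leftarrow>M. hform k Y (app 2 V a) (app 2 V b))" for a b
        unfolding L(2) M_def by (rule sum_list_filter_zero[symmetric]) (auto intro: vanish)
    qed
    then show "assembled (nonvertex P x) 1 (\<lambda>_ _. (1 - e) *\<^sub>R x + e *\<^sub>R y)"
    proof (rule assembled_compress[where V = "\<lambda>i j. of_bool (i = 1)"])
      show "hform 1 (\<lambda>_ _. (1 - e) *\<^sub>R x + e *\<^sub>R y) a b =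
        hform 2 X (app 1 (\<lambda>i j. of_bool (i = 1)) a) (app 1 (\<lambda>i j. of_bool (i = 1)) b)" for a b
        using X(2) by (simp add: hform_as_sum app_def numeral_2_eq_2)
    qed
  qed
qed

section \<open>Tuples of matrices\<close>

definition entries :: "'g::finite mtuple \<Rightarrow> nat \<Rightarrow> nat \<Rightarrow> real ^ 'g" where
  "entries X = (\<lambda>i j. \<chi> k. X k $$ (i, j))"

definition tuple :: "nat \<Rightarrow> (nat \<Rightarrow> nat \<Rightarrow> real ^ 'g) \<Rightarrow> 'g::finite mtuple" where
  "tuple n Y = (\<lambda>k. Matrix.mat n n (\<lambda>(i, j). Y i j $ k))"

definition mfun :: "real Matrix.mat \<Rightarrow> nat \<Rightarrow> nat \<Rightarrow> real" where
  "mfun M = (\<lambda>i j. M $$ (i, j))"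

lemma SMn_dim [simp]: "X \<in> SMn n \<Longrightarrow> dim_row (X k) = n" "X \<in> SMn n \<Longrightarrow> dim_col (X k) = n"
  by (auto simp: SMn_def)

lemma SMn_unique: "X \<in> SMn n \<Longrightarrow> X \<in> SMn m \<Longrightarrow> n = m"
  by (metis SMn_dim(1))

lemma SMn_sym: "X \<in> SMn n \<Longrightarrow> i < n \<Longrightarrow> j < n \<Longrightarrow> X k $$ (i, j) = X k $$ (j, i)"
  using index_transpose_mat(1)[of j "X k" i] SMn_dim[of X n k] unfolding SMn_def by simp

lemma symm_entries: "X \<in> SMn n \<Longrightarrow> symm n (entries X)"
  by (auto simp: symm_def entries_def Finite_Cartesian_Product.vec_eq_iff SMn_sym)

lemma entries_tuple [simp]: "i < n \<Longrightarrow> j < n \<Longrightarrow> entries (tuple n Y) i j = Y i j"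
  by (simp add: entries_def tuple_def Finite_Cartesian_Product.vec_eq_iff)

lemma tuple_entries: "X \<in> SMn n \<Longrightarrow> tuple n (entries X) = X"
  by (rule ext, rule eq_matI) (auto simp: entries_def tuple_def)

lemma tuple_SMn: "symm n Y \<Longrightarrow> tuple n Y \<in> SMn n"
  by (auto simp: SMn_def tuple_def symm_def intro!: eq_matI)

lemma hform_entries_tuple: "hform n (entries (tuple n Y)) v w = hform n Y v w"
  by (rule hform_cong) simp_all

section \<open>Semidefiniteness and matrix convex combinations in coordinates\<close>

lemma mat_quadratic_form:
  fixes M :: "real Matrix.mat"
  assumes "M \<in> carrier_mat n n" "v \<in> carrier_vec n"
  shows "Matrix.scalar_prod v (M *\<^sub>v v)
    = (\<Sum>i<n. \<Sum>j<n. vec_index v i * vec_index v j * M $$ (i, j))"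
  using assms by (auto simp: Matrix.scalar_prod_def mult_mat_vec_def lessThan_atLeast0
      sum_distrib_left mult_ac intro!: sum.cong)

lemma psd_iff:
  assumes "M \<in> carrier_mat n n"
  shows "psd M \<longleftrightarrow> (\<forall>i<n. \<forall>j<n. M $$ (i, j) = M $$ (j, i)) \<and>
    (\<forall>v::nat \<Rightarrow> real. 0 \<le> (\<Sum>i<n. \<Sum>j<n. v i * v j * M $$ (i, j)))"
proof -
  have sym: "transpose_mat M = M \<longleftrightarrow> (\<forall>i<n. \<forall>j<n. M $$ (i, j) = M $$ (j, i))"
  proof
    assume "transpose_mat M = M"
    then show "\<forall>i<n. \<forall>j<n. M $$ (i, j) = M $$ (j, i)"
      using assms by (metis carrier_matD index_transpose_mat(1))
  qed (use assms in \<open>auto intro!: eq_matI\<close>)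
  have "(\<forall>v\<in>carrier_vec n. 0 \<le> Matrix.scalar_prod v (M *\<^sub>v v)) \<longleftrightarrow>
    (\<forall>v::nat \<Rightarrow> real. 0 \<le> (\<Sum>i<n. \<Sum>j<n. v i * v j * M $$ (i, j)))" (is "?L \<longleftrightarrow> ?R")
  proof
    assume L: ?L
    show ?R
    proof
      fix v :: "nat \<Rightarrow> real"
      have "0 \<le> Matrix.scalar_prod (Matrix.vec n v) (M *\<^sub>v Matrix.vec n v)" using L by simp
      then show "0 \<le> (\<Sum>i<n. \<Sum>j<n. v i * v j * M $$ (i, j))"
        by (simp add: mat_quadratic_form[OF assms])
    qed
  qed (simp add: mat_quadratic_form[OF assms])
  then show ?thesis using assms sym by (auto simp: psd_def)
qed

lemma inner_hform_entries:
  "(a0, a) \<bullet> hform n (entries X) v w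
    = (\<Sum>i<n. \<Sum>j<n. v i * w j * (a0 * of_bool (i = j) + (\<Sum>k\<in>UNIV. a $ k * X k $$ (i, j))))"
proof -
  have "(a0, a) \<bullet> hform n (entries X) v w
      = (\<Sum>i<n. \<Sum>j<n. (v i * w j) * ((a0, a) \<bullet> (of_bool (i = j), entries X i j)))"
    unfolding hform_as_sum inner_sum_right inner_scaleR_right ..
  then show ?thesis by (simp add: entries_def inner_vec_def)
qed

lemma Wmax_iff:
  assumes X: "X \<in> SMn n" and n: "n \<ge> 1"
  shows "X \<in> Wmax P \<longleftrightarrow> wmax P n (entries X)"
proof -
  have cone: "(\<forall>x\<in>P. 0 \<le> a0 + (\<Sum>k\<in>UNIV. a $ k * x $ k)) \<longleftrightarrow> (a0, a) \<in> dual_cone P" for a0 a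
    by (simp add: dual_cone_def inner_vec_def)
  have p: "psd (a0 \<cdot>\<^sub>m 1\<^sub>m n + msum n n (\<lambda>k. a $ k \<cdot>\<^sub>m X k) UNIV)
      \<longleftrightarrow> (\<forall>v. 0 \<le> (a0, a) \<bullet> hform n (entries X) v v)" (is "psd ?M \<longleftrightarrow> _") for a0 a
  proof -
    have M: "?M \<in> carrier_mat n n" by (simp add: msum_def)
    have e: "?M $$ (i, j) = a0 * of_bool (i = j) + (\<Sum>k\<in>UNIV. a $ k * X k $$ (i, j))"
      if "i < n" "j < n" for i j
      using that X by (simp add: msum_def)
    have s: "\<forall>i<n. \<forall>j<n. ?M $$ (i, j) = ?M $$ (j, i)"
      by (auto simp: e SMn_sym[OF X])
    have "(\<Sum>i<n. \<Sum>j<n. v i * v j * ?M $$ (i, j)) = (a0, a) \<bullet> hform n (entries X) v v" for v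
      unfolding inner_hform_entries by (intro sum.cong refl) (simp add: e)
    then show ?thesis unfolding psd_iff[OF M] using s by simp
  qed
  have "X \<in> Wmax P \<longleftrightarrow> (\<forall>a0 a. (a0, a) \<in> dual_cone P \<longrightarrow> (\<forall>v. 0 \<le> (a0, a) \<bullet> hform n (entries X) v v))"
    unfolding Wmax_def mem_Collect_eq cone
  proof
    assume "\<exists>n'\<ge>1. X \<in> SMn n' \<and> (\<forall>a0 a. (a0, a) \<in> dual_cone P \<longrightarrow>
      psd (a0 \<cdot>\<^sub>m 1\<^sub>m n' + msum n' n' (\<lambda>k. a $ k \<cdot>\<^sub>m X k) UNIV))"
    then show "\<forall>a0 a. (a0, a) \<in> dual_cone P \<longrightarrow> (\<forall>v. 0 \<le> (a0, a) \<bullet> hform n (entries X) v v)"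
      using SMn_unique[OF X] p by blast
  next
    assume "\<forall>a0 a. (a0, a) \<in> dual_cone P \<longrightarrow> (\<forall>v. 0 \<le> (a0, a) \<bullet> hform n (entries X) v v)"
    then show "\<exists>n'\<ge>1. X \<in> SMn n' \<and> (\<forall>a0 a. (a0, a) \<in> dual_cone P \<longrightarrow>
      psd (a0 \<cdot>\<^sub>m 1\<^sub>m n' + msum n' n' (\<lambda>k. a $ k \<cdot>\<^sub>m X k) UNIV))"
      using X n p by blast
  qed
  then show ?thesis using symm_entries[OF X] by (auto simp: wmax_def)
qed

lemma tuple_Wmax: "wmax P n Y \<Longrightarrow> n \<ge> 1 \<Longrightarrow> tuple n Y \<in> Wmax P"
  using Wmax_iff[OF tuple_SMn[OF wmax_symm], of P n Y]
  by (simp add: wmax_def symm_def hform_entries_tuple)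

lemma app_unitv: "j < n \<Longrightarrow> app n V (unitv j) = (\<lambda>i. V i j)"
  by (simp add: app_def)

text \<open>One value records both the weight \<open>V^T V\<close> and the congruence of
  \<open>Y\<close>, so that the two conditions on a matrix convex combination become a single
  identity of forms.\<close>

lemma hform_congruence_entries:
  assumes "i < n" "j < n" "V \<in> carrier_mat N n" "Y \<in> SMn N"
  shows "hform N (entries Y) (app n (mfun V) (unitv i)) (app n (mfun V) (unitv j))
    = ((transpose_mat V * V) $$ (i, j), \<chi> k. (transpose_mat V * Y k * V) $$ (i, j))"
proof -
  have "(transpose_mat V * Y k * V) $$ (i, j) = (\<Sum>a<N. \<Sum>b<N. V $$ (a, i) * Y k $$ (a, b) * V $$
      (b, j))" for k
  proof -
    have "(transpose_mat V * Y k * V) $$ (i, j) = (\<Sum>b<N. (\<Sum>a<N. V $$ (a, i) * Y k $$ (a, b)) * V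
        $$ (b, j))"
      using assms by (simp add: Matrix.scalar_prod_def lessThan_atLeast0)
    then show ?thesis by (simp add: sum_distrib_right, subst sum.swap) simp
  qed
  moreover have "(transpose_mat V * V) $$ (i, j) = (\<Sum>a<N. V $$ (a, i) * V $$ (a, j))"
    using assms by (simp add: Matrix.scalar_prod_def lessThan_atLeast0)
  ultimately show ?thesis
    using assms(1,2)
    by (simp add: hform_def ip_def vform_def app_unitv mfun_def entries_def
        Finite_Cartesian_Product.vec_eq_iff sum_component mult_ac)
qed

lemma hform_sum_eqI:
  assumes "\<And>i j. i < n \<Longrightarrow> j < n \<Longrightarrow> hform n X (unitv i) (unitv j)
    = (\<Sum>l<m. hform (N l) (Y l) (app n (V l) (unitv i)) (app n (V l) (unitv j)))"
  shows "hform n X v w = (\<Sum>l<m. hform (N l) (Y l) (app n (V l) v) (app n (V l) w))"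
proof -
  have u: "app n (V l) v = (\<lambda>i. \<Sum>k<n. v k * app n (V l) (unitv k) i)" for l v
    by (rule ext) (simp add: app_unitv app_def mult.commute)
  have "hform n X v w = hform n X (\<lambda>i. \<Sum>k<n. v k * unitv k i) (\<lambda>i. \<Sum>k<n. w k * unitv k i)"
    by (rule hform_cong) (simp_all add: vec_expand)
  also have "\<dots> = (\<Sum>i<n. \<Sum>j<n. v i *\<^sub>R w j *\<^sub>R hform n X (unitv i) (unitv j))"
    unfolding hform_sum hform_sum_right scaleR_sum_right ..
  also have "\<dots> = (\<Sum>i<n. \<Sum>j<n. v i *\<^sub>R w j *\<^sub>R
      (\<Sum>l<m. hform (N l) (Y l) (app n (V l) (unitv i)) (app n (V l) (unitv j))))"
    by (intro sum.cong refl) (simp add: assms)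
  also have "\<dots> = (\<Sum>l<m. \<Sum>i<n. \<Sum>j<n. v i *\<^sub>R w j *\<^sub>R
      hform (N l) (Y l) (app n (V l) (unitv i)) (app n (V l) (unitv j)))"
    unfolding scaleR_sum_right by (subst (2) sum.swap, subst sum.swap) simp
  also have "\<dots> = (\<Sum>l<m. hform (N l) (Y l) (app n (V l) v) (app n (V l) w))"
    unfolding u[of _ v] u[of _ w] hform_sum hform_sum_right scaleR_sum_right ..
  finally show ?thesis .
qed

lemma mat_convex_comb_hform:
  assumes "mat_convex_comb K n m N V Y X"
  shows "hform n (entries X) v w
    = (\<Sum>l<m. hform (N l) (entries (Y l)) (app n (mfun (V l)) v) (app n (mfun (V l)) w))"
proof (rule hform_sum_eqI)
  fix i j assume ij: "i < n" "j < n"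
  have c: "\<And>l. l < m \<Longrightarrow> V l \<in> carrier_mat (N l) n \<and> Y l \<in> SMn (N l)"
    and I: "msum n n (\<lambda>l. transpose_mat (V l) * V l) {..<m} = 1\<^sub>m n"
    and X: "X = (\<lambda>k. msum n n (\<lambda>l. transpose_mat (V l) * Y l k * V l) {..<m})"
    using assms by (auto simp: mat_convex_comb_def level_def)
  have "hform n (entries X) (unitv i) (unitv j) = (1\<^sub>m n $$ (i, j), entries X i j)"
    using ij by (simp add: hform_unitv)
  also have "\<dots> = (\<Sum>l<m. ((transpose_mat (V l) * V l) $$ (i, j),
      \<chi> k. (transpose_mat (V l) * Y l k * V l) $$ (i, j)))"
    unfolding I[symmetric] X using ij
    by (intro prod_eqI) (simp_all add: entries_def msum_def fst_sum snd_sum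
        Finite_Cartesian_Product.vec_eq_iff sum_component)
  also have "\<dots> = (\<Sum>l<m. hform (N l) (entries (Y l)) (app n (mfun (V l)) (unitv i)) (app n (mfun (V
      l)) (unitv j)))"
    using c ij by (intro sum.cong refl hform_congruence_entries[symmetric]) auto
  finally show "hform n (entries X) (unitv i) (unitv j) = \<dots>" .
qed

lemma mat_convex_combI:
  assumes "\<And>l. l < m \<Longrightarrow> 1 \<le> N l \<and> Y l \<in> level K (N l) \<and> V l \<in> carrier_mat (N l) n"
    and X: "X \<in> SMn n"
    and h: "\<And>v w. hform n (entries X) v w
      = (\<Sum>l<m. hform (N l) (entries (Y l)) (app n (mfun (V l)) v) (app n (mfun (V l)) w))"
  shows "mat_convex_comb K n m N V Y X"
proof -
  have e: "(of_bool (i = j), entries X i j) = (\<Sum>l<m. ((transpose_mat (V l) * V l) $$ (i, j),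
      \<chi> k. (transpose_mat (V l) * Y l k * V l) $$ (i, j)))" if ij: "i < n" "j < n" for i j
  proof -
    have "(of_bool (i = j), entries X i j) = hform n (entries X) (unitv i) (unitv j)"
      using ij by (simp add: hform_unitv)
    also have "\<dots> = (\<Sum>l<m. ((transpose_mat (V l) * V l) $$ (i, j),
      \<chi> k. (transpose_mat (V l) * Y l k * V l) $$ (i, j)))"
      unfolding h using assms(1) ij
      by (intro sum.cong refl hform_congruence_entries) (auto simp: level_def)
    finally show ?thesis .
  qed
  have 1: "(\<Sum>l<m. (transpose_mat (V l) * V l) $$ (i, j)) = of_bool (i = j)"
    if "i < n" "j < n" for i j
    using arg_cong[OF e[OF that], of fst] by (simp add: fst_sum)
  have 2: "(\<Sum>l<m. (transpose_mat (V l) * Y l k * V l) $$ (i, j)) = X k $$ (i, j)"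
    if "i < n" "j < n" for i j k
    using arg_cong[OF e[OF that], of "\<lambda>p. snd p $ k"] by (simp add: snd_sum sum_component entries_def)
  have "msum n n (\<lambda>l. transpose_mat (V l) * V l) {..<m} = 1\<^sub>m n"
    by (rule eq_matI) (auto simp: msum_def 1)
  moreover have "X = (\<lambda>k. msum n n (\<lambda>l. transpose_mat (V l) * Y l k * V l) {..<m})"
    using X by (intro ext eq_matI) (auto simp: msum_def 2)
  ultimately show ?thesis unfolding mat_convex_comb_def using assms(1) by blast
qed

lemma assembled_co_mat:
  assumes "assembled K n X" "symm n X" "n \<ge> 1"
    and K: "\<And>k Y. K k Y \<Longrightarrow> 0 < k \<Longrightarrow> symm k Y \<and> tuple k Y \<in> S"
  shows "tuple n X \<in> co_mat S"
proof -
  obtain L where L: "\<forall>(k, Y, V)\<in>set L. 0 < k \<and> K k Y"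
    "\<And>v w. hform n X v w = (\<Sum>(k, Y, V)\<leftarrow>L. hform k Y (app n V v) (app n V w))"
    using assms(1) unfolding assembled_def by blast
  let ?m = "length L"
  define N where "N l = fst (L ! l)" for l
  define Z where "Z l = fst (snd (L ! l))" for l
  define W where "W l = snd (snd (L ! l))" for l
  have LZ: "0 < N l \<and> K (N l) (Z l)" if "l < ?m" for l
    using bspec[OF L(1) nth_mem[OF that]] by (simp add: N_def Z_def case_prod_unfold)
  have W: "app n (mfun (Matrix.mat (N l) n (\<lambda>(i, j). W l i j))) v i = app n (W l) v i"
    if "i < N l" for l v i
    using that by (simp add: app_def mfun_def)
  have "mat_convex_comb S n ?m N (\<lambda>l. Matrix.mat (N l) n (\<lambda>(i, j). W l i j)) (\<lambda>l. tuple (N l) (Z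
      l)) (tuple n X)"
  proof (rule mat_convex_combI)
    show "1 \<le> N l \<and> tuple (N l) (Z l) \<in> level S (N l)
        \<and> Matrix.mat (N l) n (\<lambda>(i, j). W l i j) \<in> carrier_mat (N l) n"
      if "l < ?m" for l
      using LZ[OF that] K by (auto simp: level_def tuple_SMn)
    show "tuple n X \<in> SMn n" by (rule tuple_SMn[OF assms(2)])
    show "hform n (entries (tuple n X)) v w = (\<Sum>l<?m. hform (N l) (entries (tuple (N l) (Z l)))
        (app n (mfun (Matrix.mat (N l) n (\<lambda>(i, j). W l i j))) v)
        (app n (mfun (Matrix.mat (N l) n (\<lambda>(i, j). W l i j))) w))" for v w
    proof -
      have "hform n X v w = (\<Sum>l<?m. hform (N l) (Z l) (app n (W l) v) (app n (W l) w))"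
        unfolding L(2) sum_list_sum_nth N_def Z_def W_def
        by (simp add: case_prod_unfold lessThan_atLeast0)
      also have "\<dots> = (\<Sum>l<?m. hform (N l) (Z l)
        (app n (mfun (Matrix.mat (N l) n (\<lambda>(i, j). W l i j))) v)
        (app n (mfun (Matrix.mat (N l) n (\<lambda>(i, j). W l i j))) w))"
        by (intro sum.cong refl hform_cong) (simp_all add: W)
      finally show ?thesis by (simp only: hform_entries_tuple)
    qed
  qed
  then show ?thesis unfolding co_mat_def using assms(3) by blast
qed

section \<open>Free extreme points of the maximal matrix convex set\<close>

lemma orthonormal_full:
  assumes "orthonormal n g n" "i < n"
  shows "v i = proj n g n v i"
proof -
  obtain g' where "\<And>j. j < n \<Longrightarrow> g' j = g j" "\<And>v i. i < n \<Longrightarrow> v i = proj n g' n v i"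
    by (rule orthonormal_complete[OF assms(1)]) blast
  then show ?thesis using assms(2) by (simp add: proj_def)
qed

lemma unitarily_equiv_basis:
  assumes Y: "Y \<in> SMn k" and k: "k \<ge> 1" and g: "orthonormal k g k"
  shows "(tuple k (\<lambda>i j. vform k (entries Y) (g i) (g j)), Y) \<in> unitarily_equiv"
proof -
  define X where "X i j = vform k (entries Y) (g i) (g j)" for i j
  \<comment> \<open>The basis vectors are the rows, because \<open>unitarily_equiv\<close> reads
    \<open>U^T X U = Y\<close>.\<close>
  define U where "U = Matrix.mat k k (\<lambda>(i, a). g i a)"
  have U: "U \<in> carrier_mat k k" by (simp add: U_def)
  have X: "tuple k X \<in> SMn k"
    by (rule tuple_SMn) (simp add: symm_def X_def vform_sym[OF symm_entries[OF Y]])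
  have app: "app k (mfun U) (unitv a) i = app k g (unitv a) i" if "i < k" "a < k" for i a
    using that by (simp add: app_unitv mfun_def U_def)
  have e: "(of_bool (a = b), entries Y a b)
      = ((transpose_mat U * U) $$ (a, b), \<chi> l. (transpose_mat U * tuple k X l * U) $$ (a, b))"
    if ab: "a < k" "b < k" for a b
  proof -
    have "(of_bool (a = b), entries Y a b) = hform k (entries Y) (unitv a) (unitv b)"
      using ab by (simp add: hform_unitv)
    also have "\<dots> = hform k X (app k g (unitv a)) (app k g (unitv b))"
      unfolding X_def[abs_def] by (rule hform_change_basis[OF g orthonormal_full[OF g]])
    also have "\<dots> = hform k (entries (tuple k X)) (app k (mfun U) (unitv a)) (app k (mfun U) (unitv b))"
      by (rule hform_cong) (simp_all add: app ab)
    also have "\<dots> = ((transpose_mat U * U) $$ (a, b), \<chi> l. (transpose_mat U * tuple k X l * U) $$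
        (a, b))"
      by (rule hform_congruence_entries[OF ab U X])
    finally show ?thesis .
  qed
  have e1: "(transpose_mat U * U) $$ (a, b) = of_bool (a = b)" if "a < k" "b < k" for a b
    using arg_cong[OF e[OF that], of fst] by (simp only: fst_conv)
  have e2: "(transpose_mat U * tuple k X l * U) $$ (a, b) = Y l $$ (a, b)" if "a < k" "b < k" for a b l
  proof -
    have "entries Y a b = (\<chi> l. (transpose_mat U * tuple k X l * U) $$ (a, b))"
      using arg_cong[OF e[OF that], of snd] by (simp only: snd_conv)
    from arg_cong[OF this, of "\<lambda>v. v $ l"] show ?thesis by (simp only: entries_def vec_lambda_beta)
  qed
  have "transpose_mat U * U = 1\<^sub>m k"
  proof (rule eq_matI)
    show "(transpose_mat U * U) $$ (a, b) = 1\<^sub>m k $$ (a, b)"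
      if "a < dim_row (1\<^sub>m k :: real Matrix.mat)" "b < dim_col (1\<^sub>m k :: real Matrix.mat)" for a b
    proof -
      have ab: "a < k" "b < k" using that by simp_all
      show ?thesis unfolding e1[OF ab] using ab by simp
    qed
  qed (simp_all add: U_def)
  moreover have "U * transpose_mat U = 1\<^sub>m k"
  proof (rule eq_matI)
    show "(U * transpose_mat U) $$ (a, b) = 1\<^sub>m k $$ (a, b)"
      if "a < dim_row (1\<^sub>m k :: real Matrix.mat)" "b < dim_col (1\<^sub>m k :: real Matrix.mat)" for a b
    proof -
      have "(U * transpose_mat U) $$ (a, b) = ip k (g a) (g b)"
        using that by (simp add: U_def Matrix.scalar_prod_def ip_def lessThan_atLeast0)
      then show ?thesis using g that by (auto simp: orthonormal_def)
    qed
  qed (simp_all add: U_def)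
  moreover have "transpose_mat U * tuple k X l * U = Y l" for l
  proof (rule eq_matI)
    show "(transpose_mat U * tuple k X l * U) $$ (a, b) = Y l $$ (a, b)"
      if "a < dim_row (Y l)" "b < dim_col (Y l)" for a b
      using e2[of a b l] that SMn_dim[OF Y] by simp
  qed (use Y in \<open>simp_all add: U_def\<close>)
  ultimately have "(tuple k X, Y) \<in> unitarily_equiv"
    unfolding unitarily_equiv_def using X Y U k
    by (intro CollectI case_prodI exI[of _ k] conjI bexI[of _ U] allI)
  then show ?thesis by (simp only: X_def[abs_def])
qed

lemma unitarily_equiv_refl:
  fixes X :: "'g::finite mtuple"
  assumes "X \<in> SMn n" "n \<ge> 1"
  shows "(X, X) \<in> unitarily_equiv"
proof -
  have o: "orthonormal n unitv n" by (auto simp: orthonormal_def) (simp_all add: unitv_def)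
  have "tuple n (\<lambda>i j. vform n (entries X) (unitv i) (unitv j)) = tuple n (entries X)"
    by (rule ext, rule eq_matI) (auto simp: tuple_def vform_row sum_unitv)
  then show ?thesis
    using unitarily_equiv_basis[OF assms o] tuple_entries[OF assms(1)] by simp
qed

lemma unitarily_equiv_form:
  fixes X Y :: "'g::finite mtuple"
  assumes "(X, Y) \<in> unitarily_equiv" "X \<in> SMn n"
  obtains U where "Y \<in> SMn n" "\<And>v w. hform n (entries Y) v w
      = hform n (entries X) (app n U v) (app n U w)"
proof -
  obtain m U where U: "X \<in> SMn m" "Y \<in> SMn m" "U \<in> carrier_mat m m" "transpose_mat U * U = 1\<^sub>m m"
    "\<forall>k. transpose_mat U * X k * U = Y k"
    using assms(1) unfolding unitarily_equiv_def by blast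
  have m: "m = n" using SMn_unique[OF assms(2) U(1)] by simp
  note U = U[unfolded m]
  have "hform n (entries Y) v w = (\<Sum>l<Suc 0. hform n (entries X) (app n (mfun U) v) (app n (mfun
      U) w))" for v w
  proof (rule hform_sum_eqI)
    fix i j assume ij: "i < n" "j < n"
    have "hform n (entries X) (app n (mfun U) (unitv i)) (app n (mfun U) (unitv j))
      = ((transpose_mat U * U) $$ (i, j), \<chi> k. (transpose_mat U * X k * U) $$ (i, j))"
      by (rule hform_congruence_entries[OF ij U(3,1)])
    also have "\<dots> = hform n (entries Y) (unitv i) (unitv j)"
      using ij U(4,5) by (simp add: hform_unitv entries_def)
    finally show "hform n (entries Y) (unitv i) (unitv j)
      = (\<Sum>l<Suc 0. hform n (entries X) (app n (mfun U) (unitv i)) (app n (mfun U) (unitv j)))" by simp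
  qed
  then show ?thesis using that[OF U(2), of "mfun U"] by simp
qed

text \<open>Each coefficient is a positive multiple of an isometry. In an orthonormal basis that
  begins with its normalised columns, intertwining gives \<open>Y l\<close> the corner
  \<open>X\<close> with zeros beside it; the remaining block, if any, is the required
  \<open>Z\<close>.\<close>

lemma irred_arveson_free_extreme:
  fixes X :: "nat \<Rightarrow> nat \<Rightarrow> real ^ 'g::finite"
  assumes X: "arveson P n X" "irred n X" and n: "n \<ge> 1"
  shows "tuple n X \<in> free_extreme (Wmax P)"
proof -
  have wX: "wmax P n X" using X(1) by (simp add: arveson_def)
  note sX = wmax_symm[OF wX]
  have "(N l = n \<and> (tuple n X, Y l) \<in> unitarily_equiv) \<or>
      (N l > n \<and> (\<exists>Z\<in>Wmax P. (direct_sum (tuple n X) Z, Y l) \<in> unitarily_equiv))"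
    if comb: "mat_convex_comb (Wmax P) n m N V Y (tuple n X)" and V0: "\<forall>l<m. V l \<noteq> 0\<^sub>m (N l) n"
        and l: "l < m"
    for m N V Y l
  proof -
    define k where "k = N l"
    define W where "W = mfun (V l)"
    define Z where "Z = entries (Y l)"
    have c: "1 \<le> N l' \<and> Y l' \<in> SMn (N l') \<and> Y l' \<in> Wmax P \<and> V l' \<in> carrier_mat (N l') n"
        if "l' < m" for l'
      using comb that by (auto simp: mat_convex_comb_def level_def)
    have wY: "wmax P (N l') (entries (Y l'))" if "l' < m" for l'
      using c[OF that] Wmax_iff by blast
    have k: "k \<ge> 1" "Y l \<in> SMn k" "V l \<in> carrier_mat k n" and wZ: "wmax P k Z"
      using c[OF l] wY[OF l] by (auto simp: k_def Z_def)
    have sZ: "symm k Z" by (rule wmax_symm[OF wZ])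
    have id: "hform n X v w = (\<Sum>l<m. hform (N l) (entries (Y l)) (app n (mfun (V l)) v) (app n
        (mfun (V l)) w))" for v w
      using mat_convex_comb_hform[OF comb, of v w] by (simp only: hform_entries_tuple)
    have le: "h \<bullet> hform k Z (app n W v) (app n W v) \<le> h \<bullet> hform n X v v" if h: "h \<in> dual_cone P" for h v
      unfolding id inner_sum_right k_def Z_def W_def
      by (rule member_le_sum[where f = "\<lambda>l. h \<bullet> hform (N l) (entries (Y l)) (app n (mfun (V l)) v)
          (app n (mfun (V l)) v)"])
         (use l wmaxD[OF wY h] in auto)
    have "\<exists>q. \<forall>v w. ip k (app n W v) (app n W w) = q * ip n v w"
      by (rule irred_arveson_isometry[where V = W, OF X wZ], rule le, assumption, blast)
    then obtain q where q: "\<And>v w. ip k (app n W v) (app n W w) = q * ip n v w" by blast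
    have twine: "vform k Z u (app n W v) = vform n X (tapp k W u) v" for u v
      by (rule intertwining[OF X(1) wZ le])
    \<comment> \<open>With factor 0 the whole coefficient would vanish.\<close>
    have "q > 0"
    proof -
      have "\<exists>a<k. \<exists>j<n. W a j \<noteq> 0"
      proof (rule ccontr)
        assume "\<not> ?thesis"
        then have "V l = 0\<^sub>m k n" using k(3) by (intro eq_matI) (auto simp: W_def mfun_def)
        then show False using V0 l k_def by blast
      qed
      then obtain a j where aj: "a < k" "j < n" "W a j \<noteq> 0" by blast
      have "ip k (\<lambda>i. W i j) (\<lambda>i. W i j) = q"
        using q[of "unitv j" "unitv j"] aj(2) by (simp add: app_unitv, simp add: unitv_def)
      moreover have "ip k (\<lambda>i. W i j) (\<lambda>i. W i j) \<noteq> 0" using aj(1,3) ip_eq_0_iff[of k "\<lambda>i. W i j"]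
          by blast
      ultimately show ?thesis using ip_nonneg[of k "\<lambda>i. W i j"] by simp
    qed
    define r where "r = 1 / sqrt q"
    have r: "r > 0" "r * r * q = 1" using \<open>q > 0\<close> by (simp_all add: r_def)
    define E where "E j = (\<lambda>a. r * W a j)" for j
    have ip_scale: "ip k (\<lambda>a. s * v a) w = s * ip k v w" "ip k w (\<lambda>a. s * v a) = s * ip k w v" for s v w
      using ip_left[of k "\<lambda>_. 0" s v w] ip_right[of k w "\<lambda>_. 0" s v] by simp_all
    have Eo: "orthonormal k E n"
      unfolding orthonormal_def
    proof (intro allI impI)
      fix i j assume ij: "i < n" "j < n"
      have "ip k (E i) (E j) = r * (r * (q * ip n (unitv i) (unitv j)))"
        unfolding q[symmetric] app_unitv[OF ij(1)] app_unitv[OF ij(2)] E_def ip_scale ..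
      also have "\<dots> = of_bool (i = j)" using r(2) ij
          by (simp add: mult.assoc[symmetric]) (simp add: unitv_def)
      finally show "ip k (E i) (E j) = of_bool (i = j)" .
    qed
    have nk: "n \<le> k" by (rule orthonormal_card_le[OF Eo])
    obtain g where g: "orthonormal k g k" "\<And>j. j < n \<Longrightarrow> g j = E j"
      by (rule orthonormal_complete[OF Eo]) blast
    have cross: "vform k Z (g i) (g j) = (if i < n then X i j else 0)" if "i < k" "j < n" for i j
    proof -
      have gj: "vform k Z (g i) (g j) = r *\<^sub>R vform k Z (g i) (app n W (unitv j))"
        using vform_right[of k Z "g i" "\<lambda>_. 0" r "\<lambda>a. W a j"] that(2)
        by (simp add: g(2) E_def app_unitv) (simp add: vform_def)
      \<comment> \<open>By orthonormality the transpose sends \<open>g i\<close> to a multiple of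
        the unit vector \<open>i\<close>, or to zero if \<open>i\<close> is a new index.\<close>
      have t: "tapp k W (g i) b = (1 / r) * of_bool (b = i)" if "b < n" for b
      proof -
        have "ip k (g b) (g i) = of_bool (b = i)" using g(1) that nk \<open>i < k\<close>
            by (simp add: orthonormal_def)
        then have "r * tapp k W (g i) b = of_bool (b = i)"
          using g(2)[OF that] by (simp add: E_def ip_def tapp_def sum_distrib_left mult.assoc)
        then show ?thesis using r(1) by (simp add: field_simps)
      qed
      have "vform k Z (g i) (g j) = r *\<^sub>R vform n X (\<lambda>b. (1 / r) * of_bool (b = i)) (unitv j)"
        unfolding gj twine by (intro arg_cong2[of _ _ _ _ scaleR] refl vform_cong t)
      also have "\<dots> = (if i < n then X i j else 0)"
      proof (cases "i < n")
        case True
        have "vform n X (\<lambda>b. (\<lambda>_. 0) b + (1 / r) * unitv i b) (unitv j) = (1 / r) *\<^sub>R X i j"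
          unfolding vform_left using True that(2) by (simp add: vform_row sum_unitv)
        then show ?thesis using True r(1) by (simp add: unitv_def[of i])
      next
        case False
        then show ?thesis by (auto simp: vform_def intro!: sum.neutral)
      qed
      finally show ?thesis .
    qed
    have ue: "(tuple k (\<lambda>i j. vform k Z (g i) (g j)), Y l) \<in> unitarily_equiv"
      unfolding Z_def by (rule unitarily_equiv_basis[OF k(2,1) g(1)])
    show ?thesis
    proof (cases "k = n")
      case True
      have "tuple k (\<lambda>i j. vform k Z (g i) (g j)) = tuple n X"
        using True cross by (intro ext eq_matI) (auto simp: tuple_def)
      then show ?thesis using ue True by (simp add: k_def)
    next
      case False
      define G where "G i j = vform k Z (g (n + i)) (g (n + j))" for i j
      have "orthonormal k (\<lambda>i. g (n + i)) (k - n)"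
        using g(1) nk by (auto simp: orthonormal_def)
      then have "wmax P (k - n) G" unfolding G_def[abs_def] by (rule wmax_basis[OF wZ])
      then have "tuple (k - n) G \<in> Wmax P" using False nk by (intro tuple_Wmax) auto
      moreover have ds: "direct_sum (tuple n X) (tuple (k - n) G)
          = tuple k (\<lambda>i j. vform k Z (g i) (g j))"
      proof (rule ext, rule eq_matI)
        fix s i j
        assume "i < dim_row (tuple k (\<lambda>i j. vform k Z (g i) (g j)) s)"
            "j < dim_col (tuple k (\<lambda>i j. vform k Z (g i) (g j)) s)"
        then have ij: "i < k" "j < k" by (simp_all add: tuple_def)
        have 1: "vform k Z (g i) (g j) = (if i < n then X i j else 0)" if "j < n"
            using cross ij that by blast
        have 2: "vform k Z (g i) (g j) = 0" if "i < n" "\<not> j < n"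
          using cross[of j i] ij that by (simp add: vform_sym[OF sZ, of "g i" "g j"])
        have 3: "vform k Z (g i) (g j) = G (i - n) (j - n)" if "\<not> i < n" "\<not> j < n"
          using that by (simp add: G_def)
        show "direct_sum (tuple n X) (tuple (k - n) G) s $$ (i, j)
            = tuple k (\<lambda>i j. vform k Z (g i) (g j)) s $$ (i, j)"
          using ij nk 1 2 3 by (cases "i < n"; cases "j < n") (auto simp: direct_sum_def tuple_def)
      qed (use nk in \<open>simp_all add: direct_sum_def tuple_def\<close>)
      ultimately have "\<exists>Z\<in>Wmax P. (direct_sum (tuple n X) Z, Y l) \<in> unitarily_equiv"
        using ue unfolding ds[symmetric] by blast
      then show ?thesis using False nk unfolding k_def by simp
    qed
  qed
  moreover have "tuple n X \<in> level (Wmax P) n"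
    using tuple_Wmax[OF wX n] tuple_SMn[OF sX] by (simp add: level_def)
  ultimately show ?thesis unfolding free_extreme_def using n by blast
qed

section \<open>Vertices among the free extreme points\<close>

lemma point_tuple_SMn: "point_tuple x \<in> SMn 1"
  by (auto simp: point_tuple_def SMn_def intro!: eq_matI)

lemma unitarily_equiv_point:
  fixes Y :: "nat \<Rightarrow> nat \<Rightarrow> real ^ 'g::finite"
  assumes "(tuple k Y, point_tuple x) \<in> unitarily_equiv" "symm k Y"
  shows "k = 1 \<and> Y 0 0 = x"
proof -
  obtain U where U: "point_tuple x \<in> SMn k"
    "\<And>v w. hform k (entries (point_tuple x)) v w = hform k (entries (tuple k Y)) (app k U v) (app
        k U w)"
    by (rule unitarily_equiv_form[OF assms(1) tuple_SMn[OF assms(2)]]) blast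
  have k: "k = 1" using SMn_unique[OF U(1) point_tuple_SMn] .
  have "entries (point_tuple x) 0 0 = x" by (simp add: entries_def point_tuple_def)
  then have "(1, x) = hform k (entries (point_tuple x)) (unitv 0) (unitv 0)"
    using k by (simp add: hform_unitv)
  also have "\<dots> = hform k (entries (tuple k Y)) (app k U (unitv 0)) (app k U (unitv 0))" by (rule U(2))
  also have "\<dots> = hform 1 Y (app 1 U (unitv 0)) (app 1 U (unitv 0))"
    by (simp only: hform_entries_tuple k)
  also have "\<dots> = (U 0 0 * U 0 0) *\<^sub>R (1, Y 0 0)" by (simp add: app_unitv hform_as_sum)
  finally show ?thesis using k by simp
qed

lemma nonvertex_free_extreme:
  fixes Y :: "nat \<Rightarrow> nat \<Rightarrow> real ^ 'g::finite"
  assumes "nonvertex P x k Y" "0 < k"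
  shows "symm k Y" "tuple k Y \<in> free_extreme (Wmax P)"
    "tuple k Y \<in> free_extreme (Wmax P) - {Z \<in> Wmax P. (Z, point_tuple x) \<in> unitarily_equiv}"
proof -
  have Y: "arveson P k Y" "irred k Y" "\<not> (k = 1 \<and> Y 0 0 = x)" using assms(1)
      by (auto simp: nonvertex_def)
  show s: "symm k Y" using Y(1) by (auto simp: arveson_def wmax_def)
  show fe: "tuple k Y \<in> free_extreme (Wmax P)" using assms(2)
      by (intro irred_arveson_free_extreme Y) simp
  show "tuple k Y \<in> free_extreme (Wmax P) - {Z \<in> Wmax P. (Z, point_tuple x) \<in> unitarily_equiv}"
    using fe unitarily_equiv_point[OF _ s] Y(3) by blast
qed

lemma vertex_not_crucial:
  fixes P F :: "(real ^ 'g::finite) set"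
  assumes "polytope P" "F face_of P" "aff_dim F = 2" "\<not> (\<exists>n. n simplex F)" "x extreme_point_of F"
  shows "point_tuple x \<notin> crucial_free_extreme (Wmax P)"
proof -
  define S where "S = free_extreme (Wmax P) - {Z \<in> Wmax P. (Z, point_tuple x) \<in> unitarily_equiv}"
  obtain y where y: "\<And>e. 0 < e \<Longrightarrow> e \<le> 1 \<Longrightarrow>
      assembled (nonvertex P x) 1 (\<lambda>_ _. (1 - e) *\<^sub>R x + e *\<^sub>R y)"
    by (rule near_vertex_assembled[OF assms]) blast
  have "\<exists>Y\<in>level (co_mat S) 1. \<forall>k. \<forall>i<1. \<forall>j<1. \<bar>Y k $$ (i, j) - point_tuple x k $$ (i, j)\<bar> < d"
      if d: "d > 0" for d
  proof -
    \<comment> \<open>Small enough to put \<open>z\<close> within \<open>d\<close> of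
      \<open>x\<close>; the \<open>+ 1\<close> avoids a zero denominator.\<close>
    define e where "e = min 1 (d / (norm (y - x) + 1))"
    have np: "norm (y - x) + 1 > 0" by (simp add: add_nonneg_pos)
    have e: "0 < e" "e \<le> 1" using d np by (simp_all add: e_def)
    have "e * norm (y - x) < d"
    proof -
      have "e * norm (y - x) < e * (norm (y - x) + 1)" using e(1) by simp
      also have "\<dots> \<le> d / (norm (y - x) + 1) * (norm (y - x) + 1)"
        using np by (intro mult_right_mono) (auto simp: e_def)
      finally show ?thesis using np by simp
    qed
    define z where "z = (1 - e) *\<^sub>R x + e *\<^sub>R y"
    have sz: "symm 1 (\<lambda>_ _. z)" by (simp add: symm_def)
    have "tuple 1 (\<lambda>_ _. z) \<in> co_mat S"
    proof (rule assembled_co_mat[OF y[OF e, folded z_def] sz])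
      show "symm k Y \<and> tuple k Y \<in> S" if "nonvertex P x k Y" "0 < k" for k Y
        using nonvertex_free_extreme(1,3)[OF that] unfolding S_def by blast
    qed simp
    then have "tuple 1 (\<lambda>_ _. z) \<in> level (co_mat S) 1" using tuple_SMn[OF sz] by (simp add: level_def)
    moreover have "\<bar>tuple 1 (\<lambda>_ _. z) k $$ (i, j) - point_tuple x k $$ (i, j)\<bar> < d" if "i < 1"
        "j < 1" for k i j
    proof -
      have "tuple 1 (\<lambda>_ _. z) k $$ (i, j) - point_tuple x k $$ (i, j) = e * (y - x) $ k"
        using that by (simp add: tuple_def point_tuple_def z_def algebra_simps)
      also have "\<bar>\<dots>\<bar> \<le> e * norm (y - x)"
        using e(1) component_le_norm_cart[of "y - x" k] by (simp add: abs_mult)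
      finally show ?thesis using \<open>e * norm (y - x) < d\<close> by simp
    qed
    ultimately show ?thesis by blast
  qed
  then have "point_tuple x \<in> level_closure (co_mat S)"
    unfolding level_closure_def using point_tuple_SMn[of x] by (intro CollectI exI[of _ 1]) auto
  then show ?thesis by (simp add: crucial_free_extreme_def S_def)
qed

lemma infinite_free_extreme_classes:
  fixes P F :: "(real ^ 'g::finite) set"
  assumes P: "polytope P" "F face_of P" "aff_dim F = 2" "\<not> (\<exists>n. n simplex F)"
      and x: "x extreme_point_of F"
  shows "infinite (free_extreme (Wmax P) // unitarily_equiv)"
proof
  assume fin: "finite (free_extreme (Wmax P) // unitarily_equiv)"
  have xP: "x extreme_point_of P" using x P(2) by (simp add: extreme_point_of_face)
  obtain l where l: "l \<in> dual_cone P" "l \<bullet> (1, x) = 0" "\<And>b. \<exists>C. C *\<^sub>R l + (- (b \<bullet> x), b) \<in> dual_cone P"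
    by (rule vertex_functional[OF P(1) xP]) blast
  \<comment> \<open>A null vector of \<open>l\<close> would force an irreducible point to be
    \<open>x\<close>, so compactness of the sphere gives a positive bound.\<close>
  have pos: "\<exists>e>0. \<forall>w. e * ip k w w \<le> l \<bullet> hform k Y w w" if Y: "nonvertex P x k Y" for k Y
  proof -
    have wY: "wmax P k Y" "irred k Y" "\<not> (k = 1 \<and> Y 0 0 = x)" using Y
        by (auto simp: nonvertex_def arveson_def)
    have "ip k v v = 0" if "l \<bullet> hform k Y v v = 0" for v
      using irred_vertex[OF l(1,3) wY(1,2) that] wY(3) by blast
    then obtain e where "e > 0" "\<And>w. (\<forall>s\<in>{}. ip k s w = 0) \<Longrightarrow> e * ip k w w \<le> l \<bullet> hform k Y w w"
      using positive_on_complement[of l k Y "{}"] wmaxD[OF wY(1) l(1)] by blast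
    then show ?thesis by blast
  qed
  \<comment> \<open>Equivalent points have the same form up to an isometric substitution, so one
    bound serves a whole class.\<close>
  have "\<exists>e>0. \<forall>k Y w. 0 < k \<and> nonvertex P x k Y \<and> unitarily_equiv `` {tuple k Y}
      = c \<longrightarrow> e * ip k w w \<le> l \<bullet> hform k Y w w" for c
  proof (cases "\<exists>k Y. 0 < k \<and> nonvertex P x k Y \<and> unitarily_equiv `` {tuple k Y} = c")
    case True
    then obtain k Y where Y: "0 < k" "nonvertex P x k Y" "unitarily_equiv `` {tuple k Y} = c" by blast
    obtain e where e: "e > 0" "\<And>w. e * ip k w w \<le> l \<bullet> hform k Y w w" using pos[OF Y(2)] by blast
    have "e * ip k' w w \<le> l \<bullet> hform k' Y' w w"
      if Y': "0 < k'" "nonvertex P x k' Y'" "unitarily_equiv `` {tuple k' Y'} = c" for k' Y' w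
    proof -
      have sm: "tuple k Y \<in> SMn k" "tuple k' Y' \<in> SMn k'"
        using nonvertex_free_extreme(1)[OF Y(2,1)] nonvertex_free_extreme(1)[OF Y'(2,1)]
            by (simp_all add: tuple_SMn)
      have "(tuple k' Y', tuple k' Y') \<in> unitarily_equiv" using Y'(1)
          by (intro unitarily_equiv_refl[OF sm(2)]) simp
      then have "(tuple k Y, tuple k' Y') \<in> unitarily_equiv" using Y(3) Y'(3) by blast
      then obtain U where U: "tuple k' Y' \<in> SMn k"
        "\<And>v w. hform k (entries (tuple k' Y')) v w = hform k (entries (tuple k Y)) (app k U v)
            (app k U w)"
        by (rule unitarily_equiv_form[OF _ sm(1)]) blast
      have kk: "k' = k" using SMn_unique[OF sm(2) U(1)] .
      have h: "hform k Y' w w = hform k Y (app k U w) (app k U w)"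
        using U(2)[of w w] unfolding kk hform_entries_tuple .
      have "ip k w w = ip k (app k U w) (app k U w)" using arg_cong[OF h, of fst]
          by (simp add: hform_def)
      then show ?thesis using e(2)[of "app k U w"] unfolding kk h by simp
    qed
    then show ?thesis using e(1) by blast
  next
    case False
    show ?thesis
    proof (intro exI[of _ "1::real"] conjI allI impI)
      fix k Y and w :: "nat \<Rightarrow> real"
      assume "0 < k \<and> nonvertex P x k Y \<and> unitarily_equiv `` {tuple k Y} = c"
      then show "1 * ip k w w \<le> l \<bullet> hform k Y w w" using False by blast
    qed simp
  qed
  then obtain \<epsilon> where \<epsilon>: "\<And>c. \<epsilon> c > 0" "\<And>c k Y w. 0 < k \<Longrightarrow> nonvertex P x k Y \<Longrightarrow>
      unitarily_equiv `` {tuple k Y} = c \<Longrightarrow> \<epsilon> c * ip k w w \<le> l \<bullet> hform k Y w w"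
    by metis
  \<comment> \<open>The inserted 1 keeps the set nonempty.\<close>
  define e where "e = Min (insert 1 (\<epsilon> ` (free_extreme (Wmax P) // unitarily_equiv)))"
  have e0: "e > 0" unfolding e_def using fin \<epsilon>(1) by (subst Min_gr_iff) auto
  have e: "e * ip k w w \<le> l \<bullet> hform k Y w w" if "0 < k" "nonvertex P x k Y" for k Y w
  proof -
    let ?c = "unitarily_equiv `` {tuple k Y}"
    have "?c \<in> free_extreme (Wmax P) // unitarily_equiv"
      by (rule quotientI) (rule nonvertex_free_extreme(2)[OF that(2,1)])
    then have "e \<le> \<epsilon> ?c" unfolding e_def using fin by (intro Min_le) auto
    then have "e * ip k w w \<le> \<epsilon> ?c * ip k w w" by (intro mult_right_mono ip_nonneg)
    then show ?thesis using \<epsilon>(2)[OF that refl, of w] by linarith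
  qed
  obtain y where y: "\<And>e. 0 < e \<Longrightarrow> e \<le> 1 \<Longrightarrow>
      assembled (nonvertex P x) 1 (\<lambda>_ _. (1 - e) *\<^sub>R x + e *\<^sub>R y)"
    by (rule near_vertex_assembled[OF assms]) blast
  have bound: "e \<le> s * (l \<bullet> (1, y))" if s: "0 < s" "s \<le> 1" for s
  proof -
    let ?z = "(1 - s) *\<^sub>R x + s *\<^sub>R y"
    obtain L where L: "\<forall>(k, Y, V)\<in>set L. 0 < k \<and> nonvertex P x k Y"
      "\<And>v w. hform 1 (\<lambda>_ _. ?z) v w = (\<Sum>(k, Y, V)\<leftarrow>L. hform k Y (app 1 V v) (app 1 V w))"
      using y[OF s] unfolding assembled_def by blast
    have ih: "h \<bullet> sum_list (map f M) = sum_list (map (\<lambda>T. h \<bullet> f T) M)"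
        for f :: "_ \<Rightarrow> real \<times> (real ^ 'g)" and h
      and M :: "(nat \<times> (nat \<Rightarrow> nat \<Rightarrow> real ^ 'g) \<times> (nat \<Rightarrow> nat \<Rightarrow> real)) list"
      by (induction M) (simp_all add: inner_add_right)
    have h1: "hform 1 (\<lambda>_ _. ?z) (unitv 0) (unitv 0) = (1, ?z)" by (simp add: hform_unitv)
    \<comment> \<open>\<open>(1, 0)\<close> reads off the inner product, so the bounds of the
      summands add up to a bound at \<open>?z\<close>.\<close>
    have "e * ((1, 0) \<bullet> hform 1 (\<lambda>_ _. ?z) (unitv 0) (unitv 0))
        \<le> l \<bullet> hform 1 (\<lambda>_ _. ?z) (unitv 0) (unitv 0)"
      unfolding L(2) ih sum_list_const_mult[symmetric] using L(1) e
      by (intro sum_list_mono) (auto simp: hform_def)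
    then have "e \<le> l \<bullet> (1, ?z)" unfolding h1 by simp
    also have "\<dots> = (1 - s) * (l \<bullet> (1, x)) + s * (l \<bullet> (1, y))"
      by (cases l) (simp add: inner_add_right algebra_simps)
    finally show ?thesis by (simp add: l(2))
  qed
  \<comment> \<open>Makes the value of \<open>l\<close> at the point of the segment at most
    \<open>e / 2\<close>.\<close>
  define s where "s = min 1 (e / (2 * (\<bar>l \<bullet> (1, y)\<bar> + 1)))"
  have p: "2 * (\<bar>l \<bullet> (1, y)\<bar> + 1) > 0" by simp
  have s: "0 < s" "s \<le> 1" using e0 p by (simp_all add: s_def)
  have "s * (l \<bullet> (1, y)) \<le> s * (\<bar>l \<bullet> (1, y)\<bar> + 1)" using s by (intro mult_left_mono) auto
  also have "\<dots> \<le> e / (2 * (\<bar>l \<bullet> (1, y)\<bar> + 1)) * (\<bar>l \<bullet> (1, y)\<bar> + 1)"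
    by (intro mult_right_mono) (auto simp: s_def)
  also have "\<dots> = e / 2" using p by (simp add: field_simps)
  finally show False using bound[OF s] e0 by simp
qed

section \<open>Free spectrahedra and minimal matrix convex sets\<close>

lemma sum_product_index:
  "(\<Sum>I<d * (n::nat). f I) = (\<Sum>i<d. \<Sum>a<n. f (i * n + a) :: 'b::comm_monoid_add)"
proof (induction d)
  case (Suc d)
  have "(\<Sum>I<Suc d * n. f I) = (\<Sum>I<d * n + n. f I)" by (simp add: add.commute)
  then show ?case using Suc by (simp add: sum_lessThan_add)
qed simp

text \<open>Grouped by the index of \<open>X\<close>, the quadratic form of the pencil shows the
  entries of \<open>X\<close> as linear parts of affine functionals acting on the point
  \<open>A\<close>: the two tuples exchange roles.\<close>

lemma free_spectrahedron_iff:
  fixes A X :: "'g::finite mtuple"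
  assumes A: "A \<in> SMn d" and X: "X \<in> SMn n" and n: "n \<ge> 1"
  shows "X \<in> free_spectrahedron_of d A \<longleftrightarrow>
    (\<forall>\<xi>. 0 \<le> (\<Sum>a<n. \<Sum>b<n. (of_bool (a = b), - entries X a b) \<bullet> hform d (entries A) (\<xi> a) (\<xi> b)))"
proof -
  define M where "M = 1\<^sub>m (d * n) - msum (d * n) (d * n) (\<lambda>k. kron (A k) (X k)) UNIV"
  have M: "M \<in> carrier_mat (d * n) (d * n)" unfolding M_def msum_def
      by (intro minus_carrier_mat mat_carrier)
  have lt: "i * n + a < d * n" if "i < d" "a < n" for i a
  proof -
    have "i * n + a < Suc i * n" using that by simp
    also have "\<dots> \<le> d * n" using that by (intro mult_le_mono1) simp
    finally show ?thesis .
  qed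
  \<comment> \<open>In the Kronecker product the quotient of a row number by \<open>n\<close> is the
    index of \<open>A\<close>, the remainder that of \<open>X\<close>.\<close>
  have e: "M $$ (i * n + a, j * n + b) = of_bool (i = j) * of_bool (a
      = b) - entries A i j \<bullet> entries X a b"
    if "i < d" "a < n" "j < d" "b < n" for i a j b
  proof -
    have eq: "i * n + a = j * n + b \<longleftrightarrow> i = j \<and> a = b"
      using that by (metis div_mult_self3 div_less add.right_neutral add_left_cancel less_nat_zero_code)
    show ?thesis
      using that lt[OF that(1,2)] lt[OF that(3,4)] A X
      by (auto simp: M_def msum_def kron_def entries_def inner_vec_def eq)
  qed
  have sym: "\<forall>I<d * n. \<forall>J<d * n. M $$ (I, J) = M $$ (J, I)"
  proof (intro allI impI)
    fix I J assume IJ: "I < d * n" "J < d * n"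
    have I: "I div n < d" "I mod n < n" "J div n < d" "J mod n < n"
      using IJ n by (auto simp: less_mult_imp_div_less)
    have "M $$ (I div n * n + I mod n, J div n * n + J mod n) = M $$ (J div n * n
        + J mod n, I div n * n + I mod n)"
      unfolding e[OF I] e[OF I(3,4,1,2)]
      using symm_entries[OF A] symm_entries[OF X] I by (auto simp: symm_def)
    then show "M $$ (I, J) = M $$ (J, I)" by simp
  qed
  have quad: "(\<Sum>I<d * n. \<Sum>J<d * n. v I * v J * M $$ (I, J))
      = (\<Sum>a<n. \<Sum>b<n. (of_bool (a = b), - entries X a b) \<bullet> hform d (entries A) (\<xi> a) (\<xi> b))"
    if v: "\<And>i a. i < d \<Longrightarrow> a < n \<Longrightarrow> v (i * n + a) = \<xi> a i" for v and \<xi> :: "nat \<Rightarrow> nat \<Rightarrow> real"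
  proof -
    let ?g = "\<lambda>i a j b. \<xi> a i * \<xi> b j * (of_bool (i = j) * of_bool (a
        = b) - entries A i j \<bullet> entries X a b)"
    have "(\<Sum>I<d * n. \<Sum>J<d * n. v I * v J * M $$ (I, J)) = (\<Sum>i<d. \<Sum>a<n. \<Sum>j<d. \<Sum>b<n. ?g i a j b)"
      unfolding sum_product_index by (intro sum.cong refl) (simp add: e v)
    also have "\<dots> = (\<Sum>a<n. \<Sum>i<d. \<Sum>j<d. \<Sum>b<n. ?g i a j b)" by (rule sum.swap)
    also have "\<dots> = (\<Sum>a<n. \<Sum>i<d. \<Sum>b<n. \<Sum>j<d. ?g i a j b)"
      by (rule sum.cong[OF refl], rule sum.cong[OF refl], rule sum.swap)
    also have "\<dots> = (\<Sum>a<n. \<Sum>b<n. \<Sum>i<d. \<Sum>j<d. ?g i a j b)"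
      by (rule sum.cong[OF refl], rule sum.swap)
    also have "\<dots> = (\<Sum>a<n. \<Sum>b<n. (of_bool (a = b), - entries X a b) \<bullet> hform d (entries A) (\<xi> a) (\<xi> b))"
      unfolding hform_as_sum inner_sum_right
      by (intro sum.cong refl) (simp add: inner_commute algebra_simps)
    finally show ?thesis .
  qed
  have "X \<in> free_spectrahedron_of d A \<longleftrightarrow> psd M"
  proof -
    have "\<exists>n'\<ge>1. X \<in> SMn n' \<and> psd (1\<^sub>m (d * n') - msum (d * n') (d * n') (\<lambda>k. kron (A k) (X k))
        UNIV) \<longleftrightarrow> psd M"
      unfolding M_def using SMn_unique[OF X] X n by blast
    then show ?thesis unfolding free_spectrahedron_of_def M_def using SMn_unique[OF X] X n by blast
  qed
  also have "\<dots> \<longleftrightarrow> (\<forall>v::nat \<Rightarrow> real. 0 \<le> (\<Sum>I<d * n. \<Sum>J<d * n. v I * v J * M $$ (I, J)))"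
    unfolding psd_iff[OF M] using sym by blast
  also have "\<dots> \<longleftrightarrow> (\<forall>\<xi>. 0 \<le> (\<Sum>a<n. \<Sum>b<n. (of_bool (a = b), - entries X a b) \<bullet> hform d (entries A) (\<xi>
      a) (\<xi> b)))"
  proof
    assume L: "\<forall>v::nat \<Rightarrow> real. 0 \<le> (\<Sum>I<d * n. \<Sum>J<d * n. v I * v J * M $$ (I, J))"
    show "\<forall>\<xi>. 0 \<le> (\<Sum>a<n. \<Sum>b<n. (of_bool (a = b), - entries X a b) \<bullet> hform d (entries A) (\<xi> a) (\<xi> b))"
    proof
      fix \<xi> :: "nat \<Rightarrow> nat \<Rightarrow> real"
      have "0 \<le> (\<Sum>I<d * n. \<Sum>J<d * n. \<xi> (I mod n) (I div n) * \<xi> (J mod n) (J div n) * M $$ (I, J))"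
        using L[rule_format, of "\<lambda>I. \<xi> (I mod n) (I div n)"] .
      also have "\<dots> = (\<Sum>a<n. \<Sum>b<n. (of_bool (a = b), - entries X a b) \<bullet> hform d (entries A) (\<xi> a) (\<xi> b))"
        by (rule quad) simp
      finally show "0 \<le> \<dots>" .
    qed
  next
    assume R: "\<forall>\<xi>. 0 \<le> (\<Sum>a<n. \<Sum>b<n. (of_bool (a = b), - entries X a b) \<bullet> hform d (entries A) (\<xi> a)
        (\<xi> b))"
    show "\<forall>v::nat \<Rightarrow> real. 0 \<le> (\<Sum>I<d * n. \<Sum>J<d * n. v I * v J * M $$ (I, J))"
    proof
      fix v :: "nat \<Rightarrow> real"
      have "(\<Sum>I<d * n. \<Sum>J<d * n. v I * v J * M $$ (I, J))
        = (\<Sum>a<n. \<Sum>b<n. (of_bool (a = b), - entries X a b) \<bullet> hform d (entries A) ((\<lambda>a i. v (i * n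
            + a)) a) ((\<lambda>a i. v (i * n + a)) b))"
        by (rule quad[of v "\<lambda>a i. v (i * n + a)"]) simp
      then show "0 \<le> (\<Sum>I<d * n. \<Sum>J<d * n. v I * v J * M $$ (I, J))"
          using R[rule_format, of "\<lambda>a i. v (i * n + a)"] by simp
    qed
  qed
  finally show ?thesis .
qed

lemma point_in_Wmin:
  fixes y :: "real ^ 'g::finite"
  assumes "y \<in> C"
  shows "point_tuple y \<in> Wmin C"
proof -
  have t: "tuple 1 (\<lambda>_ _. y) = point_tuple y" by (rule ext, rule eq_matI) (auto simp: tuple_def
      point_tuple_def)
  have "assembled (\<lambda>k Y. k = 1 \<and> Y = (\<lambda>_ _. y)) 1 (\<lambda>_ _. y)" by (rule assembled_base) simp_all
  then have "tuple 1 (\<lambda>_ _. y) \<in> co_mat (point_tuple ` C)"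
    by (rule assembled_co_mat) (use assms t in \<open>auto simp: symm_def\<close>)
  then show ?thesis by (simp only: Wmin_def t)
qed

text \<open>The generators have size 1, so the coefficients are rows, and \<open>X\<close> is a sum
  of points of \<open>C\<close> with rank one weights.\<close>

lemma Wmin_representation:
  fixes X :: "'g::finite mtuple"
  assumes "X \<in> Wmin C" "X \<in> SMn n"
  obtains m :: nat and \<tau> y where "\<forall>l<m. y l \<in> C"
    "\<forall>i<n. \<forall>j<n. (of_bool (i = j), entries X i j) = (\<Sum>l<m. (\<tau> l i * \<tau> l j) *\<^sub>R (1 :: real, y l))"
proof -
  obtain n' m N V Y where comb: "mat_convex_comb (point_tuple ` C) n' m N V Y X"
    using assms(1) unfolding Wmin_def co_mat_def by blast
  have "X \<in> SMn n'"
  proof -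
    have "X k \<in> carrier_mat n' n'" for k
      using comb by (auto simp: mat_convex_comb_def msum_def)
    then have "n' = n" using SMn_dim(1)[OF assms(2)] by (metis carrier_matD(1))
    then show ?thesis using assms(2) by simp
  qed
  then have n': "n' = n" using SMn_unique assms(2) by blast
  have Y: "N l = 1 \<and> (\<exists>y\<in>C. Y l = point_tuple y)" if "l < m" for l
  proof -
    have "Y l \<in> point_tuple ` C" "Y l \<in> SMn (N l)"
      using comb that by (auto simp: mat_convex_comb_def level_def)
    then obtain y where y: "y \<in> C" "Y l = point_tuple y" "point_tuple y \<in> SMn (N l)" by auto
    then show ?thesis using SMn_unique[OF y(3) point_tuple_SMn] by blast
  qed
  then obtain y where y: "\<And>l. l < m \<Longrightarrow> N l = 1 \<and> y l \<in> C \<and> Y l = point_tuple (y l)" by metis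
  show ?thesis
  proof (rule that[of m y "\<lambda>l. mfun (V l) 0"])
    show "\<forall>l<m. y l \<in> C" using y by blast
  next
    have "(of_bool (i = j), entries X i j) = (\<Sum>l<m. (mfun (V l) 0 i * mfun (V l) 0 j) *\<^sub>R (1 ::
        real, y l))"
      if ij: "i < n" "j < n" for i j
    proof -
      have "(of_bool (i = j), entries X i j) = hform n (entries X) (unitv i) (unitv j)"
        using ij by (simp add: hform_unitv)
      also have "\<dots> = (\<Sum>l<m. hform (N l) (entries (Y l)) (app n (mfun (V l)) (unitv i)) (app n
          (mfun (V l)) (unitv j)))"
        using mat_convex_comb_hform[OF comb] unfolding n' .
      also have "\<dots> = (\<Sum>l<m. (mfun (V l) 0 i * mfun (V l) 0 j) *\<^sub>R (1 :: real, y l))"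
      proof (intro sum.cong refl)
        fix l assume "l \<in> {..<m}"
        then have l: "N l = 1" "Y l = point_tuple (y l)" using y by auto
        have "entries (point_tuple (y l)) 0 0 = y l" by (simp add: entries_def point_tuple_def)
        then show "hform (N l) (entries (Y l)) (app n (mfun (V l)) (unitv i)) (app n (mfun (V l))
            (unitv j))
          = (mfun (V l) 0 i * mfun (V l) 0 j) *\<^sub>R (1 :: real, y l)"
          unfolding l by (simp add: hform_as_sum app_unitv[OF ij(1)] app_unitv[OF ij(2)])
      qed
      finally show ?thesis .
    qed
    then show "\<forall>i<n. \<forall>j<n. (of_bool (i = j), entries X i j)
        = (\<Sum>l<m. (mfun (V l) 0 i * mfun (V l) 0 j) *\<^sub>R (1 :: real, y l))"
      by blast
  qed
qed

text \<open>A functional of the cone with positive constant term is a multiple of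
  \<open>(1, - y)\<close> for some \<open>y\<close> in the polar dual, and the pencil inequality at
  \<open>y\<close> is its nonnegativity on \<open>A\<close>. As 0 is interior, constant term 0
  occurs only for the zero functional.\<close>

lemma polar_spectrahedron_wmax:
  fixes P :: "(real ^ 'g::finite) set"
  assumes P: "0 \<in> interior P" and A: "A \<in> SMn d"
    and eq: "Wmin (polar_dual P) = free_spectrahedron_of d A"
  shows "wmax P d (entries A)"
  unfolding wmax_def
proof (intro conjI ballI allI)
  show "symm d (entries A)" by (rule symm_entries[OF A])
  fix h v assume h: "h \<in> dual_cone P"
  obtain a0 a where ha: "h = (a0, a)" by (cases h)
  have nn: "0 \<le> a0 + a \<bullet> p" if "p \<in> P" for p using h that by (simp add: ha dual_cone_def)
  have a0: "0 \<le> a0" using nn[of 0] P interior_subset by force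
  show "0 \<le> h \<bullet> hform d (entries A) v v"
  proof (cases "a0 = 0")
    case True
    obtain e where e: "e > 0" "ball 0 e \<subseteq> P" using P mem_interior by blast
    have "a = 0"
    proof (rule ccontr)
      assume "a \<noteq> 0"
      \<comment> \<open>A point of the ball opposite to \<open>a\<close>, where the functional would
        be negative.\<close>
      define p where "p = (- (e / (2 * norm a))) *\<^sub>R a"
      have "norm p = e / 2" using \<open>a \<noteq> 0\<close> e(1) by (simp add: p_def)
      then have "p \<in> P" using e by (intro subsetD[OF e(2)]) simp
      then have "0 \<le> a \<bullet> p" using nn True by force
      moreover have "a \<bullet> p = - (e / (2 * norm a)) * (a \<bullet> a)" by (simp add: p_def)
      moreover have "(e / (2 * norm a)) * (a \<bullet> a) > 0" using \<open>a \<noteq> 0\<close> e(1) by simp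
      ultimately show False by linarith
    qed
    then show ?thesis using True by (simp add: ha hform_def)
  next
    case False
    then have a0: "a0 > 0" using a0 by simp
    define y where "y = - (1 / a0) *\<^sub>R a"
    have "y \<in> polar_dual P"
      unfolding polar_dual_def
    proof (intro CollectI ballI)
      fix p assume "p \<in> P"
      then have "0 \<le> (1 / a0) * (a0 + a \<bullet> p)" using nn a0 by simp
      then show "0 \<le> 1 - y \<bullet> p" using a0 by (simp add: y_def field_simps)
    qed
    then have "point_tuple y \<in> free_spectrahedron_of d A" using point_in_Wmin eq by blast
    note iffD1[OF free_spectrahedron_iff[OF A point_tuple_SMn order_refl] this, rule_format, of "\<lambda>_. v"]
    moreover have "entries (point_tuple y) 0 0 = y" by (simp add: entries_def point_tuple_def)
    ultimately have "0 \<le> (1, - y) \<bullet> hform d (entries A) v v" by simp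
    moreover have h': "h = a0 *\<^sub>R (1, - y)" using a0 by (simp add: ha y_def)
    ultimately show ?thesis unfolding h' inner_scaleR_left using a0 by (intro mult_nonneg_nonneg) auto
  qed
qed

lemma proj_linear: "proj n e k (\<lambda>i. v i + s * w i) = (\<lambda>i. proj n e k v i + s * proj n e k w i)"
  by (rule ext) (simp add: proj_def ip_left sum.distrib sum_distrib_left algebra_simps)

text \<open>The kernel of \<open>l\<close> splits off the block on which the point \<open>A\<close> equals the vertex \<open>x\<close>; \<open>T\<close> is
  the orthogonal projection onto it.\<close>

lemma vertex_projection:
  fixes P :: "'a::euclidean_space set"
  assumes l: "l \<in> dual_cone P" "\<And>b. \<exists>C. C *\<^sub>R l + (- (b \<bullet> x), b) \<in> dual_cone P"
    and A: "wmax P d A"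
  obtains e T where "e > 0" "\<And>v s w. T (\<lambda>i. v i + s * w i) = (\<lambda>i. T v i + s * T w i)"
    "\<And>q. (l - (e, 0)) \<bullet> hform d A q q \<ge> - e * ip d (T q) (T q)"
    "\<And>h p. h \<in> dual_cone P \<Longrightarrow> (h \<bullet> (1, x)) * ip d (T p) (T p) \<le> h \<bullet> hform d A p p"
proof -
  note sA = wmax_symm[OF A]
  define S where "S = {w. l \<bullet> hform d A w w = 0}"
  have S0: "l \<bullet> hform d A v w = 0" if "v \<in> S" for v w
    using wmax_kernel[OF A l(1)] that by (simp add: S_def)
  have S: "subspace_fun S"
    unfolding subspace_fun_def
  proof (intro conjI ballI allI)
    show "(\<lambda>_. 0) \<in> S" by (simp add: S_def)
    fix v w s assume "v \<in> S" "w \<in> S"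
    then show "(\<lambda>i. v i + s * w i) \<in> S"
      using S0[of v] S0[of w] by (simp add: S_def hform_quad[OF sA] inner_add_right)
  qed
  obtain g k where g: "k \<le> d" "orthonormal d g d" "\<And>j. j < k \<Longrightarrow> g j \<in> S"
    "\<And>j v. k \<le> j \<Longrightarrow> j < d \<Longrightarrow> v \<in> S \<Longrightarrow> ip d v (g j) = 0"
    "\<And>v i. v \<in> S \<Longrightarrow> i < d \<Longrightarrow> v i = proj d g k v i"
    "\<And>v i. i < d \<Longrightarrow> v i = proj d g d v i"
    by (rule adapted_basis[OF S]) blast
  have gk: "orthonormal d g k" using g(1,2) by (auto simp: orthonormal_def)
  define T where "T = proj d g k"
  define R where "R v = (\<lambda>i. v i - T v i)" for v
  have TS: "T v \<in> S" for v unfolding T_def by (rule subspace_proj[OF S g(3)])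
  have RS: "ip d s (R v) = 0" if "s \<in> S" for s v
  proof -
    have "ip d s (R v) = ip d (proj d g k s) (R v)" using g(5)[OF that] by (intro ip_cong) auto
    also have "\<dots> = (\<Sum>j<k. ip d s (g j) * ip d (R v) (g j))"
      by (simp add: proj_def ip_sum_left ip_commute[of d "g _"])
    also have "\<dots> = 0" using orthonormal_residual(2)[OF gk, of _ v] by (simp add: R_def T_def)
    finally show ?thesis .
  qed
  have dec: "v = (\<lambda>i. T v i + 1 * R v i)" for v by (simp add: R_def)
  have quad: "h \<bullet> hform d A v v = h \<bullet> hform d A (T v) (T v) + 2 * (h \<bullet> hform d A (T v) (R v))
      + h \<bullet> hform d A (R v) (R v)" for h v
    using hform_quad[OF sA, of "T v" 1 "R v"] dec[of v] by (simp add: inner_add_right)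
  have ipq: "ip d v v = ip d (T v) (T v) + ip d (R v) (R v)" for v
    using quad[of "(1, 0)" v] RS[OF TS, of v v] by (simp add: hform_def)
  obtain e where e: "e > 0" "\<And>w. (\<forall>s\<in>S. ip d s w = 0) \<Longrightarrow> e * ip d w w \<le> l \<bullet> hform d A w w"
  proof (rule positive_on_complement[of l d A S])
    show "0 \<le> l \<bullet> hform d A v v" for v by (rule wmaxD[OF A l(1)])
    show "ip d v v = 0" if "\<forall>s\<in>S. ip d s v = 0" "l \<bullet> hform d A v v = 0" for v
      using that by (simp add: S_def)
  qed blast
  show ?thesis
  proof (rule that[OF e(1)])
    show "T (\<lambda>i. v i + s * w i) = (\<lambda>i. T v i + s * T w i)" for v s w
      unfolding T_def by (rule proj_linear)
    show "(l - (e, 0)) \<bullet> hform d A q q \<ge> - e * ip d (T q) (T q)" for q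
    proof -
      \<comment> \<open>Only the component off the kernel contributes to \<open>l\<close>, and it
        outweighs its own share of \<open>- e\<close>; what remains is the kernel share.\<close>
      have "l \<bullet> hform d A q q = l \<bullet> hform d A (R q) (R q)" unfolding quad[of l q]
          by (simp add: S0[OF TS])
      also have "\<dots> \<ge> e * ip d (R q) (R q)" using RS by (intro e(2)) blast
      finally show ?thesis using ipq[of q] by (simp add: inner_diff_left hform_def algebra_simps)
    qed
    fix h p assume h: "h \<in> dual_cone P"
    \<comment> \<open>On the kernel \<open>A\<close> acts as the point \<open>x\<close>, so there
      are no cross terms with the complement.\<close>
    have "vform d A (T p) w = ip d (T p) w *\<^sub>R x" for w
      by (rule vertex_eigenvector[OF l A]) (use TS in \<open>simp add: S_def\<close>)
    then have eq: "hform d A (T p) w = ip d (T p) w *\<^sub>R (1, x)" for w by (simp add: hform_def)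
    have "h \<bullet> hform d A p p = (h \<bullet> (1, x)) * ip d (T p) (T p) + h \<bullet> hform d A (R p) (R p)"
      unfolding quad[of h p] eq inner_scaleR_right RS[OF TS] by simp
    then show "(h \<bullet> (1, x)) * ip d (T p) (T p) \<le> h \<bullet> hform d A p p"
      using wmaxD[OF A h, of "R p"] by simp
  qed
qed

lemma dual_cone_at_interior:
  fixes P :: "'a::euclidean_space set"
  assumes "h \<in> dual_cone P" "0 \<in> interior P" "convex P" "p \<in> P" "0 < h \<bullet> (1, p)"
  shows "0 < fst h"
proof -
  have 0: "0 \<in> rel_interior P" "0 \<in> P" using assms(2) interior_subset_rel_interior interior_subset
      by blast+
  have "h \<bullet> (1, 0) \<noteq> 0" using dual_cone_vanish[OF assms(1,3) 0(1) _ assms(4)] assms(5) by auto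
  moreover have "0 \<le> h \<bullet> (1, 0)" using assms(1) 0(2) unfolding dual_cone_def by blast
  ultimately show ?thesis by (simp add: inner_prod_def)
qed

text \<open>\<open>H\<close> is the sum of \<open>c u\<close> at \<open>(1, 0)\<close>,
  \<open>c v\<close> at \<open>(1, t)\<close> and \<open>l - e\<close> at \<open>(0, 1)\<close>,
  each with its rank one weight. At \<open>X\<close> the first two vanish and \<open>l - e\<close>
  is negative. On \<open>A\<close> the negative part of \<open>l - e\<close> lives on the copies of
  \<open>x\<close>, where \<open>u\<close> and \<open>v\<close> outweigh it for large
  \<open>c\<close>.\<close>

lemma separating_pencil:
  fixes P F :: "'a::euclidean_space set"
  assumes P: "polytope P" "0 \<in> interior P" and F: "F face_of P" "aff_dim F = 2" "\<not> (\<exists>n. n simplex F)"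
    and x: "x extreme_point_of F" and A: "wmax P d A"
  obtains H :: "nat \<Rightarrow> nat \<Rightarrow> real \<times> 'a" and X where "symm 2 H" "wmax P 2 X"
    "\<And>p q. 0 \<le> H 0 0 \<bullet> hform d A p p + 2 * (H 0 1 \<bullet> hform d A p q) + H 1 1 \<bullet> hform d A q q"
    "0 < fst (H 0 0)" "(fst (H 0 1))\<^sup>2 < fst (H 0 0) * fst (H 1 1)"
    "(\<Sum>i<2. \<Sum>j<2. H i j \<bullet> hform 2 X (unitv i) (unitv j)) < 0"
proof -
  have xP: "x extreme_point_of P" using x F(1) by (simp add: extreme_point_of_face)
  then have xP': "x \<in> P" by (simp add: extreme_point_of_def)
  have cP: "convex P" by (rule polytope_imp_convex[OF P(1)])
  note sA = wmax_symm[OF A]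
  obtain l where l: "l \<in> dual_cone P" "l \<bullet> (1, x) = 0" "\<And>b. \<exists>C. C *\<^sub>R l + (- (b \<bullet> x), b) \<in> dual_cone P"
    by (rule vertex_functional[OF P(1) xP]) blast
  obtain e T where e: "e > 0" and T: "\<And>v s w. T (\<lambda>i. v i + s * w i) = (\<lambda>i. T v i + s * T w i)"
    "\<And>q. (l - (e, 0)) \<bullet> hform d A q q \<ge> - e * ip d (T q) (T q)"
    "\<And>h p. h \<in> dual_cone P \<Longrightarrow> (h \<bullet> (1, x)) * ip d (T p) (T p) \<le> h \<bullet> hform d A p p"
    by (rule vertex_projection[OF l(1,3) A]) blast
  obtain u v y where uv: "u \<in> dual_cone P" "v \<in> dual_cone P" "0 < u \<bullet> (1, x)" "0 < v \<bullet> (1, x)"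
    "\<And>e. 0 < e \<Longrightarrow> e \<le> 1 \<Longrightarrow> \<exists>t>0. \<exists>X. wmax P 2 X \<and> X 1 1 = (1 - e) *\<^sub>R x + e *\<^sub>R y \<and>
      u \<bullet> hform 2 X (\<lambda>i. of_bool (i = 0)) (\<lambda>i. of_bool (i = 0)) = 0 \<and>
      v \<bullet> hform 2 X (\<lambda>i. if i = 0 then 1 else t) (\<lambda>i. if i = 0 then 1 else t) = 0"
    by (rule tilted_dilation[OF P(1) F x]) blast
  \<comment> \<open>Brings the corner so close to \<open>x\<close> that \<open>l\<close> is below
    \<open>e\<close> there.\<close>
  define s where "s = min 1 (e / (2 * (\<bar>l \<bullet> (1, y)\<bar> + 1)))"
  have s: "0 < s" "s \<le> 1" using e by (simp_all add: s_def)
  have "s * (l \<bullet> (1, y)) \<le> s * (\<bar>l \<bullet> (1, y)\<bar> + 1)" using s by (intro mult_left_mono) auto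
  also have "\<dots> \<le> e / (2 * (\<bar>l \<bullet> (1, y)\<bar> + 1)) * (\<bar>l \<bullet> (1, y)\<bar> + 1)"
    by (intro mult_right_mono) (auto simp: s_def)
  also have "\<dots> = e / 2" by (simp add: field_simps)
  finally have sl: "s * (l \<bullet> (1, y)) < e" using e by simp
  obtain t X where t: "t > 0" and X: "wmax P 2 X" "X 1 1 = (1 - s) *\<^sub>R x + s *\<^sub>R y"
      "u \<bullet> hform 2 X (\<lambda>i. of_bool (i = 0)) (\<lambda>i. of_bool (i = 0)) = 0"
      "v \<bullet> hform 2 X (\<lambda>i. if i = 0 then 1 else t) (\<lambda>i. if i = 0 then 1 else t) = 0"
    using uv(5)[OF s] by blast
  define m where "m = min (u \<bullet> (1, x)) (v \<bullet> (1, x))"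
  have m: "m > 0" "m \<le> u \<bullet> (1, x)" "m \<le> v \<bullet> (1, x)" using uv by (auto simp: m_def)
  have uv0: "0 < fst u" "0 < fst v"
    using dual_cone_at_interior[OF uv(1) P(2) cP xP' uv(3)] dual_cone_at_interior[OF uv(2) P(2) cP
        xP' uv(4)] .
  have l0: "0 \<le> fst l"
  proof -
    have "0 \<le> l \<bullet> (1, 0)" using l(1) P(2) interior_subset unfolding dual_cone_def by blast
    then show ?thesis by (simp add: inner_prod_def)
  qed
  \<comment> \<open>The first term lets \<open>u\<close> and \<open>v\<close> outweigh
    \<open>- e\<close> on the copies of \<open>x\<close>, the second makes the determinant of the
    constant term positive, and the 1 gives strictness.\<close>
  define c where "c = 4 * e / (m * t\<^sup>2) + (fst u + fst v) * e / (t\<^sup>2 * fst u * fst v) + 1"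
  have c_parts: "0 \<le> 4 * e / (m * t\<^sup>2)" "0 \<le> (fst u + fst v) * e / (t\<^sup>2 * fst u * fst v)"
    using e m t uv0 by simp_all
  then have c: "c > 0" "c \<ge> 4 * e / (m * t\<^sup>2)" "c > (fst u + fst v) * e / (t\<^sup>2 * fst u * fst v)"
    by (simp_all add: c_def)
  have c1: "4 * e \<le> c * m * t\<^sup>2" using c(2) m t by (simp add: pos_divide_le_eq mult.assoc)
  have c2: "(fst u + fst v) * e < c * (t\<^sup>2 * fst u * fst v)" using c(3) t uv0
      by (simp add: pos_divide_less_eq)
  define H where "H = pair_mat (c *\<^sub>R u + c *\<^sub>R v) ((c * t) *\<^sub>R v) (l - (e, 0) + (c * t\<^sup>2) *\<^sub>R v)"
  have H: "H 0 0 = c *\<^sub>R u + c *\<^sub>R v" "H 0 1 = (c * t) *\<^sub>R v" "H 1 0 = (c * t) *\<^sub>R v"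
    "H 1 1 = l - (e, 0) + (c * t\<^sup>2) *\<^sub>R v"
    by (simp_all add: H_def pair_mat_def)
  show ?thesis
  proof (rule that)
    show "symm 2 H" by (simp add: symm_def H_def pair_mat_def)
    show "wmax P 2 X" by (rule X(1))
    fix p q :: "nat \<Rightarrow> real"
    let ?w = "\<lambda>i. p i + t * q i"
    let ?a = "ip d (T p) (T p)" and ?g = "ip d (T q) (T q)" and ?k = "ip d (T p) (T q)"
    have "H 0 0 \<bullet> hform d A p p + 2 * (H 0 1 \<bullet> hform d A p q) + H 1 1 \<bullet> hform d A q q
      = (l - (e, 0)) \<bullet> hform d A q q + c * (u \<bullet> hform d A p p) + c * (v \<bullet> hform d A ?w ?w)"
      unfolding H hform_quad[OF sA] inner_add_left inner_add_right inner_diff_left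
        inner_scaleR_left inner_scaleR_right by (simp add: algebra_simps)
    moreover have "c * (m * ?a) \<le> c * (u \<bullet> hform d A p p)"
      using T(3)[OF uv(1), of p] mult_right_mono[OF m(2) ip_nonneg[of d "T p"]] c(1) by simp
    moreover have "c * (m * ip d (T ?w) (T ?w)) \<le> c * (v \<bullet> hform d A ?w ?w)"
      using T(3)[OF uv(2), of ?w] mult_right_mono[OF m(3) ip_nonneg[of d "T ?w"]] c(1) by simp
    moreover have "ip d (T ?w) (T ?w) = ?a + 2 * t * ?k + t\<^sup>2 * ?g"
      unfolding T(1) ip_left ip_right by (simp add: ip_commute[of d "T q"
          "T p"] power2_eq_square algebra_simps)
    moreover have "0 \<le> - e * ?g + c * m * ?a + c * m * (?a + 2 * t * ?k + t\<^sup>2 * ?g)"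
    proof -
      \<comment> \<open>Completing the square: with \<open>a = T p\<close> and
        \<open>b = T q\<close>,
        \<open>|a|^2 + |a + t b|^2 - (t^2 / 2) |b|^2 = 2 |a + (t / 2) b|^2\<close>.\<close>
      have "ip d (\<lambda>i. T p i + (t / 2) * T q i) (\<lambda>i. T p i + (t / 2) * T q i) = ?a + t * ?k
          + (t\<^sup>2 / 4) * ?g"
        unfolding ip_left ip_right by (simp add: ip_commute[of d "T q"
            "T p"] power2_eq_square algebra_simps)
      then have "0 \<le> ?a + t * ?k + (t\<^sup>2 / 4) * ?g" using ip_nonneg[of d "\<lambda>i. T p i
          + (t / 2) * T q i"] by simp
      then have "t\<^sup>2 / 2 * ?g \<le> ?a + (?a + 2 * t * ?k + t\<^sup>2 * ?g)" by simp
      then have "c * m * (t\<^sup>2 / 2 * ?g) \<le> c * m * (?a + (?a + 2 * t * ?k + t\<^sup>2 * ?g))"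
        using c(1) m(1) by (intro mult_left_mono) auto
      moreover have "4 * e * ?g \<le> c * m * t\<^sup>2 * ?g" using c1 ip_nonneg by (intro mult_right_mono)
      moreover have "0 \<le> e * ?g" using e ip_nonneg[of d "T q"] by simp
      ultimately show ?thesis by (simp add: algebra_simps)
    qed
    ultimately show "0 \<le> H 0 0 \<bullet> hform d A p p + 2 * (H 0 1 \<bullet> hform d A p q) + H 1 1 \<bullet> hform d A q q"
      using T(2)[of q] by (simp add: algebra_simps)
  next
    show "0 < fst (H 0 0)" unfolding H using c(1) uv0 by (simp add: add_pos_pos)
    have "fst (H 0 0) * fst (H 1 1) - (fst (H 0 1))\<^sup>2
        = c * ((fst u + fst v) * fst l + (c * (t\<^sup>2 * fst u * fst v) - (fst u + fst v) * e))"
      unfolding H by (simp add: power2_eq_square algebra_simps)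
    also have "\<dots> > 0" using c(1) c2 uv0 l0 by (intro mult_pos_pos add_nonneg_pos) auto
    finally show "(fst (H 0 1))\<^sup>2 < fst (H 0 0) * fst (H 1 1)" by simp
    have sym: "X 1 0 = X 0 1" using wmax_symm[OF X(1)] by (simp add: symm_def)
    have eu: "hform 2 X (\<lambda>i. of_bool (i = 0)) (\<lambda>i. of_bool (i = 0)) = (1, X 0 0)"
      by (simp add: hform_as_sum numeral_2_eq_2)
    have ev: "hform 2 X (\<lambda>i. if i = 0 then 1 else t) (\<lambda>i. if i = 0 then 1 else t)
        = (1, X 0 0) + (2 * t) *\<^sub>R (0, X 0 1) + t\<^sup>2 *\<^sub>R (1, X 1 1)"
      using sym by (simp add: hform_as_sum numeral_2_eq_2 power2_eq_square)
        (simp only: mult_2 scaleR_left_distrib)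
    have "(\<Sum>i<2. \<Sum>j<2. H i j \<bullet> hform 2 X (unitv i) (unitv j))
      = H 0 0 \<bullet> (1, X 0 0) + 2 * (H 0 1 \<bullet> (0, X 0 1)) + H 1 1 \<bullet> (1, X 1 1)"
    proof -
      have "(\<Sum>i<2. \<Sum>j<2. H i j \<bullet> hform 2 X (unitv i) (unitv j)) = (\<Sum>i<2. \<Sum>j<2. H i j \<bullet> (of_bool (i
          = j), X i j))"
        by (intro sum.cong refl) (simp add: hform_unitv)
      then show ?thesis using sym H(2,3) by (simp add: numeral_2_eq_2)
    qed
    also have "\<dots> = (l - (e, 0)) \<bullet> (1, X 1 1) + c * (u \<bullet> (1, X 0 0))
        + c * (v \<bullet> ((1, X 0 0) + (2 * t) *\<^sub>R (0, X 0 1) + t\<^sup>2 *\<^sub>R (1, X 1 1)))"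
      unfolding H inner_add_left inner_add_right inner_scaleR_left inner_scaleR_right
      by (simp add: algebra_simps)
    also have "\<dots> = (l - (e, 0)) \<bullet> (1, X 1 1)" using X(3,4) unfolding eu ev by simp
    also have "\<dots> = s * (l \<bullet> (1, y)) - e"
    proof -
      have "l \<bullet> (1, X 1 1) = (1 - s) * (l \<bullet> (1, x)) + s * (l \<bullet> (1, y))"
        unfolding X(2) by (cases l) (simp add: inner_add_right algebra_simps)
      then show ?thesis using l(2) by (simp add: inner_diff_left)
    qed
    also have "\<dots> < 0" using sl by simp
    finally show "(\<Sum>i<2. \<Sum>j<2. H i j \<bullet> hform 2 X (unitv i) (unitv j)) < 0" .
  qed
qed

text \<open>A positive definite \<open>2 \<times> 2\<close> constant term is normalised to the identity by the Cholesky
  factor.\<close>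

lemma Wmin_polar_not_free_spectrahedron:
  fixes P F :: "(real ^ 'g::finite) set"
  assumes P: "polytope P" "0 \<in> interior P" and F: "F face_of P" "aff_dim F = 2" "\<not> (\<exists>n. n simplex F)"
    and x: "x extreme_point_of F"
  shows "\<not> is_free_spectrahedron (Wmin (polar_dual P))"
proof
  assume "is_free_spectrahedron (Wmin (polar_dual P))"
  then obtain d A where A: "A \<in> SMn d" "Wmin (polar_dual P) = free_spectrahedron_of d A"
    unfolding is_free_spectrahedron_def by blast
  have wA: "wmax P d (entries A)" by (rule polar_spectrahedron_wmax[OF P(2) A])
  obtain H :: "nat \<Rightarrow> nat \<Rightarrow> real \<times> (real ^ 'g)" and X where H: "symm 2 H" "wmax P 2 X"
    "\<And>p q. 0 \<le> H 0 0 \<bullet> hform d (entries A) p p + 2 * (H 0 1 \<bullet> hform d (entries A) p q)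
        + H 1 1 \<bullet> hform d (entries A) q q"
    "0 < fst (H 0 0)" "(fst (H 0 1))\<^sup>2 < fst (H 0 0) * fst (H 1 1)"
    "(\<Sum>i<2. \<Sum>j<2. H i j \<bullet> hform 2 X (unitv i) (unitv j)) < 0"
    by (rule separating_pencil[OF P F x wA]) blast
  have H10: "H 1 0 = H 0 1" using H(1) by (simp add: symm_def)
  define b0 b1 b2 where "b0 = fst (H 0 0)" and "b1 = fst (H 0 1)" and "b2 = fst (H 1 1)"
  \<comment> \<open>The Schur complement of the constant term.\<close>
  define D where "D = b2 - b1\<^sup>2 / b0"
  have b0: "b0 > 0" using H(4) by (simp add: b0_def)
  have D: "D > 0" using H(5) b0 by (simp add: D_def b0_def b1_def b2_def field_simps)
  define \<alpha> \<delta> where "\<alpha> = 1 / sqrt b0" and "\<delta> = 1 / sqrt D"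
  have \<alpha>\<delta>: "\<alpha> > 0" "\<delta> > 0" "\<alpha> * \<alpha> * b0 = 1" "\<delta> * \<delta> * D = 1"
    using b0 D by (simp_all add: \<alpha>_def \<delta>_def)
  define \<beta> where "\<beta> = - \<delta> * b1 / b0"
  have \<beta>: "\<beta> * b0 = - \<delta> * b1" using b0 by (simp add: \<beta>_def)
  \<comment> \<open>The congruence of \<open>H\<close> by the matrix with columns
    \<open>(\<alpha>, 0)\<close> and \<open>(\<beta>, \<delta>)\<close>, chosen so that the constant
    term becomes the identity and \<open>G\<close> has the form \<open>I - Z\<close>.\<close>
  define G where "G = pair_mat ((\<alpha> * \<alpha>) *\<^sub>R H 0 0) ((\<alpha> * \<beta>) *\<^sub>R H 0 0 + (\<alpha> * \<delta>) *\<^sub>R H 0 1)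
      ((\<beta> * \<beta>) *\<^sub>R H 0 0 + (2 * \<beta> * \<delta>) *\<^sub>R H 0 1 + (\<delta> * \<delta>) *\<^sub>R H 1 1)"
  have G: "G 0 0 = (\<alpha> * \<alpha>) *\<^sub>R H 0 0" "G 0 1 = (\<alpha> * \<beta>) *\<^sub>R H 0 0 + (\<alpha> * \<delta>) *\<^sub>R H 0 1" "G 1 0 = G 0 1"
    "G 1 1 = (\<beta> * \<beta>) *\<^sub>R H 0 0 + (2 * \<beta> * \<delta>) *\<^sub>R H 0 1 + (\<delta> * \<delta>) *\<^sub>R H 1 1"
    by (simp_all add: G_def pair_mat_def)
  have fG: "fst (G 0 0) = 1" "fst (G 0 1) = 0" "fst (G 1 1) = 1"
  proof -
    show "fst (G 0 0) = 1" using \<alpha>\<delta>(3) unfolding G b0_def by simp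
    have "fst (G 0 1) = \<alpha> * (\<beta> * b0 + \<delta> * b1)" unfolding G b0_def b1_def by (simp add: algebra_simps)
    then show "fst (G 0 1) = 0" using \<beta> by simp
    have "fst (G 1 1) = \<beta> * (\<beta> * b0) + 2 * \<delta> * (\<beta> * b1) + \<delta> * \<delta> * b2"
      unfolding G b0_def b1_def b2_def by (simp add: algebra_simps)
    also have "\<dots> = \<delta> * (\<beta> * b1) + \<delta> * \<delta> * b2" unfolding \<beta> by simp
    also have "\<dots> = \<delta> * \<delta> * D" using b0 by (simp add: \<beta>_def D_def power2_eq_square field_simps)
    finally show "fst (G 1 1) = 1" using \<alpha>\<delta>(4) by simp
  qed
  define Z where "Z i j = - snd (G i j)" for i j
  have GZ: "G i j = (of_bool (i = j), - Z i j)" if "i < 2" "j < 2" for i j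
    using that fG G(3) by (auto simp: Z_def prod_eq_iff less_2_cases_iff)
  have sZ: "symm 2 Z" using G(3) by (auto simp: symm_def Z_def less_2_cases_iff)
  have ZS: "tuple 2 Z \<in> SMn 2" by (rule tuple_SMn[OF sZ])
  have "tuple 2 Z \<in> free_spectrahedron_of d A"
  proof (rule free_spectrahedron_iff[OF A(1) ZS, THEN iffD2])
    show "\<forall>\<xi>. 0 \<le> (\<Sum>a<2. \<Sum>b<2. (of_bool (a = b), - entries (tuple 2 Z) a b) \<bullet> hform d (entries A)
        (\<xi> a) (\<xi> b))"
    proof
      fix \<xi> :: "nat \<Rightarrow> nat \<Rightarrow> real"
      let ?h = "hform d (entries A)"
      \<comment> \<open>The substitution that turns values of \<open>G\<close> into values of
        \<open>H\<close>.\<close>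
      let ?p = "\<lambda>i. \<alpha> * \<xi> 0 i + \<beta> * \<xi> 1 i" and ?q = "\<lambda>i. \<delta> * \<xi> 1 i"
      have hs: "?h (\<xi> 1) (\<xi> 0) = ?h (\<xi> 0) (\<xi> 1)" by (rule hform_sym[OF symm_entries[OF A(1)]])
      have pp: "?h ?p ?p = (\<alpha> * \<alpha>) *\<^sub>R ?h (\<xi> 0) (\<xi> 0) + (2 * \<alpha> * \<beta>) *\<^sub>R ?h (\<xi> 0) (\<xi> 1)
          + (\<beta> * \<beta>) *\<^sub>R ?h (\<xi> 1) (\<xi> 1)"
        using hform_quad[OF symm_entries[OF A(1)], of "\<lambda>i. \<alpha> * \<xi> 0 i" \<beta> "\<xi> 1"]
        by (simp add: hform_scale power2_eq_square mult_ac)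
      have pq: "?h ?p ?q = (\<alpha> * \<delta>) *\<^sub>R ?h (\<xi> 0) (\<xi> 1) + (\<beta> * \<delta>) *\<^sub>R ?h (\<xi> 1) (\<xi> 1)"
        unfolding hform_left hform_scale by (simp add: mult_ac)
      have qq: "?h ?q ?q = (\<delta> * \<delta>) *\<^sub>R ?h (\<xi> 1) (\<xi> 1)" by (simp add: hform_scale)
      have "(\<Sum>a<2. \<Sum>b<2. (of_bool (a = b), - entries (tuple 2 Z) a b) \<bullet> ?h (\<xi> a) (\<xi> b))
          = (\<Sum>a<2. \<Sum>b<2. G a b \<bullet> ?h (\<xi> a) (\<xi> b))"
        by (intro sum.cong refl) (simp add: GZ)
      also have "\<dots> = G 0 0 \<bullet> ?h (\<xi> 0) (\<xi> 0) + 2 * (G 0 1 \<bullet> ?h (\<xi> 0) (\<xi> 1)) + G 1 1 \<bullet> ?h (\<xi> 1) (\<xi> 1)"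
        using hs G(3) by (simp add: numeral_2_eq_2)
      also have "\<dots> = H 0 0 \<bullet> ?h ?p ?p + 2 * (H 0 1 \<bullet> ?h ?p ?q) + H 1 1 \<bullet> ?h ?q ?q"
        unfolding pp pq qq G inner_add_left inner_add_right inner_scaleR_left inner_scaleR_right
        by (simp add: algebra_simps)
      finally show "0 \<le> (\<Sum>a<2. \<Sum>b<2. (of_bool (a = b), - entries (tuple 2 Z) a b) \<bullet> ?h (\<xi> a) (\<xi> b))"
        using H(3) by simp
    qed
  qed simp
  then have "tuple 2 Z \<in> Wmin (polar_dual P)" using A(2) by simp
  then obtain m :: nat and \<tau> y where y: "\<forall>l<m. y l \<in> polar_dual P"
    "\<forall>i<2. \<forall>j<2. (of_bool (i = j), entries (tuple 2 Z) i j)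
        = (\<Sum>l<m. (\<tau> l i * \<tau> l j) *\<^sub>R (1 :: real, y l))"
    by (rule Wmin_representation[OF _ ZS]) blast
  have Gy: "G i j = (\<Sum>l<m. (\<tau> l i * \<tau> l j) *\<^sub>R (1, - y l))" if "i < 2" "j < 2" for i j
    using y(2)[rule_format, OF that] that by (simp add: GZ[OF that] prod_eq_iff fst_sum snd_sum
        sum_negf)
  \<comment> \<open>The inverse transposed change of coordinates, carrying the rank one weights of
    \<open>G\<close> back to those of \<open>H\<close>.\<close>
  define \<sigma> :: "nat \<Rightarrow> nat \<Rightarrow> real" where "\<sigma> l = (\<lambda>i. if i
      = 0 then \<tau> l 0 / \<alpha> else \<tau> l 1 / \<delta> - \<beta> / (\<alpha> * \<delta>) * \<tau> l 0)" for l
  have \<tau>: "\<tau> l 0 = \<alpha> * \<sigma> l 0" "\<tau> l 1 = \<beta> * \<sigma> l 0 + \<delta> * \<sigma> l 1" for l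
    using \<alpha>\<delta>(1,2) by (simp_all add: \<sigma>_def field_simps)
  have Hy: "H i j = (\<Sum>l<m. (\<sigma> l i * \<sigma> l j) *\<^sub>R (1, - y l))" if ij: "i < 2" "j < 2" for i j
  proof -
    define K where "K i j = (\<Sum>l<m. (\<sigma> l i * \<sigma> l j) *\<^sub>R (1 :: real, - y l))" for i j
    have i2: "(0::nat) < 2" "(1::nat) < 2" by simp_all
    have K10: "K 1 0 = K 0 1" by (simp add: K_def mult.commute)
    have "G 0 0 = (\<alpha> * \<alpha>) *\<^sub>R K 0 0"
      unfolding Gy[OF i2(1) i2(1)] K_def by (simp add: \<tau> scaleR_sum_right mult_ac)
    then have 00: "H 0 0 = K 0 0" using \<alpha>\<delta>(1) by (simp add: G)
    have "G 0 1 = (\<alpha> * \<beta>) *\<^sub>R K 0 0 + (\<alpha> * \<delta>) *\<^sub>R K 0 1"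
      unfolding Gy[OF i2] K_def scaleR_sum_right sum.distrib[symmetric]
      by (intro sum.cong refl) (simp only: \<tau>, simp add: algebra_simps)
    then have 01: "H 0 1 = K 0 1" using \<alpha>\<delta>(1,2) unfolding G 00 by simp
    have "G 1 1 = (\<beta> * \<beta>) *\<^sub>R K 0 0 + (2 * \<beta> * \<delta>) *\<^sub>R K 0 1 + (\<delta> * \<delta>) *\<^sub>R K 1 1"
      unfolding Gy[OF i2(2) i2(2)] K_def scaleR_sum_right sum.distrib[symmetric]
      by (intro sum.cong refl) (simp only: \<tau>, simp add: algebra_simps)
    then have 11: "H 1 1 = K 1 1" using \<alpha>\<delta>(2) unfolding G 00 01 by simp
    show ?thesis using ij 00 01 11 H10 K10 unfolding K_def[symmetric] by (auto simp: less_2_cases_iff)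
  qed
  \<comment> \<open>\<open>H\<close> is now a sum of functionals of the dual cone with rank one
    weights, each contributing a nonnegative value at \<open>X\<close>.\<close>
  have "(\<Sum>i<2. \<Sum>j<2. H i j \<bullet> hform 2 X (unitv i) (unitv j))
      = (\<Sum>i<2. \<Sum>j<2. \<Sum>l<m. (\<sigma> l i * \<sigma> l j) * ((1, - y l) \<bullet> hform 2 X (unitv i) (unitv j)))"
    by (intro sum.cong refl) (simp only: Hy lessThan_iff inner_sum_left inner_scaleR_left)
  also have "\<dots> = (\<Sum>i<2. \<Sum>l<m. \<Sum>j<2. (\<sigma> l i * \<sigma> l j) * ((1, - y l) \<bullet> hform 2 X (unitv i) (unitv j)))"
    by (rule sum.cong[OF refl], rule sum.swap)
  also have "\<dots> = (\<Sum>l<m. \<Sum>i<2. \<Sum>j<2. (\<sigma> l i * \<sigma> l j) * ((1, - y l) \<bullet> hform 2 X (unitv i) (unitv j)))"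
    by (rule sum.swap)
  also have "\<dots> = (\<Sum>l<m. (1, - y l) \<bullet> hform 2 X (\<sigma> l) (\<sigma> l))"
  proof (intro sum.cong refl)
    fix l
    show "(\<Sum>i<2. \<Sum>j<2. (\<sigma> l i * \<sigma> l j) * ((1, - y l) \<bullet> hform 2 X (unitv i) (unitv j)))
        = (1, - y l) \<bullet> hform 2 X (\<sigma> l) (\<sigma> l)"
      unfolding hform_as_sum[of 2 X "\<sigma> l" "\<sigma> l"] inner_sum_right inner_scaleR_right
      by (intro sum.cong refl) (simp add: hform_unitv)
  qed
  also have "\<dots> \<ge> 0"
  proof (rule sum_nonneg)
    fix l assume "l \<in> {..<m}"
    then have "y l \<in> polar_dual P" using y(1) by simp
    then have "(1, - y l) \<in> dual_cone P"
      by (auto simp: polar_dual_def dual_cone_def inner_minus_left)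
    then show "0 \<le> (1, - y l) \<bullet> hform 2 X (\<sigma> l) (\<sigma> l)" by (rule wmaxD[OF H(2)])
  qed
  finally show False using H(6) by simp
qed

theorem corollary4p6:
  fixes P F :: "(real ^ 'g::finite) set"
  assumes "polytope P"
    and "F face_of P"
    and "aff_dim F = 2"
    and "\<not> (\<exists>n. n simplex F)"
  shows "(\<forall>x. x extreme_point_of F \<longrightarrow> point_tuple x \<notin> crucial_free_extreme (Wmax P)) \<and>
    infinite (free_extreme (Wmax P) // unitarily_equiv) \<and>
    (0 \<in> interior P \<longrightarrow> \<not> is_free_spectrahedron (Wmin (polar_dual P)))"
proof -
  have F: "compact F" "convex F" "F \<noteq> {}"
    using face_of_polytope_polytope[OF assms(1,2)] assms(3)
    by (auto simp: polytope_imp_compact polytope_imp_convex)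
  obtain x where x: "x extreme_point_of F" using extreme_point_exists_convex[OF F] by blast
  show ?thesis
    using vertex_not_crucial[OF assms] infinite_free_extreme_classes[OF assms x]
      Wmin_polar_not_free_spectrahedron[OF assms(1) _ assms(2-4) x] by blast
qed

end
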